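(* The off-diagonal gap satisfies \[ \inf_{m\ge1}A_m=\inf_{m\ge1}\frac{\mu^2m}{2}\Big((m+r-1)+\nu^2(m-r+1)\Big)=\frac{\mu^2}{2}\big(2\nu^2+(1-\nu^2)r\big). \]
   Context: Let $\mathsf h=\ell^2(\mathbb N)$ with canonical orthonormal basis $(e_n)_{n\ge0}$, $Ne_n=ne_n$. Fix $r>0$, $\omega_n=n(n+r-1)$. On $\mathrm{Dom}(N)$ define $Be_n=\omega_n^{1/2}e_{n-1}$ ($n\ge1$), $Be_0=0$, $B^+e_n=\omega_{n+1}^{1/2}e_{n+1}$. Fix real $0<\lambda<\mu$ and $\zeta^\pm\in\mathbb R$, and put $\nu=\lambda/\mu$. Let $G$ on $\mathrm{Dom}(N^2)$ be $Ge_n=-\big((\tfrac{\lambda^2}{2}+i\zeta^+)\omega_{n+1}+(\tfrac{\mu^2}{2}+i\zeta^-)\omega_n\big)e_n$, $P_t=e^{tG}$, $L_1=\mu B$, $L_2=\lambda B^+$, and let $\mathcal T$ be the minimal quantum dynamical semigroup associated with $G,L_1,L_2$ (the minimal solution of $\langle v,\mathcal T_t(x)u\rangle=\langle P_tv,xP_tu\rangle+\sum_{\ell=1}^2\int_0^t\langle L_\ell P_{t-s}v,\mathcal T_s(x)L_\ell P_{t-s}u\rangle ds$), a quantum Markov semigroup with generator formally $\mathcal L(x)=-\frac{\lambda^2}{2}(BB^+x-2BxB^++xBB^+)-\frac{\mu^2}{2}(B^+Bx-2B^+xB+xB^+B)+i[\zeta^+BB^++\zeta^-B^+B,x]$. Let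 $\rho=(1-\nu^2)\sum_n\nu^{2n}|e_n\rangle\langle e_n|$. Let $L_2(\mathsf h)$ be the Hilbert–Schmidt operators with $\langle x,y\rangle=\mathrm{tr}(x^*y)$, $\iota(x)=\rho^{1/4}x\rho^{1/4}$, and let $T=(T_t)$ be the strongly continuous contraction semigroup on $L_2(\mathsf h)$ determined by $T_t(\iota(x))=\iota(\mathcal T_t(x))$, with generator $L$. The Dirichlet form is $\mathcal E(\xi)=-\mathrm{Re}\langle\xi,L(\xi)\rangle$ for $\xi\in D(L)$. For $m\in\mathbb Z$ let $\mathcal G_m$ be the closed linear span in $L_2(\mathsf h)$ of $\{|e_k\rangle\langle e_{k+m}|:k\ge\max\{0,-m\}\}$, and for $m\ne0$ let $A_m=\inf\{\mathcal E(\xi):\|\xi\|=1,\ \xi\in\mathcal G_m\}$. *)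

theory Defs
  imports "HOL-Analysis.Analysis"
begin

text \<open>Vectors of h = l2(N) are coefficient sequences w.r.t. the canonical basis;
  operators are represented by their matrices x i j = <e_i, x e_j>.\<close>

type_synonym vec = "nat \<Rightarrow> complex"
type_synonym mat = "nat \<Rightarrow> nat \<Rightarrow> complex"

definition ell2 :: "vec set" where
  "ell2 = {u. summable (\<lambda>n. (cmod (u n))^2)}"

definition vinner :: "vec \<Rightarrow> vec \<Rightarrow> complex" where
  "vinner u v = (\<Sum>n. cnj (u n) * v n)"

definition vnorm :: "vec \<Rightarrow> real" where
  "vnorm u = sqrt (\<Sum>n. (cmod (u n))^2)"

definition mapply :: "mat \<Rightarrow> vec \<Rightarrow> vec" where
  "mapply x u = (\<lambda>i. \<Sum>j. x i j * u j)"

definition zero_mat :: mat where "zero_mat = (\<lambda>i j. 0)"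

definition bounded_mat :: "mat \<Rightarrow> bool" where
  "bounded_mat x \<longleftrightarrow> (\<exists>C. \<forall>u\<in>ell2. (\<forall>i. summable (\<lambda>j. x i j * u j))
      \<and> mapply x u \<in> ell2 \<and> vnorm (mapply x u) \<le> C * vnorm u)"

definition pos_mat :: "mat \<Rightarrow> bool" where
  "pos_mat x \<longleftrightarrow> bounded_mat x \<and>
     (\<forall>u\<in>ell2. Im (vinner u (mapply x u)) = 0 \<and> Re (vinner u (mapply x u)) \<ge> 0)"

definition mat_le :: "mat \<Rightarrow> mat \<Rightarrow> bool" where
  "mat_le x y \<longleftrightarrow> pos_mat (\<lambda>i j. y i j - x i j)"

definition omega :: "real \<Rightarrow> nat \<Rightarrow> real" where
  "omega r n = real n * (real n + r - 1)"

text \<open>Dom(N^2) = Dom(G).\<close>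
definition domN2 :: "vec set" where
  "domN2 = {u \<in> ell2. summable (\<lambda>n. ((real n)^2 * cmod (u n))^2)}"

text \<open>B e_n = omega_n^(1/2) e_(n-1), B^+ e_n = omega_(n+1)^(1/2) e_(n+1), in coordinates.\<close>
definition opB :: "real \<Rightarrow> vec \<Rightarrow> vec" where
  "opB r u = (\<lambda>n. complex_of_real (sqrt (omega r (Suc n))) * u (Suc n))"

definition opBp :: "real \<Rightarrow> vec \<Rightarrow> vec" where
  "opBp r u = (\<lambda>n. if n = 0 then 0 else complex_of_real (sqrt (omega r n)) * u (n - 1))"

definition gcoef :: "real \<Rightarrow> real \<Rightarrow> real \<Rightarrow> real \<Rightarrow> real \<Rightarrow> nat \<Rightarrow> complex" where
  "gcoef r lam mu zp zm n =
     - ((complex_of_real (lam^2/2) + \<i> * complex_of_real zp) * complex_of_real (omega r (Suc n))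
      + (complex_of_real (mu^2/2) + \<i> * complex_of_real zm) * complex_of_real (omega r n))"

text \<open>P_t = e^{tG} (G is diagonal).\<close>
definition semP :: "real \<Rightarrow> real \<Rightarrow> real \<Rightarrow> real \<Rightarrow> real \<Rightarrow> real \<Rightarrow> vec \<Rightarrow> vec" where
  "semP r lam mu zp zm t u = (\<lambda>n. exp (complex_of_real t * gcoef r lam mu zp zm n) * u n)"

definition opL1 :: "real \<Rightarrow> real \<Rightarrow> vec \<Rightarrow> vec" where
  "opL1 r mu u = (\<lambda>n. complex_of_real mu * opB r u n)"

definition opL2 :: "real \<Rightarrow> real \<Rightarrow> vec \<Rightarrow> vec" where
  "opL2 r lam u = (\<lambda>n. complex_of_real lam * opBp r u n)"

text \<open>A (normalised) solution of the minimal-QDS integral equation: a family of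
  linear positive maps on B(h), t \<ge> 0, satisfying the equation for u, v in Dom(G).
  Outside t \<ge> 0 / B(h) the value is fixed to 0 to make the family unique.\<close>
definition qds_solution :: "real \<Rightarrow> real \<Rightarrow> real \<Rightarrow> real \<Rightarrow> real \<Rightarrow> (real \<Rightarrow> mat \<Rightarrow> mat) \<Rightarrow> bool" where
  "qds_solution r lam mu zp zm S \<longleftrightarrow>
     (\<forall>t x. (t < 0 \<or> \<not> bounded_mat x) \<longrightarrow> S t x = zero_mat) \<and>
     (\<forall>t\<ge>0. \<forall>x. bounded_mat x \<longrightarrow> bounded_mat (S t x)) \<and>
     (\<forall>t\<ge>0. \<forall>x y. bounded_mat x \<longrightarrow> bounded_mat y \<longrightarrow>
          S t (\<lambda>i j. x i j + y i j) = (\<lambda>i j. S t x i j + S t y i j)) \<and>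
     (\<forall>t\<ge>0. \<forall>c x. bounded_mat x \<longrightarrow> S t (\<lambda>i j. c * x i j) = (\<lambda>i j. c * S t x i j)) \<and>
     (\<forall>t\<ge>0. \<forall>x. pos_mat x \<longrightarrow> pos_mat (S t x)) \<and>
     (\<forall>t\<ge>0. \<forall>x. bounded_mat x \<longrightarrow> (\<forall>u\<in>domN2. \<forall>v\<in>domN2. \<exists>I1 I2.
        ((\<lambda>s. vinner (opL1 r mu (semP r lam mu zp zm (t - s) v))
                (mapply (S s x) (opL1 r mu (semP r lam mu zp zm (t - s) u)))) has_integral I1) {0..t} \<and>
        ((\<lambda>s. vinner (opL2 r lam (semP r lam mu zp zm (t - s) v))
                (mapply (S s x) (opL2 r lam (semP r lam mu zp zm (t - s) u)))) has_integral I2) {0..t} \<and>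
        vinner v (mapply (S t x) u) =
          vinner (semP r lam mu zp zm t v) (mapply x (semP r lam mu zp zm t u)) + I1 + I2))"

definition min_qds :: "real \<Rightarrow> real \<Rightarrow> real \<Rightarrow> real \<Rightarrow> real \<Rightarrow> real \<Rightarrow> mat \<Rightarrow> mat" where
  "min_qds r lam mu zp zm = (THE S. qds_solution r lam mu zp zm S \<and>
     (\<forall>S'. qds_solution r lam mu zp zm S' \<longrightarrow>
        (\<forall>t\<ge>0. \<forall>x. pos_mat x \<longrightarrow> mat_le (S t x) (S' t x))))"

definition hs :: "mat set" where
  "hs = {\<xi>. (\<lambda>(i,j). (cmod (\<xi> i j))^2) summable_on UNIV}"

definition hs_inner :: "mat \<Rightarrow> mat \<Rightarrow> complex" where
  "hs_inner \<xi> \<eta> = infsum (\<lambda>(i,j). cnj (\<xi> i j) * \<eta> i j) UNIV"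

definition hs_norm :: "mat \<Rightarrow> real" where
  "hs_norm \<xi> = sqrt (infsum (\<lambda>(i,j). (cmod (\<xi> i j))^2) UNIV)"

text \<open>rho^(1/4), rho = (1-nu^2) sum nu^(2n) |e_n><e_n|, nu = lam/mu.\<close>
definition rho4 :: "real \<Rightarrow> real \<Rightarrow> nat \<Rightarrow> real" where
  "rho4 lam mu n = ((1 - (lam/mu)^2) * (lam/mu)^(2*n)) powr (1/4)"

definition iota :: "real \<Rightarrow> real \<Rightarrow> mat \<Rightarrow> mat" where
  "iota lam mu x = (\<lambda>i j. complex_of_real (rho4 lam mu i) * x i j * complex_of_real (rho4 lam mu j))"

definition hs_sg :: "real \<Rightarrow> real \<Rightarrow> real \<Rightarrow> real \<Rightarrow> real \<Rightarrow> real \<Rightarrow> mat \<Rightarrow> mat" where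
  "hs_sg r lam mu zp zm = (THE T.
     (\<forall>t \<xi>. (t < 0 \<or> \<xi> \<notin> hs) \<longrightarrow> T t \<xi> = zero_mat) \<and>
     (\<forall>t\<ge>0. \<forall>\<xi>\<in>hs. T t \<xi> \<in> hs \<and> hs_norm (T t \<xi>) \<le> hs_norm \<xi>) \<and>
     (\<forall>t\<ge>0. \<forall>\<xi>\<in>hs. \<forall>\<eta>\<in>hs. T t (\<lambda>i j. \<xi> i j + \<eta> i j) = (\<lambda>i j. T t \<xi> i j + T t \<eta> i j)) \<and>
     (\<forall>t\<ge>0. \<forall>c. \<forall>\<xi>\<in>hs. T t (\<lambda>i j. c * \<xi> i j) = (\<lambda>i j. c * T t \<xi> i j)) \<and>
     (\<forall>t\<ge>0. \<forall>x. bounded_mat x \<longrightarrow> T t (iota lam mu x) = iota lam mu (min_qds r lam mu zp zm t x)))"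

definition gen_conv :: "real \<Rightarrow> real \<Rightarrow> real \<Rightarrow> real \<Rightarrow> real \<Rightarrow> mat \<Rightarrow> mat \<Rightarrow> bool" where
  "gen_conv r lam mu zp zm \<xi> \<eta> \<longleftrightarrow> \<eta> \<in> hs \<and>
     ((\<lambda>t. hs_norm (\<lambda>i j. (hs_sg r lam mu zp zm t \<xi> i j - \<xi> i j) / complex_of_real t - \<eta> i j))
        \<longlongrightarrow> 0) (at_right 0)"

definition dom_gen :: "real \<Rightarrow> real \<Rightarrow> real \<Rightarrow> real \<Rightarrow> real \<Rightarrow> mat set" where
  "dom_gen r lam mu zp zm = {\<xi> \<in> hs. \<exists>\<eta>. gen_conv r lam mu zp zm \<xi> \<eta>}"

definition gen :: "real \<Rightarrow> real \<Rightarrow> real \<Rightarrow> real \<Rightarrow> real \<Rightarrow> mat \<Rightarrow> mat" where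
  "gen r lam mu zp zm \<xi> = (THE \<eta>. gen_conv r lam mu zp zm \<xi> \<eta>)"

definition dirichlet :: "real \<Rightarrow> real \<Rightarrow> real \<Rightarrow> real \<Rightarrow> real \<Rightarrow> mat \<Rightarrow> real" where
  "dirichlet r lam mu zp zm \<xi> = - Re (hs_inner \<xi> (gen r lam mu zp zm \<xi>))"

text \<open>G_m: closed linear span in L_2(h) of |e_k><e_(k+m)|, k \<ge> max 0 (-m).\<close>
definition Gsub :: "int \<Rightarrow> mat set" where
  "Gsub m = {\<xi> \<in> hs. \<forall>\<epsilon>>0. \<exists>F c. finite F \<and> (\<forall>k\<in>F. int k + m \<ge> 0) \<and>
     hs_norm (\<lambda>i j. \<xi> i j - (\<Sum>k\<in>F. c k * (if i = k \<and> int j = int k + m then 1 else 0))) < \<epsilon>}"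

definition gapA :: "real \<Rightarrow> real \<Rightarrow> real \<Rightarrow> real \<Rightarrow> real \<Rightarrow> int \<Rightarrow> real" where
  "gapA r lam mu zp zm m = Inf {dirichlet r lam mu zp zm \<xi> | \<xi>.
      \<xi> \<in> dom_gen r lam mu zp zm \<and> hs_norm \<xi> = 1 \<and> \<xi> \<in> Gsub m}"

end

theory Submission
  imports Defs
begin

text \<open>The generator preserves every diagonal and, after conjugation by \<open>\<rho>\<^bsup>1/4\<^esup>\<close>, acts on the \<open>m\<close>-th
  one as a Jacobi matrix whose real part is symmetric. For \<open>m \<ge> 1\<close> this real part has the
  positive square-summable eigenvector \<open>\<nu>\<^bsup>k\<^esup> s\<^sub>k\<close> with
  \<open>s\<^sub>k\<^sup>2 = (k+1)\<dots>(k+m) / ((k+r)\<dots>(k+m+r-1))\<close> and eigenvalue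
  \<open>-m/2 (\<mu>\<^sup>2(m+r-1) + \<lambda>\<^sup>2(m-r+1))\<close>. Positivity of the eigenvector turns it into a weight for the
  ground-state inequality, which gives the decay rate of the semigroup on the whole diagonal, and
  the eigenvector itself attains the infimum. The minimal semigroup is the entrywise sum of its
  Dyson series in the number of jumps; the phases \<open>\<zeta>\<^sup>\<plusminus>\<close> only enter through the diagonal
  factors, so every Dyson term is dominated by the one with \<open>\<zeta>\<^sup>\<plusminus> = 0\<close>, for which the
  eigenvector is a supersolution.\<close>

section \<open>Iterated Duhamel expansions of jump evolutions\<close>

text \<open>Both semigroups are introduced by definite descriptions, so each explicit candidate must
  be shown to satisfy the defining clauses and to be the only object that does. Nothing is known
  beforehand about the domain of the generator. The lower bound therefore never computes
  \<open>L\<close>: it compares right derivatives at time zero, using decay of the semigroup alone,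
  and only one vector per diagonal has to be placed in the domain by hand. The jump rates are
  unbounded, which makes formal energy computations unsafe. Working with partial sums of the Dyson
  series avoids this: \<open>n\<close> jumps spread a finite support by \<open>n\<close> steps, so
  every energy is a finite sum and there are no boundary terms at infinity. The eigenvector is found
  by asking which ratio of neighbouring values turns the square roots in the jump rates into
  polynomials. With the stated \<open>s\<close>, the rate upwards becomes
  \<open>(k+r)(k+m+1)\<close> and the rate downwards \<open>k(k+m+r-1)\<close>; against the diagonal
  coefficient all terms depending on \<open>k\<close> cancel, and the constant left over is the
  eigenvalue.\<close>

text \<open>Truncated subtraction reads a wrong entry when \<open>i = 0\<close> or \<open>j = 0\<close>; the coefficient \<open>a i j\<close>
  vanishes there in all uses.\<close>

definition jump :: "(nat \<Rightarrow> nat \<Rightarrow> real) \<Rightarrow> (nat \<Rightarrow> nat \<Rightarrow> real) \<Rightarrow> (nat \<Rightarrow> nat \<Rightarrow> 'a::real_normed_field)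
    \<Rightarrow> nat \<Rightarrow> nat \<Rightarrow> 'a" where
  "jump a b y i j = of_real (a i j) * y (i - 1) (j - 1) + of_real (b i j) * y (Suc i) (Suc j)"

text \<open>The index counts jumps. The value type stays generic so that the complex evolution and
  its real majorant are instances of one recursion.\<close>

primrec dyson :: "(nat \<Rightarrow> nat \<Rightarrow> real) \<Rightarrow> (nat \<Rightarrow> nat \<Rightarrow> real) \<Rightarrow> (nat \<Rightarrow> nat \<Rightarrow> 'a::{real_normed_field,banach})
    \<Rightarrow> nat \<Rightarrow> real \<Rightarrow> (nat \<Rightarrow> nat \<Rightarrow> 'a) \<Rightarrow> nat \<Rightarrow> nat \<Rightarrow> 'a" where
  "dyson a b c 0 t x = (\<lambda>i j. exp (of_real t * c i j) * x i j)"
| "dyson a b c (Suc n) t x = (\<lambda>i j. integral {0..t}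
      (\<lambda>s. exp (of_real (t - s) * c i j) * jump a b (dyson a b c n s x) i j))"

text \<open>Pulling \<open>exp (t * c)\<close> out of the convolution leaves an indefinite integral
  whose integrand no longer depends on \<open>t\<close>, so the product rule applies.\<close>

lemma duhamel_deriv:
  fixes h :: "real \<Rightarrow> 'a::{real_normed_field,banach}"
  assumes h: "continuous_on {0..T} h" and t: "t \<in> {0..T}"
  shows "((\<lambda>t. integral {0..t} (\<lambda>s. exp (of_real (t - s) * c) * h s)) has_vector_derivative
      c * integral {0..t} (\<lambda>s. exp (of_real (t - s) * c) * h s) + h t) (at t within {0..T})"
proof -
  define k where "k s = exp (- (of_real s * c)) * h s" for s
  have k: "continuous_on {0..T} k"
    unfolding k_def by (intro continuous_intros h)
  have eq: "integral {0..t} (\<lambda>s. exp (of_real (t - s) * c) * h s) = exp (of_real t * c) * integral {0..t} k" for t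
  proof -
    have "integral {0..t} (\<lambda>s. exp (of_real (t - s) * c) * h s) = integral {0..t} (\<lambda>s. exp (of_real t * c) * k s)"
      by (intro integral_cong) (simp add: k_def algebra_simps exp_add[symmetric] flip: mult.assoc)
    then show ?thesis by simp
  qed
  have e: "((\<lambda>t. exp (of_real t * c)) has_vector_derivative (exp (of_real t * c) * c)) (at t within {0..T})"
  proof -
    have "((\<lambda>t. exp (t *\<^sub>R c)) has_vector_derivative (exp (t *\<^sub>R c) * c)) (at t within {0..T})"
      by (rule exp_scaleR_has_vector_derivative_right)
    then show ?thesis by (simp add: scaleR_conv_of_real)
  qed
  have "((\<lambda>t. exp (of_real t * c) * integral {0..t} k) has_vector_derivative
      (exp (of_real t * c) * k t + exp (of_real t * c) * c * integral {0..t} k)) (at t within {0..T})"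
    by (rule has_vector_derivative_mult[OF e integral_has_vector_derivative[OF k t]])
  moreover have "exp (of_real t * c) * k t = h t"
    by (simp add: k_def exp_minus flip: mult.assoc)
  ultimately show ?thesis
    unfolding eq by (simp add: algebra_simps)
qed

lemma duhamel_cont:
  fixes h :: "real \<Rightarrow> 'a::{real_normed_field,banach}"
  assumes h: "continuous_on {0..T} h"
  shows "continuous_on {0..T} (\<lambda>t. integral {0..t} (\<lambda>s. exp (of_real (t - s) * c) * h s))"
  using duhamel_deriv[OF h] continuous_on_eq_continuous_within has_vector_derivative_continuous by blast

lemma dyson_cont: "continuous_on {0..T} (\<lambda>t. dyson a b c n t x i j)"
proof (induction n arbitrary: i j)
  case 0
  show ?case by (auto intro!: continuous_intros)
next
  case (Suc n)
  have "continuous_on {0..T} (\<lambda>s. jump a b (dyson a b c n s x) i j)" for i j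
    unfolding jump_def by (intro continuous_intros Suc)
  from duhamel_cont[OF this] show ?case by simp
qed

lemma dyson_jump_cont: "continuous_on {0..T} (\<lambda>s. jump a b (dyson a b c n s x) i j)"
  unfolding jump_def by (intro continuous_intros dyson_cont)

lemma dyson_integrand_cont:
  "continuous_on {0..T} (\<lambda>s. exp (of_real (t - s) * c i j) * jump a b (dyson a b c n s x) i j)"
  by (intro continuous_intros dyson_jump_cont)

lemma dyson_integrand_integrable:
  "(\<lambda>s. exp (of_real (t - s) * c i j) * jump a b (dyson a b c n s x) i j) integrable_on {0..T}"
  by (rule integrable_continuous_real[OF dyson_integrand_cont])

lemma dyson_add: "dyson a b c n t (\<lambda>i j. x i j + y i j) i j = dyson a b c n t x i j + dyson a b c n t y i j"
proof (induction n arbitrary: t i j)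
  case (Suc n)
  have "(\<lambda>s. exp (of_real (t - s) * c i j) * jump a b (dyson a b c n s (\<lambda>i j. x i j + y i j)) i j) =
      (\<lambda>s. exp (of_real (t - s) * c i j) * jump a b (dyson a b c n s x) i j
         + exp (of_real (t - s) * c i j) * jump a b (dyson a b c n s y) i j)"
    by (simp add: jump_def Suc algebra_simps)
  then show ?case
    unfolding dyson.simps
    by (simp only: Henstock_Kurzweil_Integration.integral_add[OF dyson_integrand_integrable dyson_integrand_integrable])
qed (simp add: algebra_simps)

lemma dyson_cmult: "dyson a b c n t (\<lambda>i j. k * x i j) i j = k * dyson a b c n t x i j"
proof (induction n arbitrary: t i j)
  case (Suc n)
  have "(\<lambda>s. exp (of_real (t - s) * c i j) * jump a b (dyson a b c n s (\<lambda>i j. k * x i j)) i j) =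
      (\<lambda>s. k * (exp (of_real (t - s) * c i j) * jump a b (dyson a b c n s x) i j))"
    by (simp add: jump_def Suc algebra_simps)
  then show ?case by simp
qed (simp add: algebra_simps)

lemma dyson_sum_Suc:
  "(\<Sum>n<Suc N. dyson a b c n t x i j) = exp (of_real t * c i j) * x i j +
     integral {0..t} (\<lambda>s. exp (of_real (t - s) * c i j) * jump a b (\<lambda>i j. \<Sum>n<N. dyson a b c n s x i j) i j)"
proof -
  have "(\<Sum>n<Suc N. dyson a b c n t x i j) = exp (of_real t * c i j) * x i j +
     (\<Sum>n<N. integral {0..t} (\<lambda>s. exp (of_real (t - s) * c i j) * jump a b (dyson a b c n s x) i j))"
    by (subst sum.lessThan_Suc_shift) simp
  also have "(\<Sum>n<N. integral {0..t} (\<lambda>s. exp (of_real (t - s) * c i j) * jump a b (dyson a b c n s x) i j))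
     = integral {0..t} (\<lambda>s. \<Sum>n<N. exp (of_real (t - s) * c i j) * jump a b (dyson a b c n s x) i j)"
    by (rule integral_sum[symmetric]) (simp_all only: finite_lessThan dyson_integrand_integrable)
  also have "\<dots> = integral {0..t} (\<lambda>s. exp (of_real (t - s) * c i j) * jump a b (\<lambda>i j. \<Sum>n<N. dyson a b c n s x i j) i j)"
    by (intro integral_cong) (simp add: jump_def sum_distrib_left sum.distrib algebra_simps)
  finally show ?thesis .
qed

lemma dyson_sum_jump_cont: "continuous_on {0..T} (\<lambda>s. jump a b (\<lambda>i j. \<Sum>n<N. dyson a b c n s x i j) i j)"
  unfolding jump_def by (intro continuous_intros dyson_cont)

text \<open>The sum over at most \<open>N\<close> jumps is driven by the sum over at most
  \<open>N - 1\<close> jumps; this mismatch of one index is what the energy estimate has to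
  repair.\<close>

lemma dyson_sum_deriv:
  assumes t: "t \<in> {0..T}"
  shows "((\<lambda>t. \<Sum>n<Suc N. dyson a b c n t x i j) has_vector_derivative
     c i j * (\<Sum>n<Suc N. dyson a b c n t x i j) + jump a b (\<lambda>i j. \<Sum>n<N. dyson a b c n t x i j) i j) (at t within {0..T})"
proof -
  have e: "((\<lambda>t. exp (of_real t * c i j)) has_vector_derivative (exp (of_real t * c i j) * c i j)) (at t within {0..T})"
    using exp_scaleR_has_vector_derivative_right[where A="c i j" and t=t and T="{0..T}"] by (simp add: scaleR_conv_of_real)
  have e': "((\<lambda>t. exp (of_real t * c i j) * x i j) has_vector_derivative (exp (of_real t * c i j) * c i j) * x i j) (at t within {0..T})"
    by (rule has_vector_derivative_mult_left[OF e])
  show ?thesis unfolding dyson_sum_Suc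
    using has_vector_derivative_add[OF e' duhamel_deriv[OF dyson_sum_jump_cont t, of "c i j"]]
    by (simp add: algebra_simps)
qed

text \<open>Each jump moves one step along a diagonal, so \<open>n\<close> jumps read at most
  \<open>n\<close> steps further out. This allows an infinite matrix to be replaced by a
  truncation.\<close>

lemma dyson_local:
  assumes "\<And>i' j'. i' \<le> i + n \<Longrightarrow> j' \<le> j + n \<Longrightarrow> x i' j' = y i' j'"
  shows "dyson a b c n t x i j = dyson a b c n t y i j"
  using assms
proof (induction n arbitrary: t i j)
  case (Suc n)
  have "dyson a b c n s x (i - 1) (j - 1) = dyson a b c n s y (i - 1) (j - 1)" for s
    by (rule Suc.IH) (use Suc.prems in auto)
  moreover have "dyson a b c n s x (Suc i) (Suc j) = dyson a b c n s y (Suc i) (Suc j)" for s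
    by (rule Suc.IH) (use Suc.prems in auto)
  ultimately show ?case by (simp add: jump_def)
qed simp

lemma dyson_support:
  assumes "\<And>i j. i \<ge> M \<or> j \<ge> M \<Longrightarrow> x i j = 0"
  shows "i \<ge> M + n \<or> j \<ge> M + n \<Longrightarrow> dyson a b c n t x i j = 0"
proof (induction n arbitrary: t i j)
  case (Suc n)
  have "dyson a b c n s x (i - 1) (j - 1) = 0" for s
    by (rule Suc.IH) (use Suc.prems in auto)
  moreover have "dyson a b c n s x (Suc i) (Suc j) = 0" for s
    by (rule Suc.IH) (use Suc.prems in auto)
  ultimately show ?case by (simp add: jump_def)
qed (use assms in auto)

section \<open>Domination and supersolutions for nonnegative jump rates\<close>

locale jumps =
  fixes a b :: "nat \<Rightarrow> nat \<Rightarrow> real"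
  assumes a_nonneg: "a i j \<ge> 0" and b_nonneg: "b i j \<ge> 0"
    and a_0_left [simp]: "a 0 j = 0" and a_0_right [simp]: "a i 0 = 0"
begin

text \<open>In the interior a jump preserves \<open>j - i\<close>. On the boundary truncated
  subtraction could change it, but there the coefficient \<open>a\<close> vanishes.\<close>

lemma dyson_diag:
  fixes P :: "int \<Rightarrow> bool"
  assumes "\<And>i j. \<not> P (int j - int i) \<Longrightarrow> x i j = 0"
  shows "\<not> P (int j - int i) \<Longrightarrow> dyson a b c n t x i j = 0"
proof (induction n arbitrary: t i j)
  case (Suc n)
  have "of_real (a i j) * dyson a b c n s x (i - 1) (j - 1) = 0" for s
  proof (cases "i = 0 \<or> j = 0")
    case False
    then have "dyson a b c n s x (i - 1) (j - 1) = 0"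
      by (intro Suc.IH) (use Suc.prems in \<open>auto simp: of_nat_diff\<close>)
    then show ?thesis by simp
  qed auto
  moreover have "dyson a b c n s x (Suc i) (Suc j) = 0" for s
    by (rule Suc.IH) (use Suc.prems in auto)
  ultimately have "jump a b (dyson a b c n s x) i j = 0" for s
    by (simp add: jump_def)
  then show ?case by simp
qed (use assms in auto)

lemma jump_norm_le:
  assumes "\<And>i j. norm (x i j) \<le> y i j"
  shows "norm (jump a b x i j) \<le> jump a b y i j"
proof -
  have "norm (jump a b x i j) \<le> norm (of_real (a i j) * x (i-1) (j-1)) + norm (of_real (b i j) * x (Suc i) (Suc j))"
    unfolding jump_def by (rule norm_triangle_ineq)
  also have "\<dots> = a i j * norm (x (i-1) (j-1)) + b i j * norm (x (Suc i) (Suc j))"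
    by (simp add: norm_mult a_nonneg b_nonneg)
  also have "\<dots> \<le> jump a b y i j"
    unfolding jump_def by (auto intro!: add_mono mult_left_mono assms a_nonneg b_nonneg)
  finally show ?thesis .
qed

text \<open>Phases disappear at this point: the rates are nonnegative, so only the modulus of the
  exponential factor survives the triangle inequality.\<close>

lemma dyson_norm_le:
  fixes c' :: "nat \<Rightarrow> nat \<Rightarrow> real"
  assumes c: "\<And>i j t. 0 \<le> t \<Longrightarrow> norm (exp (of_real t * c i j)) \<le> exp (t * c' i j)"
    and x: "\<And>i j. norm (x i j) \<le> y i j"
  shows "0 \<le> t \<Longrightarrow> norm (dyson a b c n t x i j) \<le> dyson a b c' n t y i j"
proof (induction n arbitrary: t i j)
  case 0
  then show ?case by (auto simp: norm_mult intro!: mult_mono c x)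
next
  case (Suc n)
  show ?case unfolding dyson.simps
  proof (rule integral_norm_bound_integral[OF dyson_integrand_integrable dyson_integrand_integrable])
    fix s assume s: "s \<in> {0..t}"
    have "norm (jump a b (dyson a b c n s x) i j) \<le> jump a b (dyson a b c' n s y) i j"
      by (rule jump_norm_le) (use s Suc.IH in auto)
    then show "norm (exp (of_real (t - s) * c i j) * jump a b (dyson a b c n s x) i j)
      \<le> exp (of_real (t - s) * c' i j) * jump a b (dyson a b c' n s y) i j"
      using s c[of "t-s" i j] by (auto simp: norm_mult intro!: mult_mono)
  qed
qed

lemma dyson_nonneg:
  fixes c y :: "nat \<Rightarrow> nat \<Rightarrow> real"
  assumes "\<And>i j. 0 \<le> y i j" "0 \<le> t"
  shows "0 \<le> dyson a b c n t y i j"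
  using dyson_norm_le[of c c y y t n i j] assms norm_ge_zero order_trans by fastforce

text \<open>Comparison principle, by induction on the number of jumps:
  \<open>exp (- \<kappa> * t) * h\<close> is a supersolution of the Duhamel recursion. The predicate
  \<open>P\<close> confines the hypothesis to chosen diagonals, which jumps do not leave.\<close>

lemma dyson_super:
  fixes c h :: "nat \<Rightarrow> nat \<Rightarrow> real" and P :: "int \<Rightarrow> bool"
  assumes h: "\<And>i j. P (int j - int i) \<Longrightarrow> jump a b h i j \<le> (- c i j - \<kappa>) * h i j"
  shows "0 \<le> t \<Longrightarrow> P (int j - int i) \<Longrightarrow> (\<And>i j. h i j \<ge> 0) \<Longrightarrow>
     (\<Sum>n<N. dyson a b c n t h i j) \<le> exp (- \<kappa> * t) * h i j"
proof (induction N arbitrary: t i j)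
  case (Suc N)
  note t = Suc.prems(1) and P = Suc.prems(2)
  let ?A = "\<lambda>s i j. \<Sum>n<N. dyson a b c n s h i j"
  have J: "jump a b (?A s) i j \<le> exp (- \<kappa> * s) * ((- c i j - \<kappa>) * h i j)" if s: "s \<ge> 0" for s
  proof -
    have 1: "a i j * ?A s (i-1) (j-1) \<le> a i j * (exp (- \<kappa> * s) * h (i-1) (j-1))"
    proof (cases "i = 0 \<or> j = 0")
      case False
      have "?A s (i-1) (j-1) \<le> exp (- \<kappa> * s) * h (i-1) (j-1)"
        by (rule Suc.IH) (use False P s Suc.prems(3) in \<open>auto simp: of_nat_diff\<close>)
      then show ?thesis by (intro mult_left_mono a_nonneg)
    qed auto
    have "?A s (Suc i) (Suc j) \<le> exp (- \<kappa> * s) * h (Suc i) (Suc j)"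
      by (rule Suc.IH) (use P s Suc.prems(3) in auto)
    then have 2: "b i j * ?A s (Suc i) (Suc j) \<le> b i j * (exp (- \<kappa> * s) * h (Suc i) (Suc j))"
      by (intro mult_left_mono b_nonneg)
    have "jump a b (?A s) i j \<le> exp (- \<kappa> * s) * jump a b h i j"
      using 1 2 by (simp add: jump_def algebra_simps)
    also have "\<dots> \<le> exp (- \<kappa> * s) * ((- c i j - \<kappa>) * h i j)"
      by (intro mult_left_mono h P) auto
    finally show ?thesis .
  qed
  \<comment> \<open>The derivative of \<open>F\<close> is exactly the bound for the Duhamel
    integrand, and \<open>F t - F 0\<close> plus the term without jumps is
    \<open>exp (- \<kappa> * t) * h i j\<close>.\<close>
  define F where "F s = exp ((t - s) * c i j + (- \<kappa> * s)) * h i j" for s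
  have F: "((\<lambda>s. (- c i j - \<kappa>) * F s) has_integral (F t - F 0)) {0..t}"
  proof (rule fundamental_theorem_of_calculus[OF t])
    fix s
    have "(F has_real_derivative (- c i j - \<kappa>) * F s) (at s within {0..t})"
      unfolding F_def by (auto intro!: derivative_eq_intros simp: algebra_simps)
    then show "(F has_vector_derivative (- c i j - \<kappa>) * F s) (at s within {0..t})"
      by (rule has_real_derivative_iff_has_vector_derivative[THEN iffD1])
  qed
  have A: "((\<lambda>s. exp (of_real (t - s) * c i j) * jump a b (?A s) i j) has_integral
      integral {0..t} (\<lambda>s. exp (of_real (t - s) * c i j) * jump a b (?A s) i j)) {0..t}" (is "(?f has_integral _) _")
    by (intro integrable_integral integrable_continuous_real continuous_intros dyson_sum_jump_cont)
  have "integral {0..t} ?f \<le> F t - F 0"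
  proof (rule has_integral_le[OF A F])
    fix s assume s: "s \<in> {0..t}"
    have "exp (of_real (t - s) * c i j) * jump a b (?A s) i j
        \<le> exp ((t - s) * c i j) * (exp (- \<kappa> * s) * ((- c i j - \<kappa>) * h i j))"
      using J[of s] s by (auto intro!: mult_left_mono)
    also have "\<dots> = (- c i j - \<kappa>) * F s"
      by (simp add: F_def mult_exp_exp)
    finally show "exp (of_real (t - s) * c i j) * jump a b (?A s) i j \<le> (- c i j - \<kappa>) * F s" .
  qed
  then show ?case
    unfolding dyson_sum_Suc by (simp add: F_def)
qed simp

end

lemma sum_square_shift:
  fixes f :: "nat \<Rightarrow> nat \<Rightarrow> 'a::comm_monoid_add"
  assumes "\<And>j. f 0 j = 0" "\<And>i. f i 0 = 0"
  shows "(\<Sum>i<Suc K. \<Sum>j<Suc K. f i j) = (\<Sum>i<K. \<Sum>j<K. f (Suc i) (Suc j))"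
  using assms by (simp only: sum.lessThan_Suc_shift) simp

lemma sum_square_extend:
  fixes f :: "nat \<Rightarrow> nat \<Rightarrow> 'a::comm_monoid_add"
  assumes "\<And>i j. i \<ge> K \<or> j \<ge> K \<Longrightarrow> f i j = 0" "K \<le> L"
  shows "(\<Sum>i<L. \<Sum>j<L. f i j) = (\<Sum>i<K. \<Sum>j<K. f i j)"
proof -
  have "(\<Sum>i<L. \<Sum>j<L. f i j) = (\<Sum>i<L. \<Sum>j<K. f i j)"
    using assms by (intro sum.cong refl sum.mono_neutral_right) auto
  also have "\<dots> = (\<Sum>i<K. \<Sum>j<K. f i j)"
    using assms by (intro sum.mono_neutral_right) (auto intro!: sum.neutral)
  finally show ?thesis .
qed

lemma two_mult_le_weighted:
  fixes x y p q :: real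
  assumes "p > 0" "q > 0"
  shows "2 * (x * y) \<le> x\<^sup>2 * q / p + y\<^sup>2 * p / q"
proof -
  have "0 \<le> (x * q - y * p)\<^sup>2 / (p * q)"
    using assms by simp
  also have "\<dots> = x\<^sup>2 * q / p + y\<^sup>2 * p / q - 2 * (x * y)"
    using assms by (simp add: power2_eq_square field_simps)
  finally show ?thesis by simp
qed

section \<open>Energy decay under detailed balance\<close>

locale reversible_jumps = jumps +
  fixes w :: "nat \<Rightarrow> nat \<Rightarrow> real"
  assumes w_pos: "w i j > 0"
    and balance: "(w i j)\<^sup>2 * b i j = (w (Suc i) (Suc j))\<^sup>2 * a (Suc i) (Suc j)"
begin

text \<open>Ground-state inequality: each off-diagonal product is split by AM--GM with weights
  \<open>h (Suc i) (Suc j) / h i j\<close>, which reassembles to \<open>jump a b h / h\<close>.\<close>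

lemma jump_form_le:
  fixes c h y :: "nat \<Rightarrow> nat \<Rightarrow> real"
  assumes h: "\<And>i j. y i j \<noteq> 0 \<Longrightarrow> jump a b h i j \<le> (- c i j - \<kappa>) * h i j"
    and hpos: "\<And>i j. h i j > 0"
    and supp: "\<And>i j. i \<ge> K \<or> j \<ge> K \<Longrightarrow> y i j = 0"
  shows "(\<Sum>i<K. \<Sum>j<K. (w i j)\<^sup>2 * y i j * (c i j * y i j + jump a b y i j))
     \<le> - \<kappa> * (\<Sum>i<K. \<Sum>j<K. (w i j)\<^sup>2 * (y i j)\<^sup>2)"
proof -
  define Q where "Q i j = (w i j)\<^sup>2 * b i j" for i j
  define R where "R i j = (w i j)\<^sup>2 * a i j" for i j
  have RQ: "R (Suc i) (Suc j) = Q i j" for i j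
    by (simp add: Q_def R_def balance)
  have R0 [simp]: "R 0 j = 0" "R i 0 = 0" for i j
    by (simp_all add: R_def)
  have Q0: "Q i j \<ge> 0" for i j
    by (simp add: Q_def b_nonneg)
  have ext: "(\<Sum>i<K. \<Sum>j<K. f i j) = (\<Sum>i<Suc K. \<Sum>j<Suc K. f i j)"
    if "\<And>i j. i \<ge> K \<or> j \<ge> K \<Longrightarrow> f i j = 0" for f :: "nat \<Rightarrow> nat \<Rightarrow> real"
    by (rule sum_square_extend[symmetric]) (use that in auto)
  have down: "(\<Sum>i<K. \<Sum>j<K. R i j * f i j (i - 1) (j - 1))
      = (\<Sum>i<K. \<Sum>j<K. Q i j * f (Suc i) (Suc j) i j)"
    if "\<And>i j i' j'. i \<ge> K \<or> j \<ge> K \<Longrightarrow> f i j i' j' = 0" for f :: "nat \<Rightarrow> nat \<Rightarrow> nat \<Rightarrow> nat \<Rightarrow> real"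
  proof -
    have "(\<Sum>i<K. \<Sum>j<K. R i j * f i j (i - 1) (j - 1))
        = (\<Sum>i<Suc K. \<Sum>j<Suc K. R i j * f i j (i - 1) (j - 1))"
      by (rule ext) (use that in auto)
    also have "\<dots> = (\<Sum>i<K. \<Sum>j<K. R (Suc i) (Suc j) * f (Suc i) (Suc j) (Suc i - 1) (Suc j - 1))"
      by (rule sum_square_shift) auto
    finally show ?thesis by (simp add: RQ)
  qed
  have "(\<Sum>i<K. \<Sum>j<K. (w i j)\<^sup>2 * y i j * jump a b y i j)
     = (\<Sum>i<K. \<Sum>j<K. R i j * (y i j * y (i - 1) (j - 1))) + (\<Sum>i<K. \<Sum>j<K. Q i j * (y i j * y (Suc i) (Suc j)))"
    by (simp add: jump_def Q_def R_def sum.distrib algebra_simps)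
  also have "(\<Sum>i<K. \<Sum>j<K. R i j * (y i j * y (i - 1) (j - 1))) = (\<Sum>i<K. \<Sum>j<K. Q i j * (y i j * y (Suc i) (Suc j)))"
    by (subst down[of "\<lambda>i j i' j'. y i j * y i' j'"]) (simp_all add: supp mult_ac)
  also have "\<dots> + (\<Sum>i<K. \<Sum>j<K. Q i j * (y i j * y (Suc i) (Suc j)))
      = (\<Sum>i<K. \<Sum>j<K. Q i j * (2 * (y i j * y (Suc i) (Suc j))))"
    by (simp add: sum.distrib[symmetric] mult_ac)
  also have "\<dots> \<le> (\<Sum>i<K. \<Sum>j<K. Q i j * ((y i j)\<^sup>2 * h (Suc i) (Suc j) / h i j + (y (Suc i) (Suc j))\<^sup>2 * h i j / h (Suc i) (Suc j)))"
    by (intro sum_mono mult_left_mono two_mult_le_weighted hpos Q0)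
  also have "\<dots> = (\<Sum>i<K. \<Sum>j<K. Q i j * ((y i j)\<^sup>2 * h (Suc i) (Suc j) / h i j))
      + (\<Sum>i<K. \<Sum>j<K. Q i j * ((y (Suc i) (Suc j))\<^sup>2 * h i j / h (Suc i) (Suc j)))"
    by (simp add: sum.distrib distrib_left)
  also have "(\<Sum>i<K. \<Sum>j<K. Q i j * ((y (Suc i) (Suc j))\<^sup>2 * h i j / h (Suc i) (Suc j)))
      = (\<Sum>i<K. \<Sum>j<K. R i j * ((y i j)\<^sup>2 * h (i - 1) (j - 1) / h i j))"
    by (subst down[of "\<lambda>i j i' j'. (y i j)\<^sup>2 * h i' j' / h i j"]) (simp_all add: supp)
  also have "(\<Sum>i<K. \<Sum>j<K. Q i j * ((y i j)\<^sup>2 * h (Suc i) (Suc j) / h i j)) + \<dots>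
      = (\<Sum>i<K. \<Sum>j<K. (w i j)\<^sup>2 * (y i j)\<^sup>2 * (jump a b h i j / h i j))"
    by (simp add: jump_def Q_def R_def sum.distrib[symmetric] add_divide_distrib algebra_simps)
  also have "\<dots> \<le> (\<Sum>i<K. \<Sum>j<K. (w i j)\<^sup>2 * (y i j)\<^sup>2 * (- c i j - \<kappa>))"
  proof (intro sum_mono)
    fix i j
    show "(w i j)\<^sup>2 * (y i j)\<^sup>2 * (jump a b h i j / h i j) \<le> (w i j)\<^sup>2 * (y i j)\<^sup>2 * (- c i j - \<kappa>)"
    proof (cases "y i j = 0")
      case False
      then have "jump a b h i j / h i j \<le> - c i j - \<kappa>"
        using h[of i j] hpos[of i j] by (simp add: field_simps)
      then show ?thesis by (intro mult_left_mono) auto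
    qed simp
  qed
  finally show ?thesis
    by (simp add: sum.distrib algebra_simps power2_eq_square sum_subtractf sum_negf sum_distrib_left)
qed

text \<open>A differential inequality for a finite energy. The condition
  \<open>K \<ge> M + N\<close> keeps the whole support of the partial sum inside the square, so that
  the ground-state inequality applies at each time.\<close>

lemma dyson_energy:
  fixes c h y :: "nat \<Rightarrow> nat \<Rightarrow> real" and P :: "int \<Rightarrow> bool"
  assumes h: "\<And>i j. P (int j - int i) \<Longrightarrow> jump a b h i j \<le> (- c i j - \<kappa>) * h i j"
    and hpos: "\<And>i j. h i j > 0"
    and y0: "\<And>i j. y i j \<ge> 0"
    and P: "\<And>i j. \<not> P (int j - int i) \<Longrightarrow> y i j = 0"
    and supp: "\<And>i j. i \<ge> M \<or> j \<ge> M \<Longrightarrow> y i j = 0"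
    and K: "K \<ge> M + N" and T: "T \<ge> 0"
  shows "(\<Sum>i<K. \<Sum>j<K. (w i j)\<^sup>2 * (\<Sum>n<N. dyson a b c n T y i j)\<^sup>2)
      \<le> exp (- 2 * \<kappa> * T) * (\<Sum>i<K. \<Sum>j<K. (w i j)\<^sup>2 * (y i j)\<^sup>2)"
proof (cases N)
  case 0
  then show ?thesis by (auto intro!: mult_nonneg_nonneg sum_nonneg)
next
  case (Suc N')
  define A where "A N t i j = (\<Sum>n<N. dyson a b c n t y i j)" for N t i j
  define E where "E t = (\<Sum>i<K. \<Sum>j<K. (w i j)\<^sup>2 * (A (Suc N') t i j)\<^sup>2)" for t
  define E' where "E' t = (\<Sum>i<K. \<Sum>j<K. (w i j)\<^sup>2 * (2 * A (Suc N') t i j *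
      (c i j * A (Suc N') t i j + jump a b (A N' t) i j)))" for t
  have dy0: "0 \<le> dyson a b c n t y i j" if "t \<ge> 0" for n t i j
    using that y0 by (rule dyson_nonneg[rotated])
  \<comment> \<open>The derivative of the \<open>N\<close>-th partial sum involves only the previous one; by positivity it may be
    replaced by the \<open>N\<close>-th, after which the quadratic form inequality applies.\<close>
  have A_mono: "A N' t i j \<le> A (Suc N') t i j" if "t \<ge> 0" for t i j
    using dy0[OF that] by (simp add: A_def)
  have A0: "A n t i j \<ge> 0" if "t \<ge> 0" for n t i j
    unfolding A_def by (intro sum_nonneg dy0 that)
  have suppA: "A (Suc N') t i j = 0" if "i \<ge> K \<or> j \<ge> K" for t i j
    unfolding A_def
  proof (intro sum.neutral ballI)
    fix n assume "n \<in> {..<Suc N'}"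
    then show "dyson a b c n t y i j = 0"
      using that K Suc by (intro dyson_support[OF supp]) auto
  qed
  have diagA: "P (int j - int i)" if "A (Suc N') t i j \<noteq> 0" for t i j
  proof (rule ccontr)
    assume "\<not> P (int j - int i)"
    then have "dyson a b c n t y i j = 0" for n
      using dyson_diag[where P = P and x = y and i = i and j = j] P by blast
    then show False using that by (simp add: A_def)
  qed
  have dA: "((\<lambda>t. A (Suc N') t i j) has_real_derivative
      (c i j * A (Suc N') t i j + jump a b (A N' t) i j)) (at t within {0..T})" if "t \<in> {0..T}" for t i j
    using dyson_sum_deriv[OF that, of a b c y i j N']
    unfolding A_def[abs_def] by (rule has_real_derivative_iff_has_vector_derivative[THEN iffD2])
  have dE: "(E has_real_derivative E' t) (at t within {0..T})" if "t \<in> {0..T}" for t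
    unfolding E_def[abs_def] E'_def
    by (auto intro!: derivative_eq_intros dA[OF that] sum.cong simp: power2_eq_square)
  have E'_le: "E' t \<le> - 2 * \<kappa> * E t" if t: "t \<in> {0..T}" for t
  proof -
    have "jump a b (A N' t) i j \<le> jump a b (A (Suc N') t) i j" for i j
      unfolding jump_def of_real_eq_id id_def
      by (intro add_mono mult_left_mono A_mono a_nonneg b_nonneg) (use t in auto)
    then have "E' t \<le> (\<Sum>i<K. \<Sum>j<K. (w i j)\<^sup>2 * (2 * A (Suc N') t i j *
        (c i j * A (Suc N') t i j + jump a b (A (Suc N') t) i j)))"
      unfolding E'_def using t by (intro sum_mono mult_left_mono add_left_mono) (auto intro: A0)
    also have "\<dots> = 2 * (\<Sum>i<K. \<Sum>j<K. (w i j)\<^sup>2 * A (Suc N') t i j *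
        (c i j * A (Suc N') t i j + jump a b (A (Suc N') t) i j))"
      by (simp add: sum_distrib_left mult_ac)
    also have "\<dots> \<le> 2 * (- \<kappa> * E t)"
      unfolding E_def by (intro mult_left_mono jump_form_le[where h = h] h diagA hpos suppA) auto
    finally show ?thesis by simp
  qed
  \<comment> \<open>Integrating factor: \<open>E' t \<le> - 2 * \<kappa> * E t\<close> makes
    \<open>F\<close> nonincreasing.\<close>
  define F where "F t = exp (2 * \<kappa> * t) * E t" for t
  have "F T \<le> F 0"
  proof (rule DERIV_nonpos_imp_decreasing_open[OF T])
    fix t assume t: "0 < t" "t < T"
    have "(E has_real_derivative E' t) (at t)"
      using dE[of t] t at_within_Icc_at[of 0 t T] by simp
    then have "(F has_real_derivative exp (2 * \<kappa> * t) * (2 * \<kappa> * E t + E' t)) (at t)"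
      unfolding F_def[abs_def] by (auto intro!: derivative_eq_intros simp: algebra_simps)
    moreover have "exp (2 * \<kappa> * t) * (2 * \<kappa> * E t + E' t) \<le> 0"
      using E'_le[of t] t by (intro mult_nonneg_nonpos) auto
    ultimately show "\<exists>y. (F has_real_derivative y) (at t) \<and> y \<le> 0" by blast
  next
    have "continuous_on {0..T} E"
      by (rule DERIV_continuous_on[OF dE])
    then show "continuous_on {0..T} F"
      unfolding F_def[abs_def] by (intro continuous_intros)
  qed
  have A00: "A (Suc N') 0 i j = y i j" for i j
    unfolding A_def dyson_sum_Suc by simp
  have "E T = exp (- 2 * \<kappa> * T) * F T"
    by (simp add: F_def mult_exp_exp flip: mult.assoc)
  also have "\<dots> \<le> exp (- 2 * \<kappa> * T) * F 0"
    using \<open>F T \<le> F 0\<close> by simp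
  also have "F 0 = (\<Sum>i<K. \<Sum>j<K. (w i j)\<^sup>2 * (y i j)\<^sup>2)"
    by (simp add: F_def E_def A00)
  finally show ?thesis
    using Suc by (simp add: E_def A_def)
qed

end

section \<open>Bounded matrices and finite quadratic forms\<close>

abbreviation trunc_norm :: "nat \<Rightarrow> vec \<Rightarrow> real" where
  "trunc_norm M u \<equiv> L2_set (\<lambda>i. cmod (u i)) {..<M}"

definition trunc :: "nat \<Rightarrow> vec \<Rightarrow> vec" where
  "trunc M u = (\<lambda>n. if n < M then u n else 0)"

text \<open>The compression to the first \<open>M\<close> basis vectors. Boundedness and positivity
  of infinite matrices are both read off from these finite sums, which commute with time integrals
  and entrywise limits.\<close>

definition form :: "nat \<Rightarrow> mat \<Rightarrow> vec \<Rightarrow> vec \<Rightarrow> complex" where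
  "form M X v u = (\<Sum>i<M. \<Sum>j<M. cnj (v i) * X i j * u j)"

definition form_bdd :: "real \<Rightarrow> mat \<Rightarrow> bool" where
  "form_bdd C X \<longleftrightarrow> (\<forall>M v u. cmod (form M X v u) \<le> C * trunc_norm M v * trunc_norm M u)"

definition nonneg_c :: "complex \<Rightarrow> bool" where
  "nonneg_c z \<longleftrightarrow> Im z = 0 \<and> Re z \<ge> 0"

section \<open>Square-summable sequences and their truncations\<close>

lemma ell2_D: "u \<in> ell2 \<Longrightarrow> summable (\<lambda>n. (cmod (u n))\<^sup>2)"
  by (simp add: ell2_def)

lemma vnorm_nonneg: "vnorm u \<ge> 0" if "u \<in> ell2"
  unfolding vnorm_def using ell2_D[OF that] by (intro real_sqrt_ge_zero suminf_nonneg) auto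

lemma trunc_norm_sq: "(trunc_norm M u)\<^sup>2 = (\<Sum>i<M. (cmod (u i))\<^sup>2)"
  by (simp add: L2_set_def sum_nonneg)

lemma trunc_norm_sq_complex: "of_real ((trunc_norm M u)\<^sup>2) = (\<Sum>i<M. u i * cnj (u i))"
  unfolding trunc_norm_sq of_real_sum complex_norm_square ..

lemma trunc_norm_le_vnorm: "u \<in> ell2 \<Longrightarrow> trunc_norm M u \<le> vnorm u"
  unfolding L2_set_def vnorm_def using ell2_D by (intro real_sqrt_le_mono sum_le_suminf) auto

lemma ell2_finite: "(\<And>n. n \<ge> M \<Longrightarrow> u n = 0) \<Longrightarrow> u \<in> ell2"
  unfolding ell2_def using summable_finite[of "{..<M}" "\<lambda>n. (cmod (u n))\<^sup>2"] by (force simp: not_less)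

lemma trunc_ell2 [simp]: "trunc M u \<in> ell2"
  by (rule ell2_finite[of M]) (simp add: trunc_def)

lemma vnorm_trunc: "vnorm (trunc M u) = trunc_norm M u"
proof -
  have "(\<Sum>n. (cmod (trunc M u n))\<^sup>2) = (\<Sum>n<M. (cmod (trunc M u n))\<^sup>2)"
    by (rule suminf_finite) (auto simp: trunc_def)
  then show ?thesis by (simp add: vnorm_def L2_set_def trunc_def)
qed

lemma ell2I:
  assumes "\<And>M. trunc_norm M u \<le> C"
  shows "u \<in> ell2" "vnorm u \<le> C"
proof -
  have C: "C \<ge> 0" using assms[of 0] by simp
  have le: "(\<Sum>i<M. (cmod (u i))\<^sup>2) \<le> C\<^sup>2" for M
    using assms[of M] by (simp add: trunc_norm_sq[symmetric] power_mono)
  have s: "summable (\<lambda>n. (cmod (u n))\<^sup>2)"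
    by (rule summableI_nonneg_bounded[OF _ le]) auto
  then show "u \<in> ell2" by (simp add: ell2_def)
  have "(\<Sum>n. (cmod (u n))\<^sup>2) \<le> C\<^sup>2"
    by (rule suminf_le_const[OF s le])
  then show "vnorm u \<le> C"
    unfolding vnorm_def using C by (simp add: real_le_lsqrt)
qed

lemma ell2_mult_summable:
  assumes "u \<in> ell2" "v \<in> ell2"
  shows "summable (\<lambda>n. cmod (u n * v n))"
proof (rule summable_comparison_test')
  show "summable (\<lambda>n. (cmod (u n))\<^sup>2 + (cmod (v n))\<^sup>2)"
    using assms by (intro summable_add ell2_D)
  fix n
  have "2 * (cmod (u n) * cmod (v n)) \<le> (cmod (u n))\<^sup>2 + (cmod (v n))\<^sup>2"
    using sum_squares_bound[of "cmod (u n)" "cmod (v n)"] by simp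
  then show "norm (cmod (u n * v n)) \<le> (cmod (u n))\<^sup>2 + (cmod (v n))\<^sup>2"
    using mult_nonneg_nonneg[OF norm_ge_zero norm_ge_zero, of "u n" "v n"] unfolding norm_mult real_norm_def abs_mult abs_norm_cancel
    by linarith
qed

lemma ell2_cnj: "u \<in> ell2 \<Longrightarrow> (\<lambda>n. cnj (u n)) \<in> ell2"
  by (simp add: ell2_def)

lemma sum_mult_le_trunc_norm: "cmod (\<Sum>i<M. u i * v i) \<le> trunc_norm M u * trunc_norm M v"
proof -
  have "cmod (\<Sum>i<M. u i * v i) \<le> (\<Sum>i<M. \<bar>cmod (u i)\<bar> * \<bar>cmod (v i)\<bar>)"
    by (rule order_trans[OF norm_sum]) (simp add: norm_mult)
  also have "\<dots> \<le> trunc_norm M u * trunc_norm M v"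
    by (rule L2_set_mult_ineq)
  finally show ?thesis .
qed

lemma trunc_norm_nonneg [simp]: "trunc_norm M u \<ge> 0"
  by (rule L2_set_nonneg)

lemma tail_tendsto_0:
  assumes "u \<in> ell2"
  shows "(\<lambda>M. vnorm (\<lambda>n. u n - trunc M u n)) \<longlonglongrightarrow> 0"
proof -
  have s: "summable (\<lambda>n. (cmod (u n))\<^sup>2)" using assms by (rule ell2_D)
  have "(\<Sum>n. (cmod (u n - trunc M u n))\<^sup>2) = (\<Sum>n. (cmod (u (n + M)))\<^sup>2)" for M
  proof -
    have "summable (\<lambda>n. (cmod (u n - trunc M u n))\<^sup>2)"
      by (rule summable_comparison_test'[OF s]) (auto simp: trunc_def)
    from suminf_split_initial_segment[OF this, of M] show ?thesis
      by (simp add: trunc_def)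
  qed
  moreover have "(\<lambda>M. \<Sum>n. (cmod (u (n + M)))\<^sup>2) \<longlonglongrightarrow> 0"
    by (rule suminf_exist_split2[OF s])
  ultimately show ?thesis
    unfolding vnorm_def using tendsto_real_sqrt by force
qed

section \<open>Finite compressions and operator bounds\<close>

lemma mapply_trunc: "mapply X (trunc M u) i = (\<Sum>j<M. X i j * u j)"
proof -
  have "mapply X (trunc M u) i = (\<Sum>j<M. X i j * trunc M u j)"
    unfolding mapply_def by (rule suminf_finite) (auto simp: trunc_def)
  then show ?thesis by (simp add: trunc_def)
qed

lemma form_mapply: "form M X v u = (\<Sum>i<M. cnj (v i) * mapply X (trunc M u) i)"
  by (simp add: form_def mapply_trunc sum_distrib_left mult_ac)

lemma form_trunc: "vinner (trunc M v) (mapply X (trunc M u)) = form M X v u"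
proof -
  have "vinner (trunc M v) (mapply X (trunc M u)) = (\<Sum>i<M. cnj (trunc M v i) * mapply X (trunc M u) i)"
    unfolding vinner_def by (rule suminf_finite) (auto simp: trunc_def)
  then show ?thesis by (simp add: trunc_def form_mapply)
qed

lemma form_entry: "i < M \<Longrightarrow> j < M \<Longrightarrow> form M X (\<lambda>n. if n = i then 1 else 0) (\<lambda>n. if n = j then 1 else 0) = X i j"
  unfolding form_def by (simp add: if_distrib[of "\<lambda>z. z * _"] if_distrib[of cnj] if_distrib[of "\<lambda>z. _ * z"] sum.delta' cong: if_cong)

lemma form_add_mat: "form M (\<lambda>i j. X i j + Y i j) v u = form M X v u + form M Y v u"
  by (simp add: form_def sum.distrib algebra_simps)

lemma form_diff_mat: "form M (\<lambda>i j. X i j - Y i j) v u = form M X v u - form M Y v u"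
  by (simp add: form_def sum_subtractf algebra_simps)

lemma form_cmult_mat: "form M (\<lambda>i j. k * X i j) v u = k * form M X v u"
  by (simp add: form_def sum_distrib_left mult_ac)

lemma form_adjoint: "form M (\<lambda>i j. cnj (X j i)) v u = cnj (form M X u v)"
  unfolding form_def by (subst sum.swap) (simp add: mult_ac)

lemma form_id: "form M (\<lambda>i j. if i = j then k else 0) u u = k * of_real ((trunc_norm M u)\<^sup>2)"
proof -
  have "form M (\<lambda>i j. if i = j then k else 0) u u = (\<Sum>i<M. cnj (u i) * k * u i)"
    unfolding form_def by (simp add: if_distrib[of "\<lambda>z. z * _"] if_distrib[of "\<lambda>z. _ * z"] sum.delta cong: if_cong)
  also have "\<dots> = k * (\<Sum>i<M. u i * cnj (u i))"
    by (simp add: sum_distrib_left mult_ac)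
  also have "(\<Sum>i<M. u i * cnj (u i)) = of_real ((trunc_norm M u)\<^sup>2)"
    by (rule trunc_norm_sq_complex[symmetric])
  finally show ?thesis .
qed

text \<open>Scaling \<open>v\<close> by the norm of \<open>u\<close>, and \<open>u\<close> by the
  norm of \<open>v\<close>, makes the two squares on the right equal, which turns their sum into a
  multiple of the product of norms.\<close>

lemma form_bddI_quad:
  assumes "\<And>M v u. 2 * cmod (form M X v u) \<le> C * ((trunc_norm M v)\<^sup>2 + (trunc_norm M u)\<^sup>2)" "C \<ge> 0"
  shows "form_bdd C X"
  unfolding form_bdd_def
proof (intro allI)
  fix M v u
  have scale: "form M X (\<lambda>i. of_real p * v i) (\<lambda>i. of_real q * u i) = of_real (p * q) * form M X v u" for p q :: real
    by (simp add: form_def sum_distrib_left mult_ac)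
  have nsc: "(trunc_norm M (\<lambda>i. of_real p * u i))\<^sup>2 = p\<^sup>2 * (trunc_norm M u)\<^sup>2" for p u
    unfolding trunc_norm_sq by (simp add: norm_mult power_mult_distrib sum_distrib_left)
  have key: "2 * (p * q * cmod (form M X v u)) \<le> C * (p\<^sup>2 * (trunc_norm M v)\<^sup>2 + q\<^sup>2 * (trunc_norm M u)\<^sup>2)" if "p \<ge> 0" "q \<ge> 0" for p q
    using assms(1)[of M "\<lambda>i. of_real p * v i" "\<lambda>i. of_real q * u i"] that
    unfolding scale nsc by (simp add: norm_mult)
  let ?F = "cmod (form M X v u)" and ?a = "trunc_norm M v" and ?b = "trunc_norm M u"
  show "?F \<le> C * ?a * ?b"
  proof (cases "?a = 0 \<or> ?b = 0")
    case True
    then have "form M X v u = 0"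
    proof
      assume "?a = 0"
      then have "\<forall>i<M. v i = 0" by (simp add: L2_set_eq_0_iff)
      then show ?thesis by (simp add: form_def)
    next
      assume "?b = 0"
      then have "\<forall>i<M. u i = 0" by (simp add: L2_set_eq_0_iff)
      then show ?thesis by (simp add: form_def)
    qed
    then show ?thesis using assms(2) by simp
  next
    case False
    then have pos: "?a > 0" "?b > 0" by (auto simp: less_le)
    have "2 * (?b * ?a * ?F) \<le> C * (?b\<^sup>2 * ?a\<^sup>2 + ?a\<^sup>2 * ?b\<^sup>2)"
      by (rule key) simp_all
    then have "(?a * ?b) * ?F \<le> (?a * ?b) * (C * ?a * ?b)"
      by (simp add: power2_eq_square algebra_simps)
    then show ?thesis using pos by simp
  qed
qed

lemma form_bdd_entry:
  assumes "form_bdd C X" shows "cmod (X i j) \<le> C"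
proof -
  let ?M = "Suc (max i j)"
  have n: "trunc_norm ?M (\<lambda>n. if n = k then 1 else 0) = 1" if "k < ?M" for k
    using that by (simp add: L2_set_def if_distrib[of cmod] if_distrib[of "\<lambda>z. z\<^sup>2"] cong: if_cong)
  show ?thesis
    using assms[unfolded form_bdd_def, rule_format, of ?M "\<lambda>n. if n = i then 1 else 0" "\<lambda>n. if n = j then 1 else 0"]
    by (simp add: form_entry n less_Suc_eq_le del: L2_set_insert)
qed

lemma form_bdd_add: "form_bdd C X \<Longrightarrow> form_bdd D Y \<Longrightarrow> form_bdd (C + D) (\<lambda>i j. X i j + Y i j)"
  unfolding form_bdd_def form_add_mat
  by (auto simp: algebra_simps intro!: order_trans[OF norm_triangle_ineq] add_mono)

lemma form_bdd_cmult: "form_bdd C X \<Longrightarrow> form_bdd (cmod k * C) (\<lambda>i j. k * X i j)"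
  unfolding form_bdd_def form_cmult_mat by (simp add: norm_mult mult.assoc mult_left_mono)

lemma form_bdd_adjoint: "form_bdd C X \<Longrightarrow> form_bdd C (\<lambda>i j. cnj (X j i))"
  unfolding form_bdd_def form_adjoint complex_mod_cnj by (metis mult.assoc mult.commute)

lemma form_bdd_id: "form_bdd (cmod k) (\<lambda>i j. if i = j then k else 0)"
  unfolding form_bdd_def
proof (intro allI)
  fix M v u
  have "form M (\<lambda>i j. if i = j then k else 0) v u = k * (\<Sum>i<M. cnj (v i) * u i)"
    unfolding form_def by (simp add: if_distrib[of "\<lambda>z. z * _"] if_distrib[of "\<lambda>z. _ * z"] sum.delta sum_distrib_left mult_ac cong: if_cong)
  then show "cmod (form M (\<lambda>i j. if i = j then k else 0) v u) \<le> cmod k * trunc_norm M v * trunc_norm M u"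
    using mult_left_mono[OF sum_mult_le_trunc_norm[of "\<lambda>i. cnj (v i)" u M], of "cmod k"]
    by (simp add: norm_mult mult.assoc)
qed

text \<open>The hypothesis only concerns finite squares, so convergence of the rows and the norm
  bound are both extracted by choosing test vectors and letting the truncation grow.\<close>

lemma form_bdd_mapply:
  assumes X: "form_bdd C X" and u: "u \<in> ell2"
  shows "\<And>i. summable (\<lambda>j. X i j * u j)" "mapply X u \<in> ell2" "vnorm (mapply X u) \<le> C * vnorm u"
proof -
  have C: "C \<ge> 0" using form_bdd_entry[OF X, of 0 0] norm_ge_zero order_trans by blast
  \<comment> \<open>Testing the form with the truncated image \<open>trunc K y\<close> bounds the
    square of its norm by the norm times \<open>C * trunc_norm N u\<close>; one factor
    cancels.\<close>
  have partial: "trunc_norm K (\<lambda>i. \<Sum>j<N. X i j * u j) \<le> C * trunc_norm N u" if KN: "K \<le> N" for K N u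
  proof -
    define y where "y = (\<lambda>i. \<Sum>j<N. X i j * u j)"
    have "of_real ((trunc_norm K y)\<^sup>2) = (\<Sum>i<K. cnj (y i) * y i)"
      unfolding trunc_norm_sq_complex by (simp add: mult.commute)
    also have "\<dots> = (\<Sum>i<N. cnj (trunc K y i) * y i)"
      using KN by (intro sum.mono_neutral_cong_left) (auto simp: trunc_def)
    also have "\<dots> = form N X (trunc K y) u"
      by (simp add: form_def y_def sum_distrib_left sum_distrib_right mult_ac)
    finally have "(trunc_norm K y)\<^sup>2 = cmod (form N X (trunc K y) u)"
      by (metis abs_power2 norm_of_real real_norm_def)
    also have "\<dots> \<le> C * trunc_norm N (trunc K y) * trunc_norm N u"
      using X by (simp add: form_bdd_def)
    also have "trunc_norm N (trunc K y) = trunc_norm K y"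
      unfolding L2_set_def using KN by (intro arg_cong[of _ _ sqrt] sum.mono_neutral_cong_right) (auto simp: trunc_def)
    finally have "trunc_norm K y * trunc_norm K y \<le> trunc_norm K y * (C * trunc_norm N u)"
      by (simp add: power2_eq_square mult_ac)
    moreover have "0 \<le> C * trunc_norm N u" using C by simp
    ultimately have "trunc_norm K y \<le> C * trunc_norm N u"
      by (cases "trunc_norm K y = 0") (auto simp: less_le)
    then show ?thesis by (simp add: y_def)
  qed
  \<comment> \<open>The previous bound, applied to the conjugate of row \<open>i\<close>, shows that
    the row itself has norm at most \<open>C\<close>. The cut-off must exceed \<open>i\<close>,
    hence the maximum with \<open>Suc i\<close>.\<close>
  have row: "(\<lambda>j. X i j) \<in> ell2" for i
  proof (rule ell2I(1))
    fix N
    let ?u = "\<lambda>j. cnj (X i j)"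
    have 1: "cmod (\<Sum>j<M. X i j * ?u j) \<le> C * trunc_norm M (\<lambda>j. X i j)" if "i < M" for M
    proof -
      have "cmod (\<Sum>j<M. X i j * ?u j) \<le> trunc_norm (Suc i) (\<lambda>i'. \<Sum>j<M. X i' j * ?u j)"
        using member_le_L2_set[of "{..<Suc i}" i "\<lambda>i'. cmod (\<Sum>j<M. X i' j * ?u j)"] by simp
      also have "\<dots> \<le> C * trunc_norm M ?u" by (rule partial) (use that in auto)
      finally show ?thesis by simp
    qed
    let ?M = "max N (Suc i)"
    have "(\<Sum>j<?M. X i j * ?u j) = of_real ((trunc_norm ?M (\<lambda>j. X i j))\<^sup>2)"
      unfolding trunc_norm_sq_complex ..
    with 1[of ?M] have "trunc_norm ?M (\<lambda>j. X i j) * trunc_norm ?M (\<lambda>j. X i j) \<le> trunc_norm ?M (\<lambda>j. X i j) * C"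
      by (simp add: power2_eq_square mult_ac norm_mult del: of_real_mult)
    then have "trunc_norm ?M (\<lambda>j. X i j) \<le> C"
      using C by (cases "trunc_norm ?M (\<lambda>j. X i j) = 0") (auto simp: less_le)
    moreover have "trunc_norm N (\<lambda>j. X i j) \<le> trunc_norm ?M (\<lambda>j. X i j)"
      unfolding L2_set_def by (intro real_sqrt_le_mono sum_mono2) auto
    ultimately show "trunc_norm N (\<lambda>j. X i j) \<le> C" by simp
  qed
  show s: "summable (\<lambda>j. X i j * u j)" for i
    using ell2_mult_summable[OF row u] by (rule summable_norm_cancel)
  have "trunc_norm K (mapply X u) \<le> C * vnorm u" for K
  proof (rule tendsto_upperbound)
    show "(\<lambda>N. trunc_norm K (\<lambda>i. \<Sum>j<N. X i j * u j)) \<longlonglongrightarrow> trunc_norm K (mapply X u)"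
      unfolding L2_set_def mapply_def
      by (intro tendsto_intros summable_LIMSEQ s)
    show "\<forall>\<^sub>F N in sequentially. trunc_norm K (\<lambda>i. \<Sum>j<N. X i j * u j) \<le> C * vnorm u"
      using eventually_ge_at_top[of K]
    proof eventually_elim
      case (elim N)
      have "trunc_norm K (\<lambda>i. \<Sum>j<N. X i j * u j) \<le> C * trunc_norm N u" by (rule partial[OF elim])
      also have "\<dots> \<le> C * vnorm u" by (intro mult_left_mono trunc_norm_le_vnorm u C)
      finally show ?case .
    qed
  qed simp
  from ell2I[OF this] show "mapply X u \<in> ell2" "vnorm (mapply X u) \<le> C * vnorm u"
    by auto
qed

lemma bounded_mat_iff: "bounded_mat X \<longleftrightarrow> (\<exists>C. form_bdd C X)"
proof
  assume "bounded_mat X"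
  then obtain C where C: "\<And>u. u \<in> ell2 \<Longrightarrow> mapply X u \<in> ell2 \<and> vnorm (mapply X u) \<le> C * vnorm u"
    unfolding bounded_mat_def by blast
  have "form_bdd C X" unfolding form_bdd_def
  proof (intro allI)
    fix M v u
    have "cmod (form M X v u) \<le> trunc_norm M (\<lambda>i. cnj (v i)) * trunc_norm M (mapply X (trunc M u))"
      unfolding form_mapply by (rule sum_mult_le_trunc_norm)
    also have "\<dots> \<le> trunc_norm M v * (C * trunc_norm M u)"
      using C[of "trunc M u"] trunc_norm_le_vnorm[of "mapply X (trunc M u)" M]
      by (intro mult_mono) (auto simp: vnorm_trunc)
    finally show "cmod (form M X v u) \<le> C * trunc_norm M v * trunc_norm M u"
      by (simp add: mult_ac)
  qed
  then show "\<exists>C. form_bdd C X" by blast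
next
  assume "\<exists>C. form_bdd C X"
  then show "bounded_mat X"
    unfolding bounded_mat_def by (blast intro: form_bdd_mapply)
qed

lemma form_bound:
  assumes "form_bdd C X" "v \<in> ell2" "u \<in> ell2"
  shows "cmod (form M X v u) \<le> C * vnorm v * vnorm u"
proof -
  have C: "C \<ge> 0" using form_bdd_entry[OF assms(1), of 0 0] norm_ge_zero order_trans by blast
  have "cmod (form M X v u) \<le> C * trunc_norm M v * trunc_norm M u"
    using assms by (simp add: form_bdd_def)
  also have "\<dots> \<le> C * vnorm v * vnorm u"
    using C assms by (intro mult_mono trunc_norm_le_vnorm) (auto simp: vnorm_nonneg)
  finally show ?thesis .
qed

text \<open>Truncating only the outer index converges by summability; truncating \<open>u\<close> as
  well costs at most \<open>C\<close> times the norm of \<open>v\<close> times the norm of the tail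
  of \<open>u\<close>.\<close>

lemma form_tendsto:
  assumes X: "form_bdd C X" and v: "v \<in> ell2" and u: "u \<in> ell2"
  shows "(\<lambda>M. form M X v u) \<longlonglongrightarrow> vinner v (mapply X u)"
proof -
  have C: "C \<ge> 0" using form_bdd_entry[OF X, of 0 0] norm_ge_zero order_trans by blast
  let ?S = "\<lambda>M. \<Sum>i<M. cnj (v i) * mapply X u i"
  have "summable (\<lambda>i. cnj (v i) * mapply X u i)"
    using ell2_mult_summable[OF ell2_cnj[OF v] form_bdd_mapply(2)[OF X u]] by (rule summable_norm_cancel)
  then have S: "?S \<longlonglongrightarrow> vinner v (mapply X u)"
    unfolding vinner_def by (rule summable_LIMSEQ)
  have bd: "norm (?S M - form M X v u) \<le> vnorm v * (C * vnorm (\<lambda>n. u n - trunc M u n))" for M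
  proof -
    have d: "(\<lambda>n. u n - trunc M u n) \<in> ell2"
      using ell2_D[OF u] unfolding ell2_def
      by (auto intro!: summable_comparison_test'[where g = "\<lambda>n. (cmod (u n))\<^sup>2"] simp: trunc_def)
    have "mapply X (\<lambda>n. u n - trunc M u n) i = mapply X u i - mapply X (trunc M u) i" for i
      unfolding mapply_def
      using suminf_diff[OF form_bdd_mapply(1)[OF X u, of i] form_bdd_mapply(1)[OF X trunc_ell2, of i]]
      by (simp add: algebra_simps)
    then have "?S M - form M X v u = (\<Sum>i<M. cnj (v i) * mapply X (\<lambda>n. u n - trunc M u n) i)"
      unfolding form_mapply sum_subtractf[symmetric] by (simp add: right_diff_distrib)
    also have "cmod \<dots> \<le> trunc_norm M (\<lambda>i. cnj (v i)) * trunc_norm M (mapply X (\<lambda>n. u n - trunc M u n))"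
      by (rule sum_mult_le_trunc_norm)
    also have "\<dots> \<le> vnorm v * (C * vnorm (\<lambda>n. u n - trunc M u n))"
      using order_trans[OF trunc_norm_le_vnorm[OF form_bdd_mapply(2)[OF X d]] form_bdd_mapply(3)[OF X d]]
      by (intro mult_mono) (auto simp: trunc_norm_le_vnorm v vnorm_nonneg)
    finally show ?thesis .
  qed
  have "(\<lambda>M. ?S M - form M X v u) \<longlonglongrightarrow> 0"
    by (rule Lim_null_comparison[OF always_eventually[OF allI[OF bd]]])
       (auto intro!: tendsto_eq_intros tail_tendsto_0 u)
  from tendsto_diff[OF S this] show ?thesis by simp
qed

section \<open>Positivity and the order on bounded matrices\<close>

lemma pos_mat_iff: "pos_mat X \<longleftrightarrow> bounded_mat X \<and> (\<forall>M u. nonneg_c (form M X u u))"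
proof (intro iffI conjI allI)
  assume X: "pos_mat X"
  then show "bounded_mat X" by (simp add: pos_mat_def)
  fix M u
  show "nonneg_c (form M X u u)"
    using X unfolding pos_mat_def nonneg_c_def form_trunc[symmetric] by simp
next
  assume X: "bounded_mat X \<and> (\<forall>M u. nonneg_c (form M X u u))"
  then obtain C where C: "form_bdd C X" by (auto simp: bounded_mat_iff)
  show "pos_mat X" unfolding pos_mat_def
  proof (intro conjI ballI)
    fix u assume "u \<in> ell2"
    then have t: "(\<lambda>M. form M X u u) \<longlonglongrightarrow> vinner u (mapply X u)"
      by (intro form_tendsto[OF C])
    show "Im (vinner u (mapply X u)) = 0"
      using tendsto_Im[OF t] X by (auto simp: nonneg_c_def LIMSEQ_const_iff)
    show "Re (vinner u (mapply X u)) \<ge> 0"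
      using tendsto_Re[OF t] X by (auto simp: nonneg_c_def intro: LIMSEQ_le_const)
  qed (use X in auto)
qed

lemma form_plus_quad:
  "form M X (\<lambda>n. v n + z * u n) (\<lambda>n. v n + z * u n) =
     form M X v v + z * form M X v u + cnj z * form M X u v + cnj z * z * form M X u u"
  by (simp add: form_def sum.distrib sum_distrib_left algebra_simps)

text \<open>Polarisation with the phases \<open>1\<close> and \<open>\<i>\<close>, applied to two
  basis vectors, isolates a single entry.\<close>

lemma form_zero_entries:
  assumes "\<And>M u. form M X u u = 0"
  shows "X i j = 0"
proof -
  let ?M = "Suc (max i j)"
  let ?v = "\<lambda>n. if n = i then 1 else 0 :: complex" and ?u = "\<lambda>n. if n = j then 1 else 0 :: complex"
  have 1: "form ?M X ?v ?u + form ?M X ?u ?v = 0"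
    using form_plus_quad[of ?M X ?v 1 ?u] by (simp only: assms) simp
  have 2: "\<i> * form ?M X ?v ?u - \<i> * form ?M X ?u ?v = 0"
    using form_plus_quad[of ?M X ?v "\<i>" ?u] by (simp only: assms) simp
  have "form ?M X ?v ?u = 0"
    using 1 2 by (auto simp: algebra_simps add_eq_0_iff)
  moreover have "form ?M X ?v ?u = X i j"
    by (rule form_entry) auto
  ultimately show ?thesis by simp
qed

lemma mat_le_antisym:
  assumes "mat_le x y" "mat_le y x" shows "x = y"
proof -
  have "form M (\<lambda>i j. x i j - y i j) u u = 0" for M u
  proof -
    have "nonneg_c (form M x u u - form M y u u)" "nonneg_c (form M y u u - form M x u u)"
      using assms unfolding mat_le_def pos_mat_iff form_diff_mat by auto
    then show ?thesis by (simp add: form_diff_mat nonneg_c_def complex_eq_iff)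
  qed
  then have "x i j - y i j = 0" for i j
    by (rule form_zero_entries)
  then show ?thesis by (auto simp: fun_eq_iff)
qed

text \<open>The quadratic form of \<open>z X\<close> plus its adjoint is real and at most
  \<open>2 * C\<close> times the squared norm in modulus, so the diagonal shift compensates
  it.\<close>

lemma bounded_mat_rotation_pos:
  assumes X: "form_bdd C X" and z: "cmod z = 1"
  shows "pos_mat (\<lambda>i j. (if i = j then of_real (2 * C) else 0) + (z * X i j + cnj z * cnj (X j i)))"
proof -
  have C: "C \<ge> 0" using form_bdd_entry[OF X, of 0 0] norm_ge_zero order_trans by blast
  show ?thesis unfolding pos_mat_iff
  proof (intro conjI allI)
    show "bounded_mat (\<lambda>i j. (if i = j then of_real (2 * C) else 0) + (z * X i j + cnj z * cnj (X j i)))"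
      unfolding bounded_mat_iff
      by (rule exI, rule form_bdd_add[OF form_bdd_id
            form_bdd_add[OF form_bdd_cmult[OF X] form_bdd_cmult[OF form_bdd_adjoint[OF X]]]])
    fix M u
    let ?f = "z * form M X u u"
    have eq: "form M (\<lambda>i j. (if i = j then of_real (2 * C) else 0) + (z * X i j + cnj z * cnj (X j i))) u u
       = of_real (2 * C) * of_real ((trunc_norm M u)\<^sup>2) + (?f + cnj ?f)"
      by (simp add: form_add_mat form_cmult_mat form_adjoint form_id)
    have "cmod ?f = cmod (form M X u u)"
      using z by (simp add: norm_mult)
    also have "\<dots> \<le> C * trunc_norm M u * trunc_norm M u"
      using X by (simp add: form_bdd_def)
    finally have "\<bar>Re ?f\<bar> \<le> C * (trunc_norm M u)\<^sup>2"
      using abs_Re_le_cmod[of ?f] by (simp add: power2_eq_square mult.assoc)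
    then show "nonneg_c (form M (\<lambda>i j. (if i = j then of_real (2 * C) else 0) + (z * X i j + cnj z * cnj (X j i))) u u)"
      unfolding eq nonneg_c_def by (simp del: of_real_power)
  qed
qed

text \<open>In the weighted sum over the phases \<open>1, -1, \<i>, -\<i>\<close> the diagonal
  shifts and the adjoints cancel. The purpose is that a linear map on bounded matrices is determined
  by its values on positive ones.\<close>

lemma bounded_mat_decompose:
  assumes "bounded_mat X"
  obtains p q r s where "pos_mat p" "pos_mat q" "pos_mat r" "pos_mat s"
    "X = (\<lambda>i j. (1/4) * p i j + ((-1/4) * q i j + ((-\<i>/4) * r i j + (\<i>/4) * s i j)))"
proof -
  obtain C where C: "form_bdd C X" using assms by (auto simp: bounded_mat_iff)
  define p where "p z = (\<lambda>i j. (if i = j then of_real (2 * C) else 0) + (z * X i j + cnj z * cnj (X j i)))" for z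
  have pos: "pos_mat (p z)" if "cmod z = 1" for z
    unfolding p_def by (rule bounded_mat_rotation_pos[OF C that])
  have "X = (\<lambda>i j. (1/4) * p 1 i j + ((-1/4) * p (-1) i j + ((-\<i>/4) * p \<i> i j + (\<i>/4) * p (-\<i>) i j)))"
    by (auto simp: fun_eq_iff p_def algebra_simps)
  then show ?thesis by (rule that[OF pos pos pos pos, rotated 4]) auto
qed

section \<open>The Dyson series in the quantum model\<close>

lemma omega_nonneg: "r > 0 \<Longrightarrow> omega r n \<ge> 0"
  unfolding omega_def by (cases n) auto

lemma omega_0 [simp]: "omega r 0 = 0"
  by (simp add: omega_def)

lemma nonneg_c_integral:
  assumes "(f has_integral I) {0..t::real}" "\<And>s. s \<in> {0..t} \<Longrightarrow> nonneg_c (f s)"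
  shows "nonneg_c I"
proof -
  have "((\<lambda>s. Re (f s)) has_integral Re I) {0..t}" "((\<lambda>s. Im (f s)) has_integral Im I) {0..t}"
    using has_integral_linear[OF assms(1) bounded_linear_Re] has_integral_linear[OF assms(1) bounded_linear_Im]
    by (simp_all add: o_def)
  then show ?thesis
    using assms(2) has_integral_nonneg[of "\<lambda>s. Re (f s)" "Re I" "{0..t}"]
      has_integral_eq_rhs[OF has_integral_is_0[of "{0..t}" "\<lambda>s. Im (f s)"] refl]
    unfolding nonneg_c_def by (blast intro: has_integral_unique)
qed

lemma nonneg_c_add: "nonneg_c x \<Longrightarrow> nonneg_c y \<Longrightarrow> nonneg_c (x + y)"
  by (simp add: nonneg_c_def)

lemma nonneg_c_sum: "(\<And>i. i \<in> A \<Longrightarrow> nonneg_c (f i)) \<Longrightarrow> nonneg_c (sum f A)"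
  by (simp add: nonneg_c_def sum_nonneg)

lemma nonneg_c_lim:
  assumes "f \<longlonglongrightarrow> l" "\<And>n. nonneg_c (f n)"
  shows "nonneg_c l"
  using tendsto_Re[OF assms(1)] tendsto_Im[OF assms(1)] assms(2)
  by (auto simp: nonneg_c_def LIMSEQ_const_iff intro: LIMSEQ_le_const)

lemma form_integral:
  assumes "\<And>i j. (h i j) integrable_on S"
  shows "((\<lambda>s. form M (\<lambda>i j. h i j s) v u) has_integral form M (\<lambda>i j. integral S (h i j)) v u) S"
  unfolding form_def
  by (intro has_integral_sum finite_lessThan has_integral_mult_right has_integral_mult_left integrable_integral assms)

lemma form_tendsto_entry:
  assumes "\<And>i j. (\<lambda>n. X n i j) \<longlonglongrightarrow> Y i j"
  shows "(\<lambda>n. form M (X n) v u) \<longlonglongrightarrow> form M Y v u"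
  unfolding form_def by (intro tendsto_intros assms)

lemma ell2_mono:
  assumes "\<And>n. cmod (x n) \<le> cmod (y n)" "y \<in> ell2"
  shows "x \<in> ell2" "vnorm x \<le> vnorm y"
proof -
  have "trunc_norm M x \<le> vnorm y" for M
    using L2_set_mono[of "{..<M}" "\<lambda>i. cmod (x i)" "\<lambda>i. cmod (y i)"] assms trunc_norm_le_vnorm[of y M]
    by force
  from ell2I[OF this] show "x \<in> ell2" "vnorm x \<le> vnorm y" by auto
qed

locale qds =
  fixes r lam mu zp zm :: real
  assumes r_pos: "r > 0" and lam_pos: "lam > 0" and lam_mu: "lam < mu"
begin

lemma mu_pos: "mu > 0" using lam_pos lam_mu by simp

text \<open>The entrywise coefficient of \<open>G* x + x G\<close>. The coefficients
  \<open>al\<close> and \<open>be\<close> below come in the same way from \<open>L1* x L1\<close>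
  and \<open>L2* x L2\<close>, so the three together give the formal generator on entries.\<close>

definition cc :: "nat \<Rightarrow> nat \<Rightarrow> complex" where
  "cc i j = cnj (gcoef r lam mu zp zm i) + gcoef r lam mu zp zm j"

definition cr :: "nat \<Rightarrow> nat \<Rightarrow> real" where
  "cr i j = - (lam\<^sup>2 / 2 * (omega r (Suc i) + omega r (Suc j)) + mu\<^sup>2 / 2 * (omega r i + omega r j))"

definition al :: "nat \<Rightarrow> nat \<Rightarrow> real" where
  "al i j = mu\<^sup>2 * (sqrt (omega r i) * sqrt (omega r j))"

definition be :: "nat \<Rightarrow> nat \<Rightarrow> real" where
  "be i j = lam\<^sup>2 * (sqrt (omega r (Suc i)) * sqrt (omega r (Suc j)))"

abbreviation "L1 \<equiv> opL1 r mu"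
abbreviation "L2 \<equiv> opL2 r lam"
abbreviation "P \<equiv> semP r lam mu zp zm"
abbreviation "D \<equiv> dyson al be cc"
abbreviation "D0 \<equiv> dyson al be cr"

lemma om [simp]: "omega r n \<ge> 0" by (rule omega_nonneg[OF r_pos])

sublocale jumps al be
  by unfold_locales (auto simp: al_def be_def)

lemma Re_cc: "Re (cc i j) = cr i j"
  by (simp add: cc_def cr_def gcoef_def field_simps)

lemma norm_exp_cc: "cmod (exp (of_real t * cc i j)) = exp (t * cr i j)"
  by (simp add: norm_exp_eq_Re Re_cc)

lemma cr_nonpos: "cr i j \<le> 0"
  unfolding cr_def neg_le_0_iff_le by (intro add_nonneg_nonneg mult_nonneg_nonneg) auto

lemma sqrt_mult_le: "2 * (sqrt (omega r i) * sqrt (omega r j)) \<le> omega r i + omega r j"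
  using sum_squares_bound[of "sqrt (omega r i)" "sqrt (omega r j)"] by simp

text \<open>Arithmetic-geometric mean for the rates. Constants are thus supersolutions of rate zero,
  which yields boundedness of the series and contractivity in Hilbert--Schmidt norm.\<close>

lemma ones_super: "jump al be (\<lambda>_ _. 1) i j \<le> (- cr i j - 0) * 1"
proof -
  have "mu\<^sup>2 / 2 * (2 * (sqrt (omega r i) * sqrt (omega r j))) \<le> mu\<^sup>2 / 2 * (omega r i + omega r j)"
    "lam\<^sup>2 / 2 * (2 * (sqrt (omega r (Suc i)) * sqrt (omega r (Suc j)))) \<le> lam\<^sup>2 / 2 * (omega r (Suc i) + omega r (Suc j))"
    by (intro mult_left_mono sqrt_mult_le; simp)+
  then show ?thesis by (simp add: jump_def al_def be_def cr_def)
qed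

lemma D0_ones_sum: "0 \<le> t \<Longrightarrow> (\<Sum>n<N. D0 n t (\<lambda>_ _. 1) i j) \<le> 1"
  using dyson_super[where P = "\<lambda>_. True" and h = "\<lambda>_ _. 1" and c = cr and \<kappa> = 0, OF ones_super] by simp

lemma D_norm_le: "(\<And>i j. cmod (x i j) \<le> y i j) \<Longrightarrow> 0 \<le> t \<Longrightarrow> cmod (D n t x i j) \<le> D0 n t y i j"
  by (rule dyson_norm_le) (simp_all add: norm_exp_cc del: norm_exp_eq_Re)

text \<open>The majorant series for the all-ones matrix is at most one, so the bound is uniform in
  \<open>t\<close> and \<open>N\<close> although the jump rates are unbounded.\<close>

lemma D_bdd_sum:
  assumes "\<And>i j. cmod (x i j) \<le> C" "0 \<le> t"
  shows "(\<Sum>n<N. cmod (D n t x i j)) \<le> C"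
proof -
  have C: "C \<ge> 0" using assms(1)[of 0 0] norm_ge_zero order_trans by blast
  have "cmod (D n t x i j) \<le> C * D0 n t (\<lambda>_ _. 1) i j" for n
    using D_norm_le[of x "\<lambda>_ _. C * 1" t n i j] assms dyson_cmult[of al be cr n t C "\<lambda>_ _. 1" i j] by simp
  then have "(\<Sum>n<N. cmod (D n t x i j)) \<le> (\<Sum>n<N. C * D0 n t (\<lambda>_ _. 1) i j)"
    by (intro sum_mono)
  also have "\<dots> \<le> C * 1"
    unfolding sum_distrib_left[symmetric] by (intro mult_left_mono D0_ones_sum assms C)
  finally show ?thesis by simp
qed

lemma D_summable:
  assumes "\<And>i j. cmod (x i j) \<le> C" "0 \<le> t"
  shows "summable (\<lambda>n. cmod (D n t x i j))"
  by (rule summableI_nonneg_bounded[OF _ D_bdd_sum[OF assms]]) auto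

definition evol :: "real \<Rightarrow> mat \<Rightarrow> mat" where
  "evol t x = (\<lambda>i j. \<Sum>n. D n t x i j)"

lemma evol_lim:
  assumes "\<And>i j. cmod (x i j) \<le> C" "0 \<le> t"
  shows "(\<lambda>N. \<Sum>n<N. D n t x i j) \<longlonglongrightarrow> evol t x i j"
  unfolding evol_def by (rule summable_LIMSEQ[OF summable_norm_cancel[OF D_summable[OF assms]]])

section \<open>Bounds and positivity for forms of the Dyson terms\<close>

lemma exp_cc: "exp (of_real t * cc i j) = cnj (exp (of_real t * gcoef r lam mu zp zm i)) * exp (of_real t * gcoef r lam mu zp zm j)"
  by (simp add: cc_def exp_cnj distrib_left mult_exp_exp)

lemma form_P: "form M (\<lambda>i j. exp (of_real t * cc i j) * x i j) v u = form M x (P t v) (P t u)"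
  by (simp add: form_def exp_cc semP_def mult_ac)

text \<open>Lowering loses \<open>e_0\<close>, hence size \<open>M - 1\<close>; raising, in the
  companion lemma, gives \<open>Suc M\<close>. Exact sizes close the recursion on finite
  forms.\<close>

lemma form_L1:
  "form M (\<lambda>i j. exp (of_real t * cc i j) * (of_real (al i j) * X (i - 1) (j - 1))) v u
     = form (M - 1) X (L1 (P t v)) (L1 (P t u))"
proof (cases M)
  case (Suc K)
  have "form M (\<lambda>i j. exp (of_real t * cc i j) * (of_real (al i j) * X (i - 1) (j - 1))) v u
     = (\<Sum>i<K. \<Sum>j<K. cnj (v (Suc i)) * (exp (of_real t * cc (Suc i) (Suc j)) * (of_real (al (Suc i) (Suc j)) * X i j)) * u (Suc j))"
    unfolding form_def Suc by (subst sum_square_shift) simp_all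
  also have "\<dots> = form K X (L1 (P t v)) (L1 (P t u))"
    by (simp add: form_def exp_cc semP_def opL1_def opB_def al_def power2_eq_square mult_ac)
  finally show ?thesis using Suc by simp
qed (simp add: form_def)

lemma form_L2:
  "form M (\<lambda>i j. exp (of_real t * cc i j) * (of_real (be i j) * X (Suc i) (Suc j))) v u
     = form (Suc M) X (L2 (P t v)) (L2 (P t u))"
proof -
  have "form (Suc M) X (L2 (P t v)) (L2 (P t u)) =
     (\<Sum>i<M. \<Sum>j<M. cnj (L2 (P t v) (Suc i)) * X (Suc i) (Suc j) * L2 (P t u) (Suc j))"
    unfolding form_def by (rule sum_square_shift) (simp_all add: opL2_def opBp_def)
  then show ?thesis
    by (simp add: form_def exp_cc semP_def opL2_def opBp_def be_def power2_eq_square mult_ac)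
qed

lemma form_jump:
  "form M (\<lambda>i j. exp (of_real t * cc i j) * jump al be X i j) v u
     = form (M - 1) X (L1 (P t v)) (L1 (P t u)) + form (Suc M) X (L2 (P t v)) (L2 (P t u))"
  unfolding form_L1[symmetric] form_L2[symmetric] form_add_mat[symmetric]
  by (simp add: jump_def distrib_left)

lemma form_D_Suc:
  "((\<lambda>s. form (M - 1) (D n s x) (L1 (P (t - s) v)) (L1 (P (t - s) u))
      + form (Suc M) (D n s x) (L2 (P (t - s) v)) (L2 (P (t - s) u))) has_integral form M (D (Suc n) t x) v u) {0..t}"
  unfolding form_jump[symmetric] dyson.simps
  by (rule form_integral) (rule dyson_integrand_integrable)

definition weighted_norm_sq :: "nat \<Rightarrow> (nat \<Rightarrow> real) \<Rightarrow> vec \<Rightarrow> real" where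
  "weighted_norm_sq M d u = (\<Sum>i<M. (cmod (u i))\<^sup>2 * d i)"

text \<open>Probability that the birth-death chain with birth rates \<open>be i i\<close> and death
  rates \<open>al i i\<close>, started at \<open>i\<close>, makes exactly \<open>n\<close> jumps up
  to time \<open>t\<close>. On the main diagonal the coefficient \<open>cr\<close> is minus the
  total exit rate.\<close>

abbreviation "jump_mass n t \<equiv> (\<lambda>i. D0 n t (\<lambda>_ _. 1) i i)"

lemma weighted_norm_sq_P: "weighted_norm_sq M d (P t u) = weighted_norm_sq M (\<lambda>i. exp (t * cr i i) * d i) u"
proof -
  have "(cmod (P t u i))\<^sup>2 = exp (t * cr i i) * (cmod (u i))\<^sup>2" for i
    unfolding norm_exp_cc[symmetric] exp_cc by (simp add: semP_def norm_mult power2_eq_square)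
  then show ?thesis by (simp add: weighted_norm_sq_def mult_ac)
qed

lemma weighted_norm_sq_L1: "weighted_norm_sq (M - 1) d (L1 u) = weighted_norm_sq M (\<lambda>i. al i i * d (i - 1)) u"
proof (cases M)
  case (Suc K)
  have "(cmod (L1 u i))\<^sup>2 = al (Suc i) (Suc i) * (cmod (u (Suc i)))\<^sup>2" for i
    by (simp add: opL1_def opB_def al_def norm_mult power_mult_distrib)
  then show ?thesis
    unfolding Suc weighted_norm_sq_def by (subst sum.lessThan_Suc_shift) (simp add: mult_ac)
qed (simp add: weighted_norm_sq_def)

lemma weighted_norm_sq_L2: "weighted_norm_sq (Suc M) d (L2 u) = weighted_norm_sq M (\<lambda>i. be i i * d (Suc i)) u"
proof -
  have "(cmod (L2 u (Suc i)))\<^sup>2 = be i i * (cmod (u i))\<^sup>2" for i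
    by (simp add: opL2_def opBp_def be_def norm_mult power_mult_distrib)
  moreover have "L2 u 0 = 0" by (simp add: opL2_def opBp_def)
  ultimately show ?thesis
    unfolding weighted_norm_sq_def by (subst sum.lessThan_Suc_shift) (simp add: mult_ac)
qed

lemma weighted_norm_sq_D0_Suc:
  "((\<lambda>s. weighted_norm_sq (M - 1) (jump_mass n s) (L1 (P (t - s) u)) + weighted_norm_sq (Suc M) (jump_mass n s) (L2 (P (t - s) u)))
     has_integral weighted_norm_sq M (jump_mass (Suc n) t) u) {0..t}"
proof -
  have eq: "weighted_norm_sq (M - 1) (jump_mass n s) (L1 (P (t - s) u)) + weighted_norm_sq (Suc M) (jump_mass n s) (L2 (P (t - s) u))
    = (\<Sum>i<M. (cmod (u i))\<^sup>2 * (exp (of_real (t - s) * cr i i) * jump al be (D0 n s (\<lambda>_ _. 1)) i i))" for s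
    unfolding weighted_norm_sq_L1 weighted_norm_sq_L2 weighted_norm_sq_P unfolding weighted_norm_sq_def jump_def by (simp add: sum.distrib algebra_simps)
  have *: "weighted_norm_sq M (jump_mass (Suc n) t) u = (\<Sum>i<M. (cmod (u i))\<^sup>2 * integral {0..t} (\<lambda>s. exp (of_real (t - s) * cr i i) * jump al be (D0 n s (\<lambda>_ _. 1)) i i))"
    by (simp add: weighted_norm_sq_def)
  show ?thesis unfolding eq *
    by (intro has_integral_sum finite_lessThan has_integral_mult_right integrable_integral dyson_integrand_integrable)
qed

text \<open>This replaces an appeal to complete positivity: polarised in \<open>v\<close> and \<open>u\<close>, the bound is stable
  under the integral recursion, and scaling turns it into an operator norm bound.\<close>

lemma form_D_bound:
  assumes x: "\<And>M v u. 2 * cmod (form M x v u) \<le> C * ((trunc_norm M v)\<^sup>2 + (trunc_norm M u)\<^sup>2)"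
  shows "0 \<le> t \<Longrightarrow> 2 * cmod (form M (D n t x) v u) \<le> C * (weighted_norm_sq M (jump_mass n t) v + weighted_norm_sq M (jump_mass n t) u)"
proof (induction n arbitrary: M t v u)
  case 0
  have "weighted_norm_sq M (jump_mass 0 t) u = (trunc_norm M (P t u))\<^sup>2" for u
    using weighted_norm_sq_P[of M "\<lambda>_. 1" t u] by (simp add: weighted_norm_sq_def trunc_norm_sq)
  then show ?case
    using x[of M "P t v" "P t u"] by (simp add: form_P)
next
  case (Suc n)
  let ?h = "\<lambda>s. form (M - 1) (D n s x) (L1 (P (t - s) v)) (L1 (P (t - s) u))
      + form (Suc M) (D n s x) (L2 (P (t - s) v)) (L2 (P (t - s) u))"
  let ?w = "\<lambda>u s. weighted_norm_sq (M - 1) (jump_mass n s) (L1 (P (t - s) u)) + weighted_norm_sq (Suc M) (jump_mass n s) (L2 (P (t - s) u))"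
  have h: "((\<lambda>s. 2 * ?h s) has_integral 2 * form M (D (Suc n) t x) v u) {0..t}"
    by (intro has_integral_mult_right form_D_Suc)
  have w: "((\<lambda>s. C * (?w v s + ?w u s)) has_integral C * (weighted_norm_sq M (jump_mass (Suc n) t) v + weighted_norm_sq M (jump_mass (Suc n) t) u)) {0..t}"
    by (intro has_integral_mult_right has_integral_add weighted_norm_sq_D0_Suc)
  have "norm (integral {0..t} (\<lambda>s. 2 * ?h s)) \<le> integral {0..t} (\<lambda>s. C * (?w v s + ?w u s))"
  proof (rule integral_norm_bound_integral[OF has_integral_integrable[OF h] has_integral_integrable[OF w]])
    fix s assume "s \<in> {0..t}"
    then have s: "s \<ge> 0" by simp
    have "norm (2 * ?h s) \<le> 2 * cmod (form (M - 1) (D n s x) (L1 (P (t - s) v)) (L1 (P (t - s) u)))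
        + 2 * cmod (form (Suc M) (D n s x) (L2 (P (t - s) v)) (L2 (P (t - s) u)))"
      unfolding distrib_left by (rule order_trans[OF norm_triangle_ineq]) (simp add: norm_mult)
    also have "\<dots> \<le> C * (weighted_norm_sq (M - 1) (jump_mass n s) (L1 (P (t - s) v)) + weighted_norm_sq (M - 1) (jump_mass n s) (L1 (P (t - s) u)))
        + C * (weighted_norm_sq (Suc M) (jump_mass n s) (L2 (P (t - s) v)) + weighted_norm_sq (Suc M) (jump_mass n s) (L2 (P (t - s) u)))"
      by (intro add_mono Suc.IH s)
    finally show "norm (2 * ?h s) \<le> C * (?w v s + ?w u s)"
      by (simp add: algebra_simps)
  qed
  then show ?case
    unfolding integral_unique[OF h] integral_unique[OF w] by (simp add: norm_mult)
qed

lemma form_sum_mat: "form M (\<lambda>i j. \<Sum>n\<in>A. X n i j) v u = (\<Sum>n\<in>A. form M (X n) v u)"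
  by (induction A rule: infinite_finite_induct) (simp_all add: form_add_mat form_def)

lemma weighted_norm_sq_jump_mass_sum: "0 \<le> t \<Longrightarrow> (\<Sum>n<N. weighted_norm_sq M (jump_mass n t) u) \<le> (trunc_norm M u)\<^sup>2"
proof -
  assume t: "0 \<le> t"
  have "(\<Sum>n<N. weighted_norm_sq M (jump_mass n t) u) = (\<Sum>i<M. (cmod (u i))\<^sup>2 * (\<Sum>n<N. jump_mass n t i))"
    unfolding weighted_norm_sq_def by (subst sum.swap) (simp add: sum_distrib_left)
  also have "\<dots> \<le> (\<Sum>i<M. (cmod (u i))\<^sup>2 * 1)"
    by (intro sum_mono mult_left_mono D0_ones_sum t) auto
  finally show ?thesis by (simp add: trunc_norm_sq)
qed

text \<open>The jump masses add up to at most one, so the bounds for the single Dyson terms sum to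
  the original constant \<open>C\<close> and the evolution is a contraction.\<close>

lemma form_bdd_evol:
  assumes x: "form_bdd C x" and t: "0 \<le> t"
  shows "form_bdd C (evol t x)"
proof (rule form_bddI_quad)
  have e: "cmod (x i j) \<le> C" for i j by (rule form_bdd_entry[OF x])
  show C: "C \<ge> 0" using e[of 0 0] norm_ge_zero order_trans by blast
  have q: "2 * cmod (form M x v u) \<le> C * ((trunc_norm M v)\<^sup>2 + (trunc_norm M u)\<^sup>2)" for M v u
  proof -
    have "2 * cmod (form M x v u) \<le> C * (2 * trunc_norm M v * trunc_norm M u)"
      using x[unfolded form_bdd_def, rule_format, of M v u] by (simp add: mult_ac)
    also have "\<dots> \<le> C * ((trunc_norm M v)\<^sup>2 + (trunc_norm M u)\<^sup>2)"
      by (intro mult_left_mono C sum_squares_bound)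
    finally show ?thesis .
  qed
  fix M v u
  show "2 * cmod (form M (evol t x) v u) \<le> C * ((trunc_norm M v)\<^sup>2 + (trunc_norm M u)\<^sup>2)"
  proof (rule LIMSEQ_le_const2)
    show "(\<lambda>N. 2 * cmod (form M (\<lambda>i j. \<Sum>n<N. D n t x i j) v u)) \<longlonglongrightarrow> 2 * cmod (form M (evol t x) v u)"
      by (intro tendsto_intros form_tendsto_entry evol_lim[OF e t])
    have "2 * cmod (form M (\<lambda>i j. \<Sum>n<N. D n t x i j) v u) \<le> C * ((trunc_norm M v)\<^sup>2 + (trunc_norm M u)\<^sup>2)" for N
    proof -
      have "2 * cmod (form M (\<lambda>i j. \<Sum>n<N. D n t x i j) v u) \<le> (\<Sum>n<N. 2 * cmod (form M (D n t x) v u))"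
        unfolding form_sum_mat by (simp add: sum_distrib_left[symmetric] norm_sum)
      also have "\<dots> \<le> (\<Sum>n<N. C * (weighted_norm_sq M (jump_mass n t) v + weighted_norm_sq M (jump_mass n t) u))"
        by (intro sum_mono form_D_bound q t)
      also have "\<dots> = C * ((\<Sum>n<N. weighted_norm_sq M (jump_mass n t) v) + (\<Sum>n<N. weighted_norm_sq M (jump_mass n t) u))"
        by (simp add: sum_distrib_left[symmetric] sum.distrib)
      also have "\<dots> \<le> C * ((trunc_norm M v)\<^sup>2 + (trunc_norm M u)\<^sup>2)"
        by (intro mult_left_mono add_mono weighted_norm_sq_jump_mass_sum t C)
      finally show ?thesis .
    qed
    then show "\<exists>N. \<forall>n\<ge>N. 2 * cmod (form M (\<lambda>i j. \<Sum>n<n. D n t x i j) v u) \<le> C * ((trunc_norm M v)\<^sup>2 + (trunc_norm M u)\<^sup>2)"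
      by blast
  qed
qed

text \<open>Each step of the recursion conjugates by \<open>P\<close>, \<open>L1\<close> or
  \<open>L2\<close> and integrates in time; both operations keep quadratic forms
  nonnegative.\<close>

lemma nonneg_D:
  assumes x: "\<And>M u. nonneg_c (form M x u u)"
  shows "0 \<le> t \<Longrightarrow> nonneg_c (form M (D n t x) u u)"
proof (induction n arbitrary: M t u)
  case 0
  show ?case by (simp add: form_P x)
next
  case (Suc n)
  show ?case
    by (rule nonneg_c_integral[OF form_D_Suc]) (auto intro!: nonneg_c_add Suc.IH)
qed

lemma pos_mat_evol:
  assumes "pos_mat x" "0 \<le> t" shows "pos_mat (evol t x)"
proof -
  obtain C where C: "form_bdd C x" using assms by (auto simp: pos_mat_iff bounded_mat_iff)
  show ?thesis unfolding pos_mat_iff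
  proof (intro conjI allI)
    show "bounded_mat (evol t x)" using form_bdd_evol[OF C assms(2)] by (auto simp: bounded_mat_iff)
    fix M u
    show "nonneg_c (form M (evol t x) u u)"
    proof (rule nonneg_c_lim)
      show "(\<lambda>N. form M (\<lambda>i j. \<Sum>n<N. D n t x i j) u u) \<longlonglongrightarrow> form M (evol t x) u u"
        by (intro form_tendsto_entry evol_lim[OF form_bdd_entry[OF C]] assms)
      show "nonneg_c (form M (\<lambda>i j. \<Sum>n<N. D n t x i j) u u)" for N
        unfolding form_sum_mat using assms by (intro nonneg_c_sum nonneg_D) (auto simp: pos_mat_iff)
    qed
  qed
qed

end

section \<open>The minimal semigroup\<close>

text \<open>Integrability is inherited from the continuous finite forms, which converge pointwise
  under a constant majorant built from the time-independent bounds \<open>V0\<close> and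
  \<open>U0\<close>.\<close>

lemma integrable_form_limit:
  assumes V: "\<And>s n. s \<in> {0..t} \<Longrightarrow> cmod (V s n) \<le> cmod (V0 n)" "V0 \<in> ell2"
    and U: "\<And>s n. s \<in> {0..t} \<Longrightarrow> cmod (U s n) \<le> cmod (U0 n)" "U0 \<in> ell2"
    and X: "\<And>s. s \<in> {0..t::real} \<Longrightarrow> form_bdd C (X s)"
    and cont: "\<And>M. continuous_on {0..t} (\<lambda>s. form M (X s) (V s) (U s))"
  shows "(\<lambda>s. vinner (V s) (mapply (X s) (U s))) integrable_on {0..t}"
    and "(\<lambda>M. integral {0..t} (\<lambda>s. form M (X s) (V s) (U s)))
      \<longlonglongrightarrow> integral {0..t} (\<lambda>s. vinner (V s) (mapply (X s) (U s)))"
proof -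
  have le: "norm (form M (X s) (V s) (U s)) \<le> C * vnorm V0 * vnorm U0" if s: "s \<in> {0..t}" for M s
  proof -
    have C: "C \<ge> 0" using form_bdd_entry[OF X[OF s], of 0 0] norm_ge_zero order_trans by blast
    have "cmod (form M (X s) (V s) (U s)) \<le> C * vnorm (V s) * vnorm (U s)"
      by (rule form_bound[OF X[OF s] ell2_mono(1)[OF V(1)[OF s] V(2)] ell2_mono(1)[OF U(1)[OF s] U(2)]])
    also have "\<dots> \<le> C * vnorm V0 * vnorm U0"
      using ell2_mono[OF V(1)[OF s] V(2)] ell2_mono[OF U(1)[OF s] U(2)] C V(2)
      by (intro mult_mono mult_left_mono mult_nonneg_nonneg) (simp_all add: vnorm_nonneg)
    finally show ?thesis .
  qed
  have lim: "(\<lambda>M. form M (X s) (V s) (U s)) \<longlonglongrightarrow> vinner (V s) (mapply (X s) (U s))" if s: "s \<in> {0..t}" for s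
    by (rule form_tendsto[OF X[OF s] ell2_mono(1)[OF V(1)[OF s] V(2)] ell2_mono(1)[OF U(1)[OF s] U(2)]])
  note dc = dominated_convergence[where f = "\<lambda>M s. form M (X s) (V s) (U s)" and S = "{0..t}"
      and h = "\<lambda>_. C * vnorm V0 * vnorm U0", OF integrable_continuous_real[OF cont] integrable_const_ivl le lim]
  show "(\<lambda>s. vinner (V s) (mapply (X s) (U s))) integrable_on {0..t}" by (rule dc(1))
  show "(\<lambda>M. integral {0..t} (\<lambda>s. form M (X s) (V s) (U s)))
      \<longlonglongrightarrow> integral {0..t} (\<lambda>s. vinner (V s) (mapply (X s) (U s)))" by (rule dc(2))
qed

context qds begin

section \<open>The integral equation for the summed series, entry by entry\<close>

lemma jump_bound:
  assumes "\<And>i j. cmod (y i j) \<le> C"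
  shows "cmod (jump al be y i j) \<le> C * (al i j + be i j)"
  using jump_norm_le[of y "\<lambda>_ _. C" i j] assms by (simp add: jump_def algebra_simps)

text \<open>For one fixed entry the rates \<open>al i j\<close> and \<open>be i j\<close> are mere
  constants, so dominated convergence in time lets the series pass through the jump operator and the
  integral.\<close>

lemma evol_dominated:
  assumes e: "\<And>i j. cmod (x i j) \<le> C" and phi: "continuous_on {0..T} phi"
  shows "(\<lambda>s. phi s * jump al be (evol s x) i j) integrable_on {0..T}"
    and "(\<lambda>N. integral {0..T} (\<lambda>s. phi s * jump al be (\<lambda>i j. \<Sum>n<N. D n s x i j) i j))
       \<longlonglongrightarrow> integral {0..T} (\<lambda>s. phi s * jump al be (evol s x) i j)"
proof -
  have 1: "(\<lambda>s. phi s * jump al be (\<lambda>i j. \<Sum>n<N. D n s x i j) i j) integrable_on {0..T}" for N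
    by (intro integrable_continuous_real continuous_intros phi dyson_sum_jump_cont)
  have 2: "(\<lambda>s. cmod (phi s) * (C * (al i j + be i j))) integrable_on {0..T}"
    by (intro integrable_continuous_real continuous_intros phi)
  have 3: "norm (phi s * jump al be (\<lambda>i j. \<Sum>n<N. D n s x i j) i j) \<le> cmod (phi s) * (C * (al i j + be i j))"
    if "s \<in> {0..T}" for s N
    unfolding norm_mult using that
    by (intro mult_left_mono jump_bound order_trans[OF norm_sum] D_bdd_sum[OF e]) auto
  have 4: "(\<lambda>N. phi s * jump al be (\<lambda>i j. \<Sum>n<N. D n s x i j) i j) \<longlonglongrightarrow> phi s * jump al be (evol s x) i j"
    if "s \<in> {0..T}" for s
    unfolding jump_def using that by (intro tendsto_intros evol_lim[OF e]) auto
  note dc = dominated_convergence[OF 1 2 3 4]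
  show "(\<lambda>s. phi s * jump al be (evol s x) i j) integrable_on {0..T}" by (rule dc(1))
  show "(\<lambda>N. integral {0..T} (\<lambda>s. phi s * jump al be (\<lambda>i j. \<Sum>n<N. D n s x i j) i j))
       \<longlonglongrightarrow> integral {0..T} (\<lambda>s. phi s * jump al be (evol s x) i j)" by (rule dc(2))
qed

lemma exp_shift_cont: "continuous_on A (\<lambda>s. exp (of_real (t - s) * (z::complex)))"
  by (intro continuous_intros)

lemma evol_integrable:
  assumes "\<And>i j. cmod (x i j) \<le> C"
  shows "(\<lambda>s. exp (of_real (t - s) * cc i j) * jump al be (evol s x) i j) integrable_on {0..t}"
  by (rule evol_dominated(1)[OF assms exp_shift_cont])

lemma evol_eq:
  assumes e: "\<And>i j. cmod (x i j) \<le> C" and t: "0 \<le> t"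
  shows "evol t x i j = exp (of_real t * cc i j) * x i j +
     integral {0..t} (\<lambda>s. exp (of_real (t - s) * cc i j) * jump al be (evol s x) i j)"
proof (rule LIMSEQ_unique)
  show "(\<lambda>N. \<Sum>n<Suc N. D n t x i j) \<longlonglongrightarrow> evol t x i j"
    by (rule LIMSEQ_Suc[OF evol_lim[OF e t]])
  show "(\<lambda>N. \<Sum>n<Suc N. D n t x i j) \<longlonglongrightarrow> exp (of_real t * cc i j) * x i j +
     integral {0..t} (\<lambda>s. exp (of_real (t - s) * cc i j) * jump al be (evol s x) i j)"
    unfolding dyson_sum_Suc
    by (rule tendsto_add[OF tendsto_const evol_dominated(2)[OF e exp_shift_cont]])
qed

lemma evol_cont:
  assumes e: "\<And>i j. cmod (x i j) \<le> C"
  shows "continuous_on {0..T} (\<lambda>t. evol t x i j)"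
proof -
  \<comment> \<open>At this stage only integrability of the jump term is known. Factoring out
    \<open>exp (t * cc i j)\<close> reduces continuity to that of an indefinite integral.\<close>
  let ?k = "\<lambda>s. exp (- (of_real s * cc i j)) * jump al be (evol s x) i j"
  have k: "?k integrable_on {0..T}"
    by (rule evol_dominated(1)[OF e]) (intro continuous_intros)
  have "evol t x i j = exp (of_real t * cc i j) * (x i j + integral {0..t} ?k)" if t: "t \<in> {0..T}" for t
  proof -
    have "(\<lambda>s. exp (of_real (t - s) * cc i j) * jump al be (evol s x) i j) = (\<lambda>s. exp (of_real t * cc i j) * ?k s)"
      by (simp add: fun_eq_iff algebra_simps mult_exp_exp flip: mult.assoc)
    then show ?thesis
      using evol_eq[OF e, where t=t and i=i and j=j] t by (simp add: distrib_left)
  qed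
  note eq = this
  have "continuous_on {0..T} (\<lambda>t. exp (of_real t * cc i j) * (x i j + integral {0..t} ?k))"
    by (intro continuous_intros indefinite_integral_continuous_1 k)
  then show ?thesis by (rule continuous_on_eq) (simp only: eq)
qed

lemma form_evol:
  assumes e: "\<And>i j. cmod (x i j) \<le> C" and t: "0 \<le> t"
  shows "((\<lambda>s. form (M - 1) (evol s x) (L1 (P (t - s) v)) (L1 (P (t - s) u))
      + form (Suc M) (evol s x) (L2 (P (t - s) v)) (L2 (P (t - s) u))) has_integral
      (form M (evol t x) v u - form M x (P t v) (P t u))) {0..t}"
proof -
  have "form M (evol t x) v u = form M x (P t v) (P t u) +
      form M (\<lambda>i j. integral {0..t} (\<lambda>s. exp (of_real (t - s) * cc i j) * jump al be (evol s x) i j)) v u"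
  proof -
    have "evol t x = (\<lambda>i j. exp (of_real t * cc i j) * x i j +
        integral {0..t} (\<lambda>s. exp (of_real (t - s) * cc i j) * jump al be (evol s x) i j))"
      by (intro ext evol_eq[OF e t])
    then show ?thesis by (simp only: form_add_mat form_P)
  qed
  then show ?thesis
    unfolding form_jump[symmetric] using form_integral[OF evol_integrable[OF e]] by simp
qed

lemma form_D_sum:
  "((\<lambda>s. form (M - 1) (\<lambda>i j. \<Sum>n<N. D n s x i j) (L1 (P (t - s) v)) (L1 (P (t - s) u))
      + form (Suc M) (\<lambda>i j. \<Sum>n<N. D n s x i j) (L2 (P (t - s) v)) (L2 (P (t - s) u))) has_integral
      (form M (\<lambda>i j. \<Sum>n<Suc N. D n t x i j) v u - form M x (P t v) (P t u))) {0..t}"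
proof -
  have i: "(\<lambda>s. exp (of_real (t - s) * cc i j) * jump al be (\<lambda>i j. \<Sum>n<N. D n s x i j) i j) integrable_on {0..t}" for i j
    by (intro integrable_continuous_real continuous_on_mult exp_shift_cont dyson_sum_jump_cont)
  have "form M (\<lambda>i j. \<Sum>n<Suc N. D n t x i j) v u = form M x (P t v) (P t u) +
      form M (\<lambda>i j. integral {0..t} (\<lambda>s. exp (of_real (t - s) * cc i j) * jump al be (\<lambda>i j. \<Sum>n<N. D n s x i j) i j)) v u"
    unfolding form_P[symmetric] form_add_mat[symmetric] dyson_sum_Suc ..
  then show ?thesis
    unfolding form_jump[symmetric] using form_integral[OF i] by simp
qed

section \<open>The weak integral equation on \<open>domN2\<close>\<close>

lemma cmod_P_le: "0 \<le> t \<Longrightarrow> cmod (P t u n) \<le> cmod (u n)"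
proof -
  assume t: "0 \<le> t"
  have "2 * Re (gcoef r lam mu zp zm n) = cr n n"
    by (simp add: Re_cc[symmetric] cc_def)
  then have "t * Re (gcoef r lam mu zp zm n) \<le> 0"
    using cr_nonpos[of n n] t by (intro mult_nonneg_nonpos) auto
  then show ?thesis
    by (auto simp: semP_def norm_mult norm_exp_eq_Re intro!: mult_left_le_one_le)
qed

lemma cmod_L1_P_le: "0 \<le> t \<Longrightarrow> cmod (L1 (P t u) n) \<le> cmod (L1 u n)"
  by (auto simp: opL1_def opB_def norm_mult intro!: mult_left_mono cmod_P_le)

lemma cmod_L2_P_le: "0 \<le> t \<Longrightarrow> cmod (L2 (P t u) n) \<le> cmod (L2 u n)"
  by (auto simp: opL2_def opBp_def norm_mult intro!: mult_left_mono cmod_P_le)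

lemma P_ell2: "0 \<le> t \<Longrightarrow> u \<in> ell2 \<Longrightarrow> P t u \<in> ell2"
  by (rule ell2_mono(1)[OF cmod_P_le])

lemma omega_le: "omega r n \<le> (1 + r) * (real n)\<^sup>2"
proof (cases n)
  case (Suc k)
  have "real n * (real n + r - 1) \<le> real n * ((1 + r) * real n)"
    using r_pos Suc by (intro mult_left_mono) (auto simp: algebra_simps)
  then show ?thesis by (simp add: omega_def power2_eq_square mult_ac)
qed simp

lemma L1_ell2: "u \<in> domN2 \<Longrightarrow> L1 u \<in> ell2"
proof -
  assume u: "u \<in> domN2"
  let ?h = "\<lambda>n. ((real n)\<^sup>2 * cmod (u n))\<^sup>2"
  have "summable (\<lambda>n. ?h (Suc n))"
    using u unfolding domN2_def mem_Collect_eq by (subst summable_Suc_iff) blast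
  then have s: "summable (\<lambda>n. mu\<^sup>2 * (1 + r) * ?h (Suc n))"
    by (rule summable_mult)
  have "summable (\<lambda>n. (cmod (L1 u n))\<^sup>2)"
  proof (rule summable_comparison_test'[OF s])
    fix n
    have "omega r (Suc n) \<le> (1 + r) * (real (Suc n))\<^sup>2" by (rule omega_le)
    also have "\<dots> \<le> (1 + r) * ((real (Suc n))\<^sup>2)\<^sup>2"
      using r_pos by (intro mult_left_mono self_le_power one_le_power) auto
    finally have "mu\<^sup>2 * omega r (Suc n) * (cmod (u (Suc n)))\<^sup>2 \<le> mu\<^sup>2 * ((1 + r) * ((real (Suc n))\<^sup>2)\<^sup>2) * (cmod (u (Suc n)))\<^sup>2"
      by (intro mult_left_mono mult_right_mono) auto
    then show "norm ((cmod (L1 u n))\<^sup>2) \<le> mu\<^sup>2 * (1 + r) * ?h (Suc n)"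
      by (simp add: opL1_def opB_def norm_mult power_mult_distrib mult_ac del: of_nat_Suc)
  qed
  then show ?thesis by (simp add: ell2_def)
qed

lemma L2_ell2: "u \<in> domN2 \<Longrightarrow> L2 u \<in> ell2"
proof -
  assume u: "u \<in> domN2"
  let ?h = "\<lambda>n. ((real n)\<^sup>2 * cmod (u n))\<^sup>2" and ?k = "\<lambda>n. (cmod (u n))\<^sup>2"
  have "summable ?h" "summable ?k"
    using u unfolding domN2_def ell2_def by auto
  then have s: "summable (\<lambda>n. lam\<^sup>2 * (1 + r) * 4 * (?k n + ?h n))"
    by (intro summable_mult summable_add)
  have "summable (\<lambda>n. (cmod (L2 u (Suc n)))\<^sup>2)"
  proof (rule summable_comparison_test'[OF s])
    fix n
    \<comment> \<open>The summand \<open>1\<close> covers \<open>n = 0\<close>, where the weight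
      from \<open>domN2\<close> vanishes but \<open>omega r (Suc n)\<close> does not; this is why
      \<open>?k\<close> joins \<open>?h\<close> in the majorant.\<close>
    have n2: "(real (Suc n))\<^sup>2 \<le> 4 * (1 + ((real n)\<^sup>2)\<^sup>2)"
    proof (cases n)
      case (Suc k)
      have "real (Suc n) \<le> 2 * real n" using Suc by simp
      then have "(real (Suc n))\<^sup>2 \<le> (2 * real n)\<^sup>2" by (intro power_mono) auto
      also have "\<dots> = 4 * (real n)\<^sup>2" by simp
      also have "\<dots> \<le> 4 * ((real n)\<^sup>2)\<^sup>2"
        using Suc by (intro mult_left_mono self_le_power one_le_power) auto
      finally show ?thesis by simp
    qed simp
    have "omega r (Suc n) \<le> (1 + r) * (4 * (1 + ((real n)\<^sup>2)\<^sup>2))"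
      using n2 r_pos by (intro order_trans[OF omega_le] mult_left_mono) auto
    then have "lam\<^sup>2 * omega r (Suc n) * (cmod (u n))\<^sup>2 \<le> lam\<^sup>2 * ((1 + r) * (4 * (1 + ((real n)\<^sup>2)\<^sup>2))) * (cmod (u n))\<^sup>2"
      by (intro mult_left_mono mult_right_mono) auto
    then show "norm ((cmod (L2 u (Suc n)))\<^sup>2) \<le> lam\<^sup>2 * (1 + r) * 4 * (?k n + ?h n)"
      by (simp add: opL2_def opBp_def norm_mult power_mult_distrib algebra_simps)
  qed
  then have "summable (\<lambda>n. (cmod (L2 u n))\<^sup>2)"
    by (subst (asm) summable_Suc_iff)
  then show ?thesis by (simp add: ell2_def)
qed

lemma form_evol_equation:
  assumes x: "form_bdd C x" and t: "0 \<le> t" and u: "u \<in> domN2" and v: "v \<in> domN2"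
  shows "\<exists>I1 I2. ((\<lambda>s. vinner (L1 (P (t - s) v)) (mapply (evol s x) (L1 (P (t - s) u)))) has_integral I1) {0..t} \<and>
     ((\<lambda>s. vinner (L2 (P (t - s) v)) (mapply (evol s x) (L2 (P (t - s) u)))) has_integral I2) {0..t} \<and>
     vinner v (mapply (evol t x) u) = vinner (P t v) (mapply x (P t u)) + I1 + I2"
proof -
  have e: "cmod (x i j) \<le> C" for i j by (rule form_bdd_entry[OF x])
  have u2: "u \<in> ell2" and v2: "v \<in> ell2" using u v by (auto simp: domN2_def)
  have cont1: "continuous_on {0..t} (\<lambda>s. form M (evol s x) (L1 (P (t - s) v)) (L1 (P (t - s) u)))" for M
    unfolding form_def opL1_def opB_def semP_def by (intro continuous_intros evol_cont[OF e])
  have opL2_cont: "continuous_on {0..t} (\<lambda>s. L2 (P (t - s) v) n)" for v n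
    by (cases n) (auto simp: opL2_def opBp_def semP_def intro!: continuous_intros)
  have cont2: "continuous_on {0..t} (\<lambda>s. form M (evol s x) (L2 (P (t - s) v)) (L2 (P (t - s) u)))" for M
    unfolding form_def by (intro continuous_intros evol_cont[OF e] opL2_cont)
  have bd: "form_bdd C (evol s x)" if "s \<in> {0..t}" for s
    using form_bdd_evol[OF x] that by simp
  let ?f1 = "\<lambda>M s. form M (evol s x) (L1 (P (t - s) v)) (L1 (P (t - s) u))"
  let ?f2 = "\<lambda>M s. form M (evol s x) (L2 (P (t - s) v)) (L2 (P (t - s) u))"
  let ?g1 = "\<lambda>s. vinner (L1 (P (t - s) v)) (mapply (evol s x) (L1 (P (t - s) u)))"
  let ?g2 = "\<lambda>s. vinner (L2 (P (t - s) v)) (mapply (evol s x) (L2 (P (t - s) u)))"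
  have V: "cmod (L1 (P (t - s) v) n) \<le> cmod (L1 v n)" "cmod (L2 (P (t - s) v) n) \<le> cmod (L2 v n)"
    if "s \<in> {0..t}" for s n v
    using that by (auto intro: cmod_L1_P_le cmod_L2_P_le)
  have g1: "?g1 integrable_on {0..t}" and l1: "(\<lambda>M. integral {0..t} (?f1 M)) \<longlonglongrightarrow> integral {0..t} ?g1"
    by (rule integrable_form_limit[OF V(1) L1_ell2[OF v] V(1) L1_ell2[OF u] bd cont1]; assumption)+
  have g2: "?g2 integrable_on {0..t}" and l2: "(\<lambda>M. integral {0..t} (?f2 M)) \<longlonglongrightarrow> integral {0..t} ?g2"
    by (rule integrable_form_limit[OF V(2) L2_ell2[OF v] V(2) L2_ell2[OF u] bd cont2]; assumption)+
  \<comment> \<open>At size \<open>Suc M\<close> the lowering term lives on size \<open>M\<close>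
    and the raising term on \<open>Suc (Suc M)\<close>. The shifts do not affect the limits taken
    afterwards.\<close>
  have eq: "form (Suc M) (evol t x) v u = form (Suc M) x (P t v) (P t u) + integral {0..t} (?f1 M) + integral {0..t} (?f2 (Suc (Suc M)))" for M
  proof -
    have "((\<lambda>s. ?f1 M s + ?f2 (Suc (Suc M)) s) has_integral (integral {0..t} (?f1 M) + integral {0..t} (?f2 (Suc (Suc M))))) {0..t}"
      by (intro has_integral_add integrable_integral integrable_continuous_real cont1 cont2)
    from has_integral_unique[OF this] form_evol[where x = x and C = C and M = "Suc M" and u = u and v = v, OF e t]
    show ?thesis by (simp add: algebra_simps)
  qed
  have "vinner v (mapply (evol t x) u) = vinner (P t v) (mapply x (P t u)) + integral {0..t} ?g1 + integral {0..t} ?g2"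
  proof (rule LIMSEQ_unique)
    show "(\<lambda>M. form (Suc M) (evol t x) v u) \<longlonglongrightarrow> vinner v (mapply (evol t x) u)"
      by (rule LIMSEQ_Suc[OF form_tendsto[OF form_bdd_evol[OF x t] v2 u2]])
    show "(\<lambda>M. form (Suc M) (evol t x) v u) \<longlonglongrightarrow> vinner (P t v) (mapply x (P t u)) + integral {0..t} ?g1 + integral {0..t} ?g2"
      unfolding eq
      by (intro tendsto_add l1 LIMSEQ_Suc[OF form_tendsto[OF x P_ell2[OF t v2] P_ell2[OF t u2]]]
          LIMSEQ_Suc[OF LIMSEQ_Suc[OF l2]])
  qed
  then show ?thesis using g1 g2 by (blast intro: integrable_integral)
qed

text \<open>The value \<open>zero_mat\<close> outside nonnegative times and bounded matrices is the
  normalisation demanded by \<open>qds_solution\<close>.\<close>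

definition minimal_sol :: "real \<Rightarrow> mat \<Rightarrow> mat" where
  "minimal_sol t x = (if t < 0 \<or> \<not> bounded_mat x then zero_mat else evol t x)"

lemma bounded_mat_entry: "bounded_mat x \<Longrightarrow> \<exists>C. \<forall>i j. cmod (x i j) \<le> C"
  by (auto simp: bounded_mat_iff dest: form_bdd_entry)

lemma bounded_mat_add: "bounded_mat x \<Longrightarrow> bounded_mat y \<Longrightarrow> bounded_mat (\<lambda>i j. x i j + y i j)"
  by (auto simp: bounded_mat_iff dest: form_bdd_add)

lemma bounded_mat_cmult: "bounded_mat x \<Longrightarrow> bounded_mat (\<lambda>i j. k * x i j)"
  by (auto simp: bounded_mat_iff dest: form_bdd_cmult)

lemma evol_add:
  assumes "\<And>i j. summable (\<lambda>n. D n t x i j)" "\<And>i j. summable (\<lambda>n. D n t y i j)"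
  shows "evol t (\<lambda>i j. x i j + y i j) = (\<lambda>i j. evol t x i j + evol t y i j)"
  unfolding evol_def dyson_add by (simp add: suminf_add assms)

lemma evol_cmult:
  assumes "\<And>i j. summable (\<lambda>n. D n t x i j)"
  shows "evol t (\<lambda>i j. k * x i j) = (\<lambda>i j. k * evol t x i j)"
  unfolding evol_def dyson_cmult by (simp add: suminf_mult assms)

lemma D_summable_bounded: "bounded_mat x \<Longrightarrow> 0 \<le> t \<Longrightarrow> summable (\<lambda>n. D n t x i j)"
proof -
  assume "bounded_mat x" "0 \<le> t"
  then obtain C where "\<And>i j. cmod (x i j) \<le> C" using bounded_mat_entry by blast
  from D_summable[of x C, OF this \<open>0 \<le> t\<close>] show ?thesis by (rule summable_norm_cancel)
qed

lemma qds_solution_minimal_sol: "qds_solution r lam mu zp zm minimal_sol"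
proof -
  have pb: "bounded_mat x" if "pos_mat x" for x using that by (simp add: pos_mat_iff)
  show ?thesis
    unfolding qds_solution_def
  proof (intro conjI allI impI)
    fix t :: real and x assume "0 \<le> t" "bounded_mat x"
    then show "bounded_mat (minimal_sol t x)"
      by (auto simp: minimal_sol_def bounded_mat_iff dest: form_bdd_evol)
  next
    fix t :: real and x y assume "0 \<le> t" "bounded_mat x" "bounded_mat y"
    then show "minimal_sol t (\<lambda>i j. x i j + y i j) = (\<lambda>i j. minimal_sol t x i j + minimal_sol t y i j)"
      by (simp add: minimal_sol_def bounded_mat_add evol_add D_summable_bounded)
  next
    fix t :: real and c x assume "0 \<le> t" "bounded_mat x"
    then show "minimal_sol t (\<lambda>i j. c * x i j) = (\<lambda>i j. c * minimal_sol t x i j)"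
      by (simp add: minimal_sol_def bounded_mat_cmult evol_cmult D_summable_bounded)
  next
    fix t :: real and x assume "0 \<le> t" "pos_mat x"
    then show "pos_mat (minimal_sol t x)" using pb by (simp add: minimal_sol_def pos_mat_evol)
  next
    fix t :: real and x assume t: "0 \<le> t" and x: "bounded_mat x"
    then obtain C where C: "form_bdd C x" by (auto simp: bounded_mat_iff)
    have eq: "((\<lambda>s. f s (minimal_sol s x)) has_integral I) {0..t} \<longleftrightarrow> ((\<lambda>s. f s (evol s x)) has_integral I) {0..t}"
      for f :: "real \<Rightarrow> mat \<Rightarrow> complex" and I
      using x by (intro has_integral_cong) (auto simp: minimal_sol_def)
    show "\<forall>u\<in>domN2. \<forall>v\<in>domN2. \<exists>I1 I2.
        ((\<lambda>s. vinner (L1 (P (t - s) v)) (mapply (minimal_sol s x) (L1 (P (t - s) u)))) has_integral I1) {0..t} \<and>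
        ((\<lambda>s. vinner (L2 (P (t - s) v)) (mapply (minimal_sol s x) (L2 (P (t - s) u)))) has_integral I2) {0..t} \<and>
        vinner v (mapply (minimal_sol t x) u) = vinner (P t v) (mapply x (P t u)) + I1 + I2"
    proof (intro ballI)
      fix u v assume "u \<in> domN2" "v \<in> domN2"
      have St: "minimal_sol t x = evol t x" using t x by (simp add: minimal_sol_def)
      from form_evol_equation[OF C t \<open>u \<in> domN2\<close> \<open>v \<in> domN2\<close>]
      show "\<exists>I1 I2.
        ((\<lambda>s. vinner (L1 (P (t - s) v)) (mapply (minimal_sol s x) (L1 (P (t - s) u)))) has_integral I1) {0..t} \<and>
        ((\<lambda>s. vinner (L2 (P (t - s) v)) (mapply (minimal_sol s x) (L2 (P (t - s) u)))) has_integral I2) {0..t} \<and>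
        vinner v (mapply (minimal_sol t x) u) = vinner (P t v) (mapply x (P t u)) + I1 + I2"
        unfolding St eq[of "\<lambda>s X. vinner (L1 (P (t - s) v)) (mapply X (L1 (P (t - s) u)))"]
          eq[of "\<lambda>s X. vinner (L2 (P (t - s) v)) (mapply X (L2 (P (t - s) u)))"] .
    qed
  qed (auto simp: minimal_sol_def)
qed

section \<open>Minimality and uniqueness\<close>

lemma trunc_domN2: "trunc M u \<in> domN2"
  unfolding domN2_def using summable_finite[of "{..<M}" "\<lambda>n. ((real n)\<^sup>2 * cmod (trunc M u n))\<^sup>2"]
  by (auto simp: trunc_def intro!: ell2_finite[of M])

lemma P_trunc: "P t (trunc M u) = trunc M (P t u)"
  by (auto simp: semP_def trunc_def)

lemma L1_trunc: "L1 (trunc M u) = trunc (M - 1) (L1 u)"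
  by (auto simp: opL1_def opB_def trunc_def fun_eq_iff)

lemma L2_trunc: "L2 (trunc M u) = trunc (Suc M) (L2 u)"
  by (auto simp: opL2_def opBp_def trunc_def fun_eq_iff)

text \<open>The induction on \<open>N\<close> plays the role of Picard iteration from below.\<close>

lemma solution_above_partial_sums:
  assumes S': "qds_solution r lam mu zp zm S'" and x: "pos_mat x"
  shows "0 \<le> t \<Longrightarrow> nonneg_c (form M (\<lambda>i j. S' t x i j - (\<Sum>n<N. D n t x i j)) u u)"
proof (induction N arbitrary: M t u)
  case 0
  then show ?case using S' x unfolding qds_solution_def by (simp add: pos_mat_iff)
next
  case (Suc N)
  let ?A = "\<lambda>s i j. \<Sum>n<N. D n s x i j"
  \<comment> \<open>Truncated vectors lie in \<open>domN2\<close>, and on them all pairings become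
    finite forms, so the equation for \<open>S'\<close> can be subtracted from that of the partial
    sums.\<close>
  let ?u = "trunc M u"
  have "bounded_mat x" using x by (simp add: pos_mat_iff)
  then have "\<forall>u\<in>domN2. \<forall>v\<in>domN2. \<exists>I1 I2.
        ((\<lambda>s. vinner (L1 (P (t - s) v)) (mapply (S' s x) (L1 (P (t - s) u)))) has_integral I1) {0..t} \<and>
        ((\<lambda>s. vinner (L2 (P (t - s) v)) (mapply (S' s x) (L2 (P (t - s) u)))) has_integral I2) {0..t} \<and>
        vinner v (mapply (S' t x) u) = vinner (P t v) (mapply x (P t u)) + I1 + I2"
    using S' Suc.prems unfolding qds_solution_def by simp
  from bspec[OF bspec[OF this trunc_domN2[of M u]] trunc_domN2[of M u]] obtain I1 I2 where
    I1: "((\<lambda>s. vinner (L1 (P (t - s) ?u)) (mapply (S' s x) (L1 (P (t - s) ?u)))) has_integral I1) {0..t}" and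
    I2: "((\<lambda>s. vinner (L2 (P (t - s) ?u)) (mapply (S' s x) (L2 (P (t - s) ?u)))) has_integral I2) {0..t}" and
    eq: "vinner ?u (mapply (S' t x) ?u) = vinner (P t ?u) (mapply x (P t ?u)) + I1 + I2"
    by (elim exE conjE)
  have eq': "form M (S' t x) u u = form M x (P t u) (P t u) + (I1 + I2)"
    using eq by (simp add: P_trunc form_trunc add.assoc)
  have "((\<lambda>s. (form (M - 1) (S' s x) (L1 (P (t - s) u)) (L1 (P (t - s) u))
       + form (Suc M) (S' s x) (L2 (P (t - s) u)) (L2 (P (t - s) u)))
      - (form (M - 1) (?A s) (L1 (P (t - s) u)) (L1 (P (t - s) u))
       + form (Suc M) (?A s) (L2 (P (t - s) u)) (L2 (P (t - s) u)))) has_integral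
      ((I1 + I2) - (form M (\<lambda>i j. \<Sum>n<Suc N. D n t x i j) u u - form M x (P t u) (P t u)))) {0..t}"
    using I1 I2 unfolding P_trunc L1_trunc L2_trunc form_trunc
    by (intro has_integral_diff has_integral_add form_D_sum)
  then have "((\<lambda>s. form (M - 1) (\<lambda>i j. S' s x i j - ?A s i j) (L1 (P (t - s) u)) (L1 (P (t - s) u))
       + form (Suc M) (\<lambda>i j. S' s x i j - ?A s i j) (L2 (P (t - s) u)) (L2 (P (t - s) u))) has_integral
      form M (\<lambda>i j. S' t x i j - (\<Sum>n<Suc N. D n t x i j)) u u) {0..t}"
    unfolding form_diff_mat eq' by (simp add: algebra_simps)
  then show ?case
    by (rule nonneg_c_integral) (auto intro!: nonneg_c_add Suc.IH)
qed

lemma minimal_sol_minimal: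
  assumes S': "qds_solution r lam mu zp zm S'" and x: "pos_mat x" and t: "0 \<le> t"
  shows "mat_le (minimal_sol t x) (S' t x)"
proof -
  have bx: "bounded_mat x" using x by (simp add: pos_mat_iff)
  then obtain C where C: "form_bdd C x" by (auto simp: bounded_mat_iff)
  have St: "minimal_sol t x = evol t x" using bx t by (simp add: minimal_sol_def)
  have 1: "bounded_mat (S' t x)" using S' bx t unfolding qds_solution_def by blast
  have "bounded_mat (evol t x)" unfolding bounded_mat_iff using form_bdd_evol[OF C t] ..
  from bounded_mat_add[OF 1 bounded_mat_cmult[OF this, of "-1"]]
  have b: "bounded_mat (\<lambda>i j. S' t x i j - evol t x i j)"
    by (simp only: mult_minus1 add_uminus_conv_diff)
  have "nonneg_c (form M (\<lambda>i j. S' t x i j - evol t x i j) u u)" for M u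
  proof (rule nonneg_c_lim)
    have "(\<lambda>N. S' t x i j - (\<Sum>n<N. D n t x i j)) \<longlonglongrightarrow> S' t x i j - evol t x i j" for i j
      by (rule tendsto_diff[OF tendsto_const evol_lim[OF form_bdd_entry[OF C] t]])
    then show "(\<lambda>N. form M (\<lambda>i j. S' t x i j - (\<Sum>n<N. D n t x i j)) u u) \<longlonglongrightarrow> form M (\<lambda>i j. S' t x i j - evol t x i j) u u"
      by (rule form_tendsto_entry)
  qed (rule solution_above_partial_sums[OF S' x t])
  then have "pos_mat (\<lambda>i j. S' t x i j - evol t x i j)"
    unfolding pos_mat_iff using b by blast
  then show ?thesis unfolding mat_le_def St .
qed

lemma qds_solution_combination:
  assumes S': "qds_solution r lam mu zp zm S'" and t: "0 \<le> t"
    and b: "bounded_mat p" "bounded_mat q" "bounded_mat p'" "bounded_mat q'"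
  shows "S' t (\<lambda>i j. a * p i j + (b * q i j + (c * p' i j + d * q' i j))) =
    (\<lambda>i j. a * S' t p i j + (b * S' t q i j + (c * S' t p' i j + d * S' t q' i j)))"
proof -
  have add: "S' t (\<lambda>i j. x i j + y i j) = (\<lambda>i j. S' t x i j + S' t y i j)"
    if "bounded_mat x" "bounded_mat y" for x y
    using S' t that unfolding qds_solution_def by blast
  have cm: "S' t (\<lambda>i j. c * x i j) = (\<lambda>i j. c * S' t x i j)" if "bounded_mat x" for c x
    using S' t that unfolding qds_solution_def by blast
  show ?thesis
    by (simp add: add cm b bounded_mat_add bounded_mat_cmult)
qed

text \<open>Two minimal solutions lie below each other on positive matrices and hence agree there;
  linearity and the decomposition into four positive matrices extend this to all bounded
  ones.\<close>

lemma min_qds_eq: "min_qds r lam mu zp zm = minimal_sol"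
  unfolding min_qds_def
proof (rule the_equality)
  show "qds_solution r lam mu zp zm minimal_sol \<and> (\<forall>S'. qds_solution r lam mu zp zm S' \<longrightarrow> (\<forall>t\<ge>0. \<forall>x. pos_mat x \<longrightarrow> mat_le (minimal_sol t x) (S' t x)))"
    by (intro conjI allI impI qds_solution_minimal_sol minimal_sol_minimal)
next
  fix R assume R: "qds_solution r lam mu zp zm R \<and> (\<forall>S'. qds_solution r lam mu zp zm S' \<longrightarrow> (\<forall>t\<ge>0. \<forall>x. pos_mat x \<longrightarrow> mat_le (R t x) (S' t x)))"
  have pos: "R t x = minimal_sol t x" if "pos_mat x" "0 \<le> t" for t x
  proof (rule mat_le_antisym)
    show "mat_le (R t x) (minimal_sol t x)"
      using conjunct2[OF R, rule_format, OF qds_solution_minimal_sol that(2,1)] .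
    show "mat_le (minimal_sol t x) (R t x)"
      by (rule minimal_sol_minimal[OF conjunct1[OF R] that])
  qed
  show "R = minimal_sol"
  proof (intro ext)
    fix t x i j
    show "R t x i j = minimal_sol t x i j"
    proof (cases "t < 0 \<or> \<not> bounded_mat x")
      case True
      have "\<forall>t x. (t < 0 \<or> \<not> bounded_mat x) \<longrightarrow> R t x = zero_mat"
        using conjunct1[OF R] unfolding qds_solution_def by (rule conjunct1)
      with True have "R t x = zero_mat" by blast
      moreover have "minimal_sol t x = zero_mat" unfolding minimal_sol_def using True by (rule if_P)
      ultimately show ?thesis by simp
    next
      case False
      then have t: "0 \<le> t" and bx: "bounded_mat x" by auto
      obtain p q p' q' where pq: "pos_mat p" "pos_mat q" "pos_mat p'" "pos_mat q'"
        and x: "x = (\<lambda>i j. (1/4) * p i j + ((-1/4) * q i j + ((-\<i>/4) * p' i j + (\<i>/4) * q' i j)))"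
        by (rule bounded_mat_decompose[OF bx])
      have b: "bounded_mat p" "bounded_mat q" "bounded_mat p'" "bounded_mat q'"
        using pq by (auto simp: pos_mat_iff)
      show ?thesis
        unfolding x qds_solution_combination[OF conjunct1[OF R] t b] qds_solution_combination[OF qds_solution_minimal_sol t b]
        by (simp only: pos[OF pq(1) t] pos[OF pq(2) t] pos[OF pq(3) t] pos[OF pq(4) t])
    qed
  qed
qed

end

section \<open>The Hilbert--Schmidt semigroup\<close>

abbreviation sqr :: "nat \<Rightarrow> (nat \<times> nat) set" where
  "sqr M \<equiv> {..<M} \<times> {..<M}"

definition hs_trunc_norm :: "nat \<Rightarrow> mat \<Rightarrow> real" where
  "hs_trunc_norm M \<xi> = L2_set (\<lambda>(i,j). cmod (\<xi> i j)) (sqr M)"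

definition trunc2 :: "nat \<Rightarrow> mat \<Rightarrow> mat" where
  "trunc2 M \<xi> = (\<lambda>i j. if i < M \<and> j < M then \<xi> i j else 0)"

lemma hs_trunc_norm_nonneg [simp]: "hs_trunc_norm M \<xi> \<ge> 0"
  by (simp add: hs_trunc_norm_def L2_set_nonneg)

lemma hs_trunc_norm_sq: "(hs_trunc_norm M \<xi>)\<^sup>2 = (\<Sum>(i,j)\<in>sqr M. (cmod (\<xi> i j))\<^sup>2)"
  by (simp add: hs_trunc_norm_def L2_set_def sum_nonneg case_prod_unfold)

lemma hs_trunc_norm_sq': "(hs_trunc_norm M \<xi>)\<^sup>2 = (\<Sum>i<M. \<Sum>j<M. (cmod (\<xi> i j))\<^sup>2)"
  by (simp add: hs_trunc_norm_sq sum.cartesian_product)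

lemma hs_norm_nonneg [simp]: "hs_norm \<xi> \<ge> 0"
  unfolding hs_norm_def by (intro real_sqrt_ge_zero infsum_nonneg) auto

lemma hs_norm_sq: "(hs_norm \<xi>)\<^sup>2 = infsum (\<lambda>(i,j). (cmod (\<xi> i j))\<^sup>2) UNIV"
  unfolding hs_norm_def by (intro real_sqrt_pow2 infsum_nonneg) auto

lemma finite_subset_sqr: "finite F \<Longrightarrow> \<exists>M. F \<subseteq> sqr M"
proof -
  assume "finite F"
  then have "finite (fst ` F \<union> snd ` F)" by simp
  then obtain M where M: "\<forall>n\<in>fst ` F \<union> snd ` F. n < M"
    unfolding finite_nat_set_iff_bounded ..
  have "F \<subseteq> sqr M"
  proof
    fix p assume "p \<in> F"
    then have "fst p < M" "snd p < M" using M by auto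
    then show "p \<in> sqr M" by (simp add: mem_Times_iff)
  qed
  then show ?thesis by (rule exI[where x = M])
qed

lemma hsI:
  assumes "\<And>M. hs_trunc_norm M \<xi> \<le> B"
  shows "\<xi> \<in> hs" "hs_norm \<xi> \<le> B"
proof -
  have B: "B \<ge> 0" by (rule order_trans[OF hs_trunc_norm_nonneg assms[of 0]])
  let ?f = "\<lambda>(i,j). (cmod (\<xi> i j))\<^sup>2"
  have le: "sum ?f F \<le> B\<^sup>2" if F: "finite F" for F
  proof -
    obtain M where M: "F \<subseteq> sqr M" using finite_subset_sqr[OF F] by blast
    have "sum ?f F \<le> sum ?f (sqr M)" by (rule sum_mono2[OF _ M]) auto
    also have "\<dots> = (hs_trunc_norm M \<xi>)\<^sup>2" by (simp add: hs_trunc_norm_sq)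
    also have "\<dots> \<le> B\<^sup>2" using assms[of M] by (simp add: power_mono)
    finally show ?thesis .
  qed
  have s: "?f summable_on UNIV"
  proof (rule nonneg_bdd_above_summable_on)
    show "bdd_above (sum ?f ` {F. F \<subseteq> UNIV \<and> finite F})"
      using le by (intro bdd_aboveI[of _ "B\<^sup>2"]) auto
  qed auto
  then show "\<xi> \<in> hs" by (simp add: hs_def)
  have "infsum ?f UNIV \<le> B\<^sup>2"
    by (rule infsum_le_finite_sums[OF s]) (rule le)
  then show "hs_norm \<xi> \<le> B"
    unfolding hs_norm_sq[symmetric] using B by (rule power2_le_imp_le)
qed

lemma hs_D: "\<xi> \<in> hs \<Longrightarrow> (\<lambda>(i,j). (cmod (\<xi> i j))\<^sup>2) summable_on UNIV"
  by (simp add: hs_def)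

lemma hs_trunc_norm_le: "\<xi> \<in> hs \<Longrightarrow> hs_trunc_norm M \<xi> \<le> hs_norm \<xi>"
proof (rule power2_le_imp_le)
  assume "\<xi> \<in> hs"
  then show "(hs_trunc_norm M \<xi>)\<^sup>2 \<le> (hs_norm \<xi>)\<^sup>2"
    unfolding hs_trunc_norm_sq hs_norm_sq by (intro finite_sum_le_infsum hs_D) auto
qed simp

lemma hs_entry_le: "\<xi> \<in> hs \<Longrightarrow> cmod (\<xi> i j) \<le> hs_norm \<xi>"
proof -
  assume "\<xi> \<in> hs"
  have "cmod (\<xi> i j) \<le> hs_trunc_norm (Suc (max i j)) \<xi>"
    using member_le_L2_set[of "sqr (Suc (max i j))" "(i,j)" "\<lambda>(i,j). cmod (\<xi> i j)"] by (simp add: hs_trunc_norm_def less_Suc_eq_le)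
  also have "\<dots> \<le> hs_norm \<xi>" by (rule hs_trunc_norm_le) fact
  finally show ?thesis .
qed

lemma hs_trunc_norm_mono: "(\<And>i j. cmod (\<xi> i j) \<le> cmod (\<eta> i j)) \<Longrightarrow> hs_trunc_norm M \<xi> \<le> hs_trunc_norm M \<eta>"
  unfolding hs_trunc_norm_def by (intro L2_set_mono) auto

lemma hs_mono:
  assumes "\<And>i j. cmod (\<xi> i j) \<le> cmod (\<eta> i j)" "\<eta> \<in> hs"
  shows "\<xi> \<in> hs" "hs_norm \<xi> \<le> hs_norm \<eta>"
proof -
  have "hs_trunc_norm M \<xi> \<le> hs_norm \<eta>" for M
    by (rule order_trans[OF hs_trunc_norm_mono[OF assms(1)] hs_trunc_norm_le[OF assms(2)]])
  from hsI[OF this] show "\<xi> \<in> hs" "hs_norm \<xi> \<le> hs_norm \<eta>" by auto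
qed

lemma hs_trunc_norm_triangle: "hs_trunc_norm M (\<lambda>i j. \<xi> i j + \<eta> i j) \<le> hs_trunc_norm M \<xi> + hs_trunc_norm M \<eta>"
proof -
  have "hs_trunc_norm M (\<lambda>i j. \<xi> i j + \<eta> i j) \<le> L2_set (\<lambda>p. (case p of (i,j) \<Rightarrow> cmod (\<xi> i j)) + (case p of (i,j) \<Rightarrow> cmod (\<eta> i j))) (sqr M)"
    unfolding hs_trunc_norm_def by (intro L2_set_mono) (auto intro: norm_triangle_ineq)
  also have "\<dots> \<le> hs_trunc_norm M \<xi> + hs_trunc_norm M \<eta>"
    unfolding hs_trunc_norm_def by (rule L2_set_triangle_ineq)
  finally show ?thesis .
qed

lemma hs_add:
  assumes "\<xi> \<in> hs" "\<eta> \<in> hs"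
  shows "(\<lambda>i j. \<xi> i j + \<eta> i j) \<in> hs" "hs_norm (\<lambda>i j. \<xi> i j + \<eta> i j) \<le> hs_norm \<xi> + hs_norm \<eta>"
proof -
  have "hs_trunc_norm M (\<lambda>i j. \<xi> i j + \<eta> i j) \<le> hs_norm \<xi> + hs_norm \<eta>" for M
    by (rule order_trans[OF hs_trunc_norm_triangle add_mono[OF hs_trunc_norm_le[OF assms(1)] hs_trunc_norm_le[OF assms(2)]]])
  from hsI[OF this] show "(\<lambda>i j. \<xi> i j + \<eta> i j) \<in> hs" "hs_norm (\<lambda>i j. \<xi> i j + \<eta> i j) \<le> hs_norm \<xi> + hs_norm \<eta>"
    by auto
qed

lemma hs_norm_cmult: "hs_norm (\<lambda>i j. k * \<xi> i j) = cmod k * hs_norm \<xi>"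
proof -
  have "infsum (\<lambda>(i,j). (cmod (k * \<xi> i j))\<^sup>2) UNIV = infsum (\<lambda>p. (cmod k)\<^sup>2 * (case p of (i,j) \<Rightarrow> (cmod (\<xi> i j))\<^sup>2)) UNIV"
    by (intro infsum_cong) (auto simp: norm_mult power_mult_distrib)
  also have "\<dots> = (cmod k)\<^sup>2 * infsum (\<lambda>(i,j). (cmod (\<xi> i j))\<^sup>2) UNIV"
    by (rule infsum_cmult_right')
  finally show ?thesis by (simp add: hs_norm_def real_sqrt_mult)
qed

lemma hs_cmult: "\<xi> \<in> hs \<Longrightarrow> (\<lambda>i j. k * \<xi> i j) \<in> hs"
proof (rule hsI(1))
  fix M assume "\<xi> \<in> hs"
  have "hs_trunc_norm M (\<lambda>i j. k * \<xi> i j) = cmod k * hs_trunc_norm M \<xi>"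
    unfolding hs_trunc_norm_def by (subst L2_set_right_distrib) (auto simp: norm_mult case_prod_unfold intro!: L2_set_cong)
  also have "\<dots> \<le> cmod k * hs_norm \<xi>"
    by (intro mult_left_mono hs_trunc_norm_le \<open>\<xi> \<in> hs\<close>) auto
  finally show "hs_trunc_norm M (\<lambda>i j. k * \<xi> i j) \<le> cmod k * hs_norm \<xi>" .
qed

lemma hs_diff: "\<xi> \<in> hs \<Longrightarrow> \<eta> \<in> hs \<Longrightarrow> (\<lambda>i j. \<xi> i j - \<eta> i j) \<in> hs"
  using hs_add(1)[OF _ hs_cmult[of \<eta> "-1"], of \<xi>] by simp

lemma hs_trunc_norm_trunc2_le: "hs_trunc_norm K (trunc2 M \<xi>) \<le> hs_trunc_norm M \<xi>"
proof (rule power2_le_imp_le)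
  have "(hs_trunc_norm K (trunc2 M \<xi>))\<^sup>2 = (\<Sum>(i,j)\<in>sqr K \<inter> sqr M. (cmod (trunc2 M \<xi> i j))\<^sup>2)"
    unfolding hs_trunc_norm_sq by (rule sum.mono_neutral_right) (auto simp: trunc2_def split: if_splits)
  also have "\<dots> = (\<Sum>(i,j)\<in>sqr K \<inter> sqr M. (cmod (\<xi> i j))\<^sup>2)"
    by (rule sum.cong) (auto simp: trunc2_def)
  also have "\<dots> \<le> (hs_trunc_norm M \<xi>)\<^sup>2"
    unfolding hs_trunc_norm_sq by (rule sum_mono2) auto
  finally show "(hs_trunc_norm K (trunc2 M \<xi>))\<^sup>2 \<le> (hs_trunc_norm M \<xi>)\<^sup>2" .
qed simp

lemma trunc2_hs [simp]: "trunc2 M \<xi> \<in> hs"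
  by (rule hsI(1)[OF hs_trunc_norm_trunc2_le])

lemma hs_tail:
  assumes "\<xi> \<in> hs" "e > 0"
  shows "\<exists>M. hs_norm (\<lambda>i j. \<xi> i j - trunc2 M \<xi> i j) < e"
proof -
  let ?f = "\<lambda>(i,j). (cmod (\<xi> i j))\<^sup>2"
  have s: "?f summable_on UNIV" by (rule hs_D[OF assms(1)])
  obtain F where F: "finite F" "dist (sum ?f F) (infsum ?f UNIV) \<le> e\<^sup>2 / 2"
    using infsum_finite_approximation[OF s, of "e\<^sup>2 / 2"] assms(2) by auto
  obtain M where M: "F \<subseteq> sqr M" using finite_subset_sqr[OF F(1)] by blast
  have "sum ?f F \<le> sum ?f (sqr M)" by (rule sum_mono2[OF _ M]) auto
  then have 1: "infsum ?f UNIV - sum ?f (sqr M) \<le> e\<^sup>2 / 2"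
    using F(2) unfolding dist_real_def abs_diff_le_iff by linarith
  have "(hs_norm (\<lambda>i j. \<xi> i j - trunc2 M \<xi> i j))\<^sup>2 = infsum ?f (UNIV - sqr M)"
    unfolding hs_norm_sq by (rule infsum_cong_neutral) (auto simp: trunc2_def split: if_splits)
  also have "\<dots> = infsum ?f UNIV - infsum ?f (sqr M)"
    by (rule infsum_Diff[OF s]) auto
  also have "\<dots> < e\<^sup>2"
  proof -
    have "e\<^sup>2 / 2 < e\<^sup>2" using assms(2) by simp
    moreover have "infsum ?f (sqr M) = sum ?f (sqr M)" by (rule infsum_finite) simp
    ultimately show ?thesis using 1 by linarith
  qed
  finally have "(hs_norm (\<lambda>i j. \<xi> i j - trunc2 M \<xi> i j))\<^sup>2 < e\<^sup>2" .
  then show ?thesis using assms(2) power2_less_imp_less[of _ e] by (intro exI[of _ M]) simp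
qed

text \<open>Dominated convergence in Hilbert--Schmidt norm: a finite square carries all but a small
  part of \<open>h\<close>, and inside it there are finitely many entries. The filter is arbitrary
  because the limits of interest are taken at \<open>at_right 0\<close>.\<close>

lemma hs_dominated_tendsto_0:
  assumes h: "h \<in> hs"
    and le': "\<forall>\<^sub>F t in F. \<forall>i j. cmod (\<xi> t i j) \<le> cmod (h i j)"
    and lim: "\<And>i j. ((\<lambda>t. \<xi> t i j) \<longlongrightarrow> 0) F"
  shows "((\<lambda>t. hs_norm (\<xi> t)) \<longlongrightarrow> 0) F"
proof (rule tendstoI)
  fix e :: real assume e: "e > 0"
  obtain M where M: "hs_norm (\<lambda>i j. h i j - trunc2 M h i j) < e / 2"
    using hs_tail[OF h, of "e / 2"] e by auto
  have "((\<lambda>t. hs_trunc_norm M (\<xi> t)) \<longlongrightarrow> hs_trunc_norm M (\<lambda>i j. 0)) F"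
    unfolding hs_trunc_norm_def L2_set_def case_prod_unfold using lim by (intro tendsto_intros)
  moreover have "hs_trunc_norm M (\<lambda>i j. 0) = 0" by (simp add: hs_trunc_norm_def L2_set_def)
  ultimately have "\<forall>\<^sub>F t in F. hs_trunc_norm M (\<xi> t) < e / 2"
    using e order_tendstoD(2)[of _ 0 F "e/2"] by simp
  with le' show "\<forall>\<^sub>F t in F. dist (hs_norm (\<xi> t)) 0 < e"
  proof eventually_elim
    case (elim t)
    have a: "hs_norm (trunc2 M (\<xi> t)) \<le> hs_trunc_norm M (\<xi> t)"
      by (rule hsI(2)[OF hs_trunc_norm_trunc2_le])
    have le: "cmod (\<xi> t i j - trunc2 M (\<xi> t) i j) \<le> cmod (h i j - trunc2 M h i j)" for i j
      using elim by (simp add: trunc2_def)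
    have "hs_norm (\<xi> t) \<le> hs_norm (trunc2 M (\<xi> t)) + hs_norm (\<lambda>i j. \<xi> t i j - trunc2 M (\<xi> t) i j)"
      using hs_add(2)[OF trunc2_hs hs_mono(1)[OF le hs_diff[OF h trunc2_hs]], of M "\<xi> t"] by simp
    also have "\<dots> < e"
      using a elim M hs_mono(2)[OF le hs_diff[OF h trunc2_hs]] by linarith
    finally show ?case by simp
  qed
qed

lemma hs_inner_summable:
  assumes "\<xi> \<in> hs" "\<eta> \<in> hs"
  shows "(\<lambda>p. norm (case p of (i,j) \<Rightarrow> cnj (\<xi> i j) * \<eta> i j)) summable_on UNIV"
    and "infsum (\<lambda>p. norm (case p of (i,j) \<Rightarrow> cnj (\<xi> i j) * \<eta> i j)) UNIV \<le> hs_norm \<xi> * hs_norm \<eta>"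
proof -
  let ?g = "\<lambda>p. norm (case p of (i,j) \<Rightarrow> cnj (\<xi> i j) * \<eta> i j)"
  have le: "sum ?g F \<le> hs_norm \<xi> * hs_norm \<eta>" if F: "finite F" for F
  proof -
    obtain M where M: "F \<subseteq> sqr M" using finite_subset_sqr[OF F] by blast
    have "sum ?g F \<le> sum ?g (sqr M)" by (rule sum_mono2[OF _ M]) auto
    also have "\<dots> = (\<Sum>p\<in>sqr M. \<bar>case p of (i,j) \<Rightarrow> cmod (\<xi> i j)\<bar> * \<bar>case p of (i,j) \<Rightarrow> cmod (\<eta> i j)\<bar>)"
      by (rule sum.cong) (auto simp: norm_mult)
    also have "\<dots> \<le> hs_trunc_norm M \<xi> * hs_trunc_norm M \<eta>"
      unfolding hs_trunc_norm_def by (rule L2_set_mult_ineq)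
    also have "\<dots> \<le> hs_norm \<xi> * hs_norm \<eta>"
      by (intro mult_mono hs_trunc_norm_le assms) auto
    finally show ?thesis .
  qed
  show s: "(\<lambda>p. norm (case p of (i,j) \<Rightarrow> cnj (\<xi> i j) * \<eta> i j)) summable_on UNIV"
  proof (rule nonneg_bdd_above_summable_on)
    show "bdd_above (sum ?g ` {F. F \<subseteq> UNIV \<and> finite F})"
      using le by (intro bdd_aboveI[of _ "hs_norm \<xi> * hs_norm \<eta>"]) auto
  qed auto
  show "infsum ?g UNIV \<le> hs_norm \<xi> * hs_norm \<eta>"
    by (rule infsum_le_finite_sums[OF s]) (rule le)
qed

lemma hs_cauchy_schwarz: "\<xi> \<in> hs \<Longrightarrow> \<eta> \<in> hs \<Longrightarrow> cmod (hs_inner \<xi> \<eta>) \<le> hs_norm \<xi> * hs_norm \<eta>"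
  unfolding hs_inner_def by (rule order_trans[OF norm_infsum_bound]) (rule hs_inner_summable; assumption)+

lemma hs_inner_diff: "\<xi> \<in> hs \<Longrightarrow> \<eta> \<in> hs \<Longrightarrow> \<zeta> \<in> hs \<Longrightarrow>
    hs_inner \<xi> (\<lambda>i j. \<eta> i j - \<zeta> i j) = hs_inner \<xi> \<eta> - hs_inner \<xi> \<zeta>"
proof -
  assume "\<xi> \<in> hs" "\<eta> \<in> hs" "\<zeta> \<in> hs"
  then have s: "(\<lambda>(i,j). cnj (\<xi> i j) * \<eta> i j) summable_on UNIV" "(\<lambda>(i,j). cnj (\<xi> i j) * \<zeta> i j) summable_on UNIV"
    by (simp_all add: abs_summable_summable hs_inner_summable)
  show ?thesis unfolding hs_inner_def
    using infsum_add[OF s(1) summable_on_uminus[THEN iffD2, OF s(2)]]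
    unfolding infsum_uminus by (simp add: case_prod_unfold right_diff_distrib)
qed

lemma hs_inner_cmult: "hs_inner \<xi> (\<lambda>i j. k * \<eta> i j) = k * hs_inner \<xi> \<eta>"
  unfolding hs_inner_def infsum_cmult_right'[symmetric]
  by (rule infsum_cong) (auto simp: mult_ac)

text \<open>Entrywise the product is \<open>d\<close> times a squared modulus, so only the real part
  of \<open>d\<close> counts, and only on the support of \<open>\<xi>\<close>. This removes the
  phases from the Dirichlet form of the ground state.\<close>

lemma Re_hs_inner_multiplier:
  assumes "\<xi> \<in> hs" "(\<lambda>i j. d i j * \<xi> i j) \<in> hs" "\<And>i j. \<xi> i j \<noteq> 0 \<Longrightarrow> Re (d i j) = k"
  shows "Re (hs_inner \<xi> (\<lambda>i j. d i j * \<xi> i j)) = k * (hs_norm \<xi>)\<^sup>2"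
proof -
  have s: "(\<lambda>(i,j). cnj (\<xi> i j) * (d i j * \<xi> i j)) summable_on UNIV"
    by (rule abs_summable_summable[OF hs_inner_summable(1)[OF assms(1,2)]])
  have "Re (hs_inner \<xi> (\<lambda>i j. d i j * \<xi> i j)) = infsum (\<lambda>p. Re (case p of (i,j) \<Rightarrow> cnj (\<xi> i j) * (d i j * \<xi> i j))) UNIV"
    unfolding hs_inner_def by (rule infsum_Re[OF s, symmetric])
  also have "\<dots> = infsum (\<lambda>p. k * (case p of (i,j) \<Rightarrow> (cmod (\<xi> i j))\<^sup>2)) UNIV"
  proof (rule infsum_cong)
    fix p :: "nat \<times> nat"
    obtain i j where p: "p = (i, j)" by (cases p)
    have "cnj (\<xi> i j) * (d i j * \<xi> i j) = d i j * of_real ((cmod (\<xi> i j))\<^sup>2)"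
      unfolding complex_norm_square by (simp add: mult_ac)
    then have "Re (cnj (\<xi> i j) * (d i j * \<xi> i j)) = Re (d i j) * (cmod (\<xi> i j))\<^sup>2"
      unfolding \<open>cnj (\<xi> i j) * (d i j * \<xi> i j) = _\<close> by (simp del: of_real_power)
    then show "Re (case p of (i,j) \<Rightarrow> cnj (\<xi> i j) * (d i j * \<xi> i j)) = k * (case p of (i,j) \<Rightarrow> (cmod (\<xi> i j))\<^sup>2)"
      using assms(3)[of i j] unfolding p by (cases "\<xi> i j = 0") simp_all
  qed
  also have "\<dots> = k * (hs_norm \<xi>)\<^sup>2"
    unfolding hs_norm_sq by (rule infsum_cmult_right')
  finally show ?thesis .
qed

lemma hs_form_bdd:
  assumes "\<xi> \<in> hs" shows "form_bdd (hs_norm \<xi>) \<xi>"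
  unfolding form_bdd_def
proof (intro allI)
  fix M v u
  have "cmod (form M \<xi> v u) \<le> (\<Sum>p\<in>sqr M. cmod (case p of (i,j) \<Rightarrow> cnj (v i) * \<xi> i j * u j))"
    unfolding form_def sum.cartesian_product by (rule norm_sum)
  also have "\<dots> = (\<Sum>p\<in>sqr M. \<bar>case p of (i,j) \<Rightarrow> cmod (\<xi> i j)\<bar> * \<bar>case p of (i,j) \<Rightarrow> cmod (v i) * cmod (u j)\<bar>)"
    by (rule sum.cong) (auto simp: norm_mult)
  also have "\<dots> \<le> hs_trunc_norm M \<xi> * L2_set (\<lambda>p. case p of (i,j) \<Rightarrow> cmod (v i) * cmod (u j)) (sqr M)"
    unfolding hs_trunc_norm_def by (rule L2_set_mult_ineq)
  also have "L2_set (\<lambda>p. case p of (i,j) \<Rightarrow> cmod (v i) * cmod (u j)) (sqr M) = trunc_norm M v * trunc_norm M u"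
    unfolding L2_set_def real_sqrt_mult[symmetric] sum_product sum.cartesian_product
    by (intro arg_cong[of _ _ sqrt] sum.cong) (auto simp: power_mult_distrib)
  also have "hs_trunc_norm M \<xi> * (trunc_norm M v * trunc_norm M u) \<le> hs_norm \<xi> * (trunc_norm M v * trunc_norm M u)"
    by (intro mult_right_mono hs_trunc_norm_le assms) auto
  finally show "cmod (form M \<xi> v u) \<le> hs_norm \<xi> * trunc_norm M v * trunc_norm M u"
    by (simp add: mult.assoc)
qed

section \<open>The invariant weight and the transported semigroup\<close>

context qds begin

definition nu :: real where "nu = lam / mu"

lemma nu_pos: "nu > 0" and nu_less: "nu < 1"
  using lam_pos lam_mu by (auto simp: nu_def)

definition w :: "nat \<Rightarrow> nat \<Rightarrow> real" where
  "w i j = rho4 lam mu i * rho4 lam mu j"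

lemma rho4_base: "(1 - nu\<^sup>2) * nu ^ (2 * n) > 0"
  using nu_pos nu_less by (simp add: power_strict_mono abs_square_less_1)

lemma rho4_pos: "rho4 lam mu n > 0"
  unfolding rho4_def nu_def[symmetric] powr_gt_zero using rho4_base[of n] by (metis less_irrefl)

lemma rho4_sq: "(rho4 lam mu n)\<^sup>2 = sqrt (1 - nu\<^sup>2) * nu ^ n"
proof -
  have "(rho4 lam mu n)\<^sup>2 = ((1 - nu\<^sup>2) * nu ^ (2 * n)) powr (1/2)"
    unfolding rho4_def nu_def[symmetric] power2_eq_square[of "_ powr _"] powr_add[symmetric] by simp
  also have "\<dots> = sqrt ((1 - nu\<^sup>2) * nu ^ (2 * n))"
    using rho4_base[of n] by (simp add: powr_half_sqrt)
  also have "\<dots> = sqrt (1 - nu\<^sup>2) * nu ^ n"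
  proof -
    have "nu ^ (2 * n) = (nu ^ n)\<^sup>2" by (simp add: power_mult[symmetric] mult.commute)
    then show ?thesis using nu_pos by (simp add: real_sqrt_mult)
  qed
  finally show ?thesis .
qed

lemma w_sq: "(w i j)\<^sup>2 = (1 - nu\<^sup>2) * (nu ^ i * nu ^ j)"
proof -
  have "(w i j)\<^sup>2 = (sqrt (1 - nu\<^sup>2) * sqrt (1 - nu\<^sup>2)) * (nu ^ i * nu ^ j)"
    unfolding w_def power_mult_distrib rho4_sq by (simp only: mult_ac)
  also have "sqrt (1 - nu\<^sup>2) * sqrt (1 - nu\<^sup>2) = 1 - nu\<^sup>2"
    using rho4_base[of 0] by simp
  finally show ?thesis .
qed

text \<open>Detailed balance: a diagonal step multiplies the square of \<open>w\<close> by
  \<open>nu\<^sup>2\<close>, which is the quotient \<open>lam\<^sup>2 / mu\<^sup>2\<close> of the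
  two jump rates.\<close>

sublocale reversible_jumps al be w
proof unfold_locales
  show "w i j > 0" for i j by (simp add: w_def rho4_pos)
  show "(w i j)\<^sup>2 * be i j = (w (Suc i) (Suc j))\<^sup>2 * al (Suc i) (Suc j)" for i j
    unfolding w_sq be_def al_def nu_def using mu_pos by (simp add: power2_eq_square field_simps)
qed

lemma sum_nu_le: "(\<Sum>i<M. nu ^ i) \<le> 1 / (1 - nu)"
proof -
  have "(\<Sum>i<M. nu ^ i) \<le> (\<Sum>i. nu ^ i)"
    using nu_pos nu_less by (intro sum_le_suminf summable_geometric) auto
  also have "\<dots> = 1 / (1 - nu)"
    using nu_pos nu_less by (intro suminf_geometric) auto
  finally show ?thesis .
qed

lemma w_hs: "(\<lambda>i j. of_real (w i j)) \<in> hs"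
proof (rule hsI(1))
  fix M
  let ?s = "\<Sum>i<M. nu ^ i"
  have g0: "0 \<le> ?s"
    using nu_pos by (intro sum_nonneg) simp
  have "?s * ?s \<le> (1 / (1 - nu)) * (1 / (1 - nu))"
    by (rule mult_mono[OF sum_nu_le sum_nu_le _ g0]) (use nu_less in \<open>simp add: divide_nonneg_pos\<close>)
  moreover have "(hs_trunc_norm M (\<lambda>i j. of_real (w i j)))\<^sup>2 = (1 - nu\<^sup>2) * (?s * ?s)"
  proof -
    have "(hs_trunc_norm M (\<lambda>i j. of_real (w i j)))\<^sup>2 = (\<Sum>i<M. \<Sum>j<M. (1 - nu\<^sup>2) * (nu ^ i * nu ^ j))"
      unfolding hs_trunc_norm_sq' norm_of_real power2_abs w_sq ..
    also have "\<dots> = (\<Sum>i<M. (1 - nu\<^sup>2) * (\<Sum>j<M. nu ^ i * nu ^ j))"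
      by (intro sum.cong refl sum_distrib_left[symmetric])
    also have "\<dots> = (1 - nu\<^sup>2) * (\<Sum>i<M. \<Sum>j<M. nu ^ i * nu ^ j)"
      by (rule sum_distrib_left[symmetric])
    finally show ?thesis unfolding sum_product .
  qed
  moreover have "(1 - nu\<^sup>2) * (?s * ?s) \<le> 1 * (?s * ?s)"
    by (rule mult_right_mono[OF _ mult_nonneg_nonneg[OF g0 g0]]) simp
  ultimately have "(hs_trunc_norm M (\<lambda>i j. of_real (w i j)))\<^sup>2 \<le> (1 / (1 - nu)) * (1 / (1 - nu))"
    by linarith
  then show "hs_trunc_norm M (\<lambda>i j. of_real (w i j)) \<le> 1 / (1 - nu)"
    using nu_less by (simp only: power2_eq_square[of "1 / _", symmetric]) (rule power2_le_imp_le, simp_all)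
qed

definition iota_inv :: "mat \<Rightarrow> mat" where
  "iota_inv \<xi> = (\<lambda>i j. \<xi> i j / of_real (w i j))"

lemma iota_w: "iota lam mu x i j = of_real (w i j) * x i j"
  by (simp add: iota_def w_def)

lemma w_neq0 [simp]: "w i j \<noteq> 0"
  using w_pos[of i j] by simp

lemma iota_iota_inv: "iota lam mu (iota_inv \<xi>) = \<xi>"
  by (auto simp: fun_eq_iff iota_w iota_inv_def)

lemma iota_inv_iota: "iota_inv (iota lam mu x) = x"
  by (auto simp: fun_eq_iff iota_w iota_inv_def)

lemma iota_bounded_hs:
  assumes "bounded_mat x" shows "iota lam mu x \<in> hs"
proof -
  obtain C where "\<forall>i j. cmod (x i j) \<le> C" using bounded_mat_entry[OF assms] ..
  then have C: "cmod (x i j) \<le> C" for i j by blast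
  have C0: "C \<ge> 0" by (rule order_trans[OF norm_ge_zero C])
  show ?thesis
  proof (rule hs_mono(1)[OF _ hs_cmult[OF w_hs, of "of_real C"]])
    fix i j
    have "w i j * cmod (x i j) \<le> w i j * C"
      using w_pos[of i j] by (intro mult_left_mono C) simp
    then show "cmod (iota lam mu x i j) \<le> cmod (of_real C * of_real (w i j))"
      using w_pos[of i j] C0 by (simp add: iota_w norm_mult mult.commute)
  qed
qed

text \<open>Moduli are summed before the norm is taken, so that the estimate gives absolute
  convergence of the series as well as its decay. The supersolution inequality is asked on the
  diagonals in \<open>Q\<close> only, where \<open>\<xi>\<close> lives.\<close>

lemma hs_core_bound:
  fixes h :: "nat \<Rightarrow> nat \<Rightarrow> real" and Q :: "int \<Rightarrow> bool"
  assumes h: "\<And>i j. Q (int j - int i) \<Longrightarrow> jump al be h i j \<le> (- cr i j - \<kappa>) * h i j"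
    and hpos: "\<And>i j. h i j > 0"
    and Q: "\<And>i j. \<not> Q (int j - int i) \<Longrightarrow> \<xi> i j = 0"
    and hs: "\<xi> \<in> hs" and t: "0 \<le> t"
  shows "hs_trunc_norm L (\<lambda>i j. of_real (w i j * (\<Sum>n<N. cmod (D n t (iota_inv \<xi>) i j)))) \<le> exp (- \<kappa> * t) * hs_norm \<xi>"
proof -
  \<comment> \<open>Fewer than \<open>N\<close> jumps from inside the square of size
    \<open>L\<close> read only entries below \<open>L + N\<close>. Cutting there gives finitely
    supported data, and \<open>M + N\<close> contains the support of the partial sums.\<close>
  define M where "M = L + N"
  define y where "y i j = (if i < M \<and> j < M then cmod (iota_inv \<xi> i j) else 0)" for i j
  have dom: "(\<Sum>n<N. cmod (D n t (iota_inv \<xi>) i j)) \<le> (\<Sum>n<N. D0 n t y i j)" if "i < L" "j < L" for i j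
  proof (rule sum_mono)
    fix n assume n: "n \<in> {..<N}"
    have "cmod (D n t (iota_inv \<xi>) i j) \<le> D0 n t (\<lambda>i j. cmod (iota_inv \<xi> i j)) i j"
      by (rule D_norm_le[OF _ t]) simp
    also have "\<dots> = D0 n t y i j"
      by (rule dyson_local) (use that n in \<open>auto simp: y_def M_def\<close>)
    finally show "cmod (D n t (iota_inv \<xi>) i j) \<le> D0 n t y i j" .
  qed
  have D00: "D0 n t y i j \<ge> 0" for n i j
    by (rule dyson_nonneg[OF _ t]) (simp add: y_def)
  have "(hs_trunc_norm L (\<lambda>i j. of_real (w i j * (\<Sum>n<N. cmod (D n t (iota_inv \<xi>) i j)))))\<^sup>2
     = (\<Sum>i<L. \<Sum>j<L. (w i j)\<^sup>2 * (\<Sum>n<N. cmod (D n t (iota_inv \<xi>) i j))\<^sup>2)"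
    by (simp add: hs_trunc_norm_sq' norm_mult power_mult_distrib sum_nonneg del: of_real_sum of_real_mult)
  also have "\<dots> \<le> (\<Sum>i<L. \<Sum>j<L. (w i j)\<^sup>2 * (\<Sum>n<N. D0 n t y i j)\<^sup>2)"
    by (intro sum_mono mult_left_mono power_mono dom sum_nonneg) auto
  also have "\<dots> \<le> (\<Sum>i<M+N. \<Sum>j<L. (w i j)\<^sup>2 * (\<Sum>n<N. D0 n t y i j)\<^sup>2)"
    by (rule sum_mono2) (auto simp: M_def intro!: sum_nonneg)
  also have "\<dots> \<le> (\<Sum>i<M+N. \<Sum>j<M+N. (w i j)\<^sup>2 * (\<Sum>n<N. D0 n t y i j)\<^sup>2)"
    by (intro sum_mono sum_mono2) (auto simp: M_def)
  also have "\<dots> \<le> exp (- 2 * \<kappa> * t) * (\<Sum>i<M+N. \<Sum>j<M+N. (w i j)\<^sup>2 * (y i j)\<^sup>2)"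
  proof (rule dyson_energy[where P = Q and h = h and M = M and N = N, OF h hpos])
    show "y i j = 0" if "\<not> Q (int j - int i)" for i j
      using Q[OF that] by (simp add: y_def iota_inv_def)
  qed (use t in \<open>auto simp: y_def\<close>)
  also have "(\<Sum>i<M+N. \<Sum>j<M+N. (w i j)\<^sup>2 * (y i j)\<^sup>2) \<le> (hs_norm \<xi>)\<^sup>2"
  proof -
    have "(\<Sum>i<M+N. \<Sum>j<M+N. (w i j)\<^sup>2 * (y i j)\<^sup>2) \<le> (hs_trunc_norm (M+N) \<xi>)\<^sup>2"
      unfolding hs_trunc_norm_sq' by (intro sum_mono) (auto simp: y_def iota_inv_def norm_divide power_divide)
    also have "\<dots> \<le> (hs_norm \<xi>)\<^sup>2"
      by (intro power_mono hs_trunc_norm_le hs) auto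
    finally show ?thesis .
  qed
  finally have "(hs_trunc_norm L (\<lambda>i j. of_real (w i j * (\<Sum>n<N. cmod (D n t (iota_inv \<xi>) i j)))))\<^sup>2 \<le> (exp (- \<kappa> * t) * hs_norm \<xi>)\<^sup>2"
    by (simp add: power_mult_distrib exp_double[symmetric] mult_ac)
  then show ?thesis by (rule power2_le_imp_le) simp
qed

lemma hs_D_summable:
  assumes "\<xi> \<in> hs" "0 \<le> t"
  shows "summable (\<lambda>n. cmod (D n t (iota_inv \<xi>) i j))"
proof (rule summableI_nonneg_bounded)
  fix N
  let ?z = "\<lambda>i j. complex_of_real (w i j * (\<Sum>n<N. cmod (D n t (iota_inv \<xi>) i j)))"
  have "cmod (?z i j) \<le> hs_trunc_norm (Suc (max i j)) ?z"
    using member_le_L2_set[of "sqr (Suc (max i j))" "(i,j)" "\<lambda>(i,j). cmod (?z i j)"] by (simp add: hs_trunc_norm_def less_Suc_eq_le)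
  also have "\<dots> \<le> exp (- 0 * t) * hs_norm \<xi>"
    by (rule hs_core_bound[where h = "\<lambda>_ _. 1" and Q = "\<lambda>_. True"]) (use assms ones_super in auto)
  finally have "w i j * (\<Sum>n<N. cmod (D n t (iota_inv \<xi>) i j)) \<le> hs_norm \<xi>"
    using w_pos[of i j] by (simp add: abs_mult sum_nonneg del: of_real_sum of_real_mult)
  then show "(\<Sum>n<N. cmod (D n t (iota_inv \<xi>) i j)) \<le> hs_norm \<xi> / w i j"
    using w_pos[of i j] by (simp add: field_simps)
qed simp

definition hs_evol :: "real \<Rightarrow> mat \<Rightarrow> mat" where
  "hs_evol t \<xi> = (if t < 0 \<or> \<xi> \<notin> hs then zero_mat else iota lam mu (evol t (iota_inv \<xi>)))"

lemma hs_evol_bound: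
  fixes h :: "nat \<Rightarrow> nat \<Rightarrow> real" and Q :: "int \<Rightarrow> bool"
  assumes h: "\<And>i j. Q (int j - int i) \<Longrightarrow> jump al be h i j \<le> (- cr i j - \<kappa>) * h i j"
    and hpos: "\<And>i j. h i j > 0"
    and Q: "\<And>i j. \<not> Q (int j - int i) \<Longrightarrow> \<xi> i j = 0"
    and hs: "\<xi> \<in> hs" and t: "0 \<le> t"
  shows "hs_evol t \<xi> \<in> hs" "hs_norm (hs_evol t \<xi>) \<le> exp (- \<kappa> * t) * hs_norm \<xi>"
proof -
  have lim: "(\<lambda>N. \<Sum>n<N. D n t (iota_inv \<xi>) i j) \<longlonglongrightarrow> evol t (iota_inv \<xi>) i j" for i j
    unfolding evol_def by (rule summable_LIMSEQ[OF summable_norm_cancel[OF hs_D_summable[OF hs t]]])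
  have T: "hs_evol t \<xi> = iota lam mu (evol t (iota_inv \<xi>))" using hs t by (simp add: hs_evol_def)
  have "hs_trunc_norm L (hs_evol t \<xi>) \<le> exp (- \<kappa> * t) * hs_norm \<xi>" for L
  proof (rule LIMSEQ_le_const2)
    show "(\<lambda>N. hs_trunc_norm L (\<lambda>i j. of_real (w i j) * (\<Sum>n<N. D n t (iota_inv \<xi>) i j))) \<longlonglongrightarrow> hs_trunc_norm L (hs_evol t \<xi>)"
      unfolding T iota_w hs_trunc_norm_def L2_set_def case_prod_unfold by (intro tendsto_intros lim)
    have "hs_trunc_norm L (\<lambda>i j. of_real (w i j) * (\<Sum>n<N. D n t (iota_inv \<xi>) i j)) \<le> exp (- \<kappa> * t) * hs_norm \<xi>" for N
    proof (rule order_trans[OF hs_trunc_norm_mono hs_core_bound[OF h hpos Q hs t]])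
      fix i j
      show "cmod (of_real (w i j) * (\<Sum>n<N. D n t (iota_inv \<xi>) i j)) \<le> cmod (of_real (w i j * (\<Sum>n<N. cmod (D n t (iota_inv \<xi>) i j))))"
        using w_pos[of i j] norm_sum[of "\<lambda>n. D n t (iota_inv \<xi>) i j" "{..<N}"]
        by (simp add: norm_mult abs_mult sum_nonneg del: of_real_sum of_real_mult)
    qed auto
    then show "\<exists>N. \<forall>n\<ge>N. hs_trunc_norm L (\<lambda>i j. of_real (w i j) * (\<Sum>n<n. D n t (iota_inv \<xi>) i j)) \<le> exp (- \<kappa> * t) * hs_norm \<xi>"
      by blast
  qed
  from hsI[OF this] show "hs_evol t \<xi> \<in> hs" "hs_norm (hs_evol t \<xi>) \<le> exp (- \<kappa> * t) * hs_norm \<xi>" by auto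
qed

lemma hs_evol_contraction:
  assumes "\<xi> \<in> hs" "0 \<le> t"
  shows "hs_evol t \<xi> \<in> hs" "hs_norm (hs_evol t \<xi>) \<le> hs_norm \<xi>"
  using hs_evol_bound[where h = "\<lambda>_ _. 1" and Q = "\<lambda>_. True" and \<kappa> = 0 and \<xi> = \<xi> and t = t] ones_super assms by auto

lemma hs_evol_add:
  assumes "\<xi> \<in> hs" "\<eta> \<in> hs" "0 \<le> t"
  shows "hs_evol t (\<lambda>i j. \<xi> i j + \<eta> i j) = (\<lambda>i j. hs_evol t \<xi> i j + hs_evol t \<eta> i j)"
proof -
  have e1: "iota_inv (\<lambda>i j. \<xi> i j + \<eta> i j) = (\<lambda>i j. iota_inv \<xi> i j + iota_inv \<eta> i j)"
    by (simp add: iota_inv_def add_divide_distrib)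
  have e2: "evol t (\<lambda>i j. iota_inv \<xi> i j + iota_inv \<eta> i j) = (\<lambda>i j. evol t (iota_inv \<xi>) i j + evol t (iota_inv \<eta>) i j)"
    by (rule evol_add; rule summable_norm_cancel[OF hs_D_summable]) (use assms in auto)
  show ?thesis
    using assms hs_add(1)[OF assms(1,2)] by (intro ext) (simp add: hs_evol_def e1 e2 iota_w distrib_left)
qed

lemma hs_evol_cmult:
  assumes "\<xi> \<in> hs" "0 \<le> t"
  shows "hs_evol t (\<lambda>i j. k * \<xi> i j) = (\<lambda>i j. k * hs_evol t \<xi> i j)"
proof -
  have e1: "iota_inv (\<lambda>i j. k * \<xi> i j) = (\<lambda>i j. k * iota_inv \<xi> i j)"
    by (simp add: iota_inv_def)
  have e2: "evol t (\<lambda>i j. k * iota_inv \<xi> i j) = (\<lambda>i j. k * evol t (iota_inv \<xi>) i j)"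
    by (rule evol_cmult; rule summable_norm_cancel[OF hs_D_summable]) (use assms in auto)
  show ?thesis
    using assms hs_cmult[OF assms(1)] by (intro ext) (simp add: hs_evol_def e1 e2 iota_w distrib_left)
qed

lemma hs_evol_iota: "0 \<le> t \<Longrightarrow> bounded_mat x \<Longrightarrow> hs_evol t (iota lam mu x) = iota lam mu (min_qds r lam mu zp zm t x)"
  by (simp add: hs_evol_def iota_bounded_hs iota_inv_iota min_qds_eq minimal_sol_def)

text \<open>For uniqueness, finite truncations are images under \<open>iota\<close> of bounded
  matrices, where the last clause prescribes the value; additivity splits off the remainder, and
  contractivity makes it small in every entry.\<close>

lemma hs_sg_eq: "hs_sg r lam mu zp zm = hs_evol"
  unfolding hs_sg_def
proof (rule the_equality)
  show "(\<forall>t \<xi>. (t < 0 \<or> \<xi> \<notin> hs) \<longrightarrow> hs_evol t \<xi> = zero_mat) \<and>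
     (\<forall>t\<ge>0. \<forall>\<xi>\<in>hs. hs_evol t \<xi> \<in> hs \<and> hs_norm (hs_evol t \<xi>) \<le> hs_norm \<xi>) \<and>
     (\<forall>t\<ge>0. \<forall>\<xi>\<in>hs. \<forall>\<eta>\<in>hs. hs_evol t (\<lambda>i j. \<xi> i j + \<eta> i j) = (\<lambda>i j. hs_evol t \<xi> i j + hs_evol t \<eta> i j)) \<and>
     (\<forall>t\<ge>0. \<forall>c. \<forall>\<xi>\<in>hs. hs_evol t (\<lambda>i j. c * \<xi> i j) = (\<lambda>i j. c * hs_evol t \<xi> i j)) \<and>
     (\<forall>t\<ge>0. \<forall>x. bounded_mat x \<longrightarrow> hs_evol t (iota lam mu x) = iota lam mu (min_qds r lam mu zp zm t x))"
    by (intro conjI allI impI ballI hs_evol_contraction hs_evol_add hs_evol_cmult hs_evol_iota) (auto simp: hs_evol_def)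
next
  fix R
  assume R: "(\<forall>t \<xi>. (t < 0 \<or> \<xi> \<notin> hs) \<longrightarrow> R t \<xi> = zero_mat) \<and>
     (\<forall>t\<ge>0. \<forall>\<xi>\<in>hs. R t \<xi> \<in> hs \<and> hs_norm (R t \<xi>) \<le> hs_norm \<xi>) \<and>
     (\<forall>t\<ge>0. \<forall>\<xi>\<in>hs. \<forall>\<eta>\<in>hs. R t (\<lambda>i j. \<xi> i j + \<eta> i j) = (\<lambda>i j. R t \<xi> i j + R t \<eta> i j)) \<and>
     (\<forall>t\<ge>0. \<forall>c. \<forall>\<xi>\<in>hs. R t (\<lambda>i j. c * \<xi> i j) = (\<lambda>i j. c * R t \<xi> i j)) \<and>
     (\<forall>t\<ge>0. \<forall>x. bounded_mat x \<longrightarrow> R t (iota lam mu x) = iota lam mu (min_qds r lam mu zp zm t x))"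
  note R1 = conjunct1[OF R] and R' = conjunct2[OF R]
  note R2 = conjunct1[OF R'] and R'' = conjunct2[OF R']
  note R3 = conjunct1[OF R''] and R5 = conjunct2[OF conjunct2[OF R'']]
  show "R = hs_evol"
  proof (intro ext)
    fix t \<xi> i j
    show "R t \<xi> i j = hs_evol t \<xi> i j"
    proof (cases "t < 0 \<or> \<xi> \<notin> hs")
      case True
      then have "R t \<xi> = zero_mat" using R1 by blast
      moreover have "hs_evol t \<xi> = zero_mat" unfolding hs_evol_def using True by (rule if_P)
      ultimately show ?thesis by simp
    next
      case False
      then have t: "0 \<le> t" and \<xi>: "\<xi> \<in> hs" by auto
      have "cmod (R t \<xi> i j - hs_evol t \<xi> i j) \<le> e" if e: "e > 0" for e
      proof -
        obtain M where M: "hs_norm (\<lambda>i j. \<xi> i j - trunc2 M \<xi> i j) < e / 2"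
          using hs_tail[OF \<xi>, of "e/2"] e by auto
        let ?a = "trunc2 M \<xi>" and ?b = "\<lambda>i j. \<xi> i j - trunc2 M \<xi> i j"
        have b: "?b \<in> hs" using \<xi> by (intro hs_diff) auto
        have ab: "(\<lambda>i j. ?a i j + ?b i j) = \<xi>" by simp
        \<comment> \<open>Division by \<open>w\<close> is harmless on a finite square.\<close>
        have "bounded_mat (iota_inv ?a)"
        proof -
          have "iota_inv ?a = trunc2 M (iota_inv \<xi>)" by (simp add: iota_inv_def trunc2_def fun_eq_iff)
          then have "iota_inv ?a \<in> hs" by simp
          then show ?thesis using hs_form_bdd by (auto simp: bounded_mat_iff)
        qed
        then have Ra: "R t ?a = hs_evol t ?a"
          using R5[rule_format, OF t, of "iota_inv ?a"] hs_evol_iota[OF t, of "iota_inv ?a"] by (simp add: iota_iota_inv)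
        have "R t (\<lambda>i j. ?a i j + ?b i j) = (\<lambda>i j. R t ?a i j + R t ?b i j)"
          using R3[rule_format, OF t trunc2_hs b] .
        then have 1: "R t \<xi> i j = R t ?a i j + R t ?b i j"
          unfolding ab by simp
        have 2: "hs_evol t \<xi> i j = hs_evol t ?a i j + hs_evol t ?b i j"
          using hs_evol_add[OF trunc2_hs[of M \<xi>] b t] unfolding ab by simp
        have Rb: "R t ?b \<in> hs" "hs_norm (R t ?b) \<le> hs_norm ?b"
          using R2[rule_format, OF t b] by auto
        have "cmod (R t \<xi> i j - hs_evol t \<xi> i j) = cmod (R t ?b i j - hs_evol t ?b i j)"
          unfolding 1 2 Ra by simp
        also have "\<dots> \<le> cmod (R t ?b i j) + cmod (hs_evol t ?b i j)"
          by (rule norm_triangle_ineq4)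
        also have "\<dots> \<le> hs_norm ?b + hs_norm ?b"
          using hs_entry_le[OF Rb(1), of i j] Rb(2) hs_entry_le[OF hs_evol_contraction(1)[OF b t], of i j]
            hs_evol_contraction(2)[OF b t] by linarith
        finally show ?thesis using M by simp
      qed
      then have "cmod (R t \<xi> i j - hs_evol t \<xi> i j) \<le> 0"
        by (rule field_le_epsilon[of _ 0, simplified])
      then show ?thesis by simp
    qed
  qed
qed

end

section \<open>Ground states on the diagonals\<close>

text \<open>Fourth roots reduce the claim to boundedness of \<open>n * y ^ n\<close> for
  \<open>y < 1\<close>. The shift from \<open>k\<close> to \<open>k + 1\<close> accounts for the
  division by \<open>y\<close>.\<close>

lemma power4_geometric_bounded:
  fixes x :: real
  assumes "0 < x" "x < 1"
  obtains B where "B > 0" "\<And>k. (real k + 1) ^ 4 * x ^ k \<le> B"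
proof -
  define y where "y = x powr (1/4)"
  have y: "0 < y" "y < 1" using assms powr_less_mono2[of "1/4" x 1] by (auto simp: y_def)
  have y4: "y ^ 4 = x" using assms by (simp add: y_def powr_power)
  have "(\<lambda>n. real n * y ^ n) \<longlonglongrightarrow> 0"
    using powser_times_n_limit_0[of y] y by simp
  then have "Bseq (\<lambda>n. real n * y ^ n)" by (rule convergent_imp_Bseq[OF convergentI])
  then obtain K where K: "K > 0" "\<And>n. \<bar>real n * y ^ n\<bar> \<le> K"
    by (auto simp: Bseq_def)
  have "(real k + 1) ^ 4 * x ^ k \<le> (K / y) ^ 4" for k
  proof -
    have "(real k + 1) * y ^ k \<le> K / y"
      using K(2)[of "Suc k"] y by (simp add: field_simps abs_mult)
    then have "((real k + 1) * y ^ k) ^ 4 \<le> (K / y) ^ 4"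
      using y by (intro power_mono) auto
    then show ?thesis
      by (simp add: power_mult_distrib y4[symmetric] power_mult[symmetric] mult.commute)
  qed
  moreover have "(K / y) ^ 4 > 0" using K y by simp
  ultimately show ?thesis using that by blast
qed

context qds begin

lemma evol_deriv:
  assumes e: "\<And>i j. cmod (x i j) \<le> C" and t: "t \<in> {0..T}"
  shows "((\<lambda>t. evol t x i j) has_vector_derivative cc i j * evol t x i j + jump al be (evol t x) i j) (at t within {0..T})"
proof -
  let ?I = "\<lambda>t. integral {0..t} (\<lambda>s. exp (of_real (t - s) * cc i j) * jump al be (evol s x) i j)"
  have c: "continuous_on {0..T} (\<lambda>s. jump al be (evol s x) i j)"
    unfolding jump_def by (intro continuous_intros evol_cont[OF e])
  have 1: "((\<lambda>t. exp (of_real t * cc i j)) has_vector_derivative (exp (of_real t * cc i j) * cc i j)) (at t within {0..T})"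
    using exp_scaleR_has_vector_derivative_right[where A="cc i j" and t=t and T="{0..T}"] by (simp add: scaleR_conv_of_real)
  have "((\<lambda>t. exp (of_real t * cc i j) * x i j + ?I t) has_vector_derivative
      exp (of_real t * cc i j) * cc i j * x i j + (cc i j * ?I t + jump al be (evol t x) i j)) (at t within {0..T})"
    by (intro has_vector_derivative_add has_vector_derivative_mult_left 1 duhamel_deriv c t)
  moreover have "exp (of_real t * cc i j) * cc i j * x i j + (cc i j * ?I t + jump al be (evol t x) i j)
      = cc i j * evol t x i j + jump al be (evol t x) i j"
    using evol_eq[where x = x and C = C and t = t and i = i and j = j, OF e] t by (simp add: algebra_simps)
  ultimately have "((\<lambda>t. exp (of_real t * cc i j) * x i j + ?I t) has_vector_derivative
      cc i j * evol t x i j + jump al be (evol t x) i j) (at t within {0..T})"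
    by (simp only:)
  then show ?thesis
    by (rule has_vector_derivative_transform[OF t, rotated]) (use evol_eq[where x = x and C = C, OF e] in auto)
qed

lemma evol_0: "(\<And>i j. cmod (x i j) \<le> C) \<Longrightarrow> evol 0 x i j = x i j"
  using evol_eq[where x = x and C = C and t = 0 and i = i and j = j] by simp

section \<open>Explicit eigenvectors of the real part\<close>

definition ground_seq :: "nat \<Rightarrow> nat \<Rightarrow> real" where
  "ground_seq m k = sqrt (\<Prod>a<m. (real (k + a) + 1) / (real (k + a) + r))"

definition rate :: "nat \<Rightarrow> real" where
  "rate m = real m / 2 * (mu\<^sup>2 * (real m + r - 1) + lam\<^sup>2 * (real m - r + 1))"

lemma ground_seq_pos: "ground_seq m k > 0"
  unfolding ground_seq_def using r_pos by (auto intro!: prod_pos divide_pos_pos)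

text \<open>Each factor moves monotonically from \<open>1 / r\<close> at zero to the limit
  \<open>1\<close>, so the larger of the two bounds it.\<close>

lemma ground_seq_bounded: "ground_seq m k \<le> sqrt (max 1 (1 / r) ^ m)"
proof -
  have "(\<Prod>a<m. (real (k + a) + 1) / (real (k + a) + r)) \<le> (\<Prod>a<m. max 1 (1 / r))"
  proof (rule prod_mono)
    fix a
    let ?z = "real (k + a)"
    have "?z + 1 \<le> max 1 (1 / r) * (?z + r)"
    proof (cases "r \<ge> 1")
      case True
      then have "max 1 (1 / r) = 1" by simp
      then show ?thesis using True by simp
    next
      case False
      have "?z * r \<le> ?z * 1" using False by (intro mult_left_mono) auto
      then have "?z + 1 \<le> (1 / r) * (?z + r)" using r_pos by (simp add: field_simps)
      also have "\<dots> \<le> max 1 (1 / r) * (?z + r)" using r_pos by (intro mult_right_mono) auto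
      finally show ?thesis .
    qed
    then show "0 \<le> (?z + 1) / (?z + r) \<and> (?z + 1) / (?z + r) \<le> max 1 (1 / r)"
      using r_pos by (auto simp: pos_divide_le_eq)
  qed
  then show ?thesis unfolding ground_seq_def by simp
qed

text \<open>Shifting \<open>k\<close> drops the factor at \<open>k\<close> and gains the one at
  \<open>k + m\<close>. The identity is cross-multiplied to stay free of quotients.\<close>

lemma ground_seq_Suc_sq:
  "(ground_seq m (Suc k))\<^sup>2 * ((real k + 1) * (real k + real m + r)) = (ground_seq m k)\<^sup>2 * ((real k + real m + 1) * (real k + r))"
proof (induction m)
  case 0
  show ?case by (simp add: ground_seq_def algebra_simps)
next
  case (Suc m)
  have step: "(ground_seq (Suc m) k)\<^sup>2 = (ground_seq m k)\<^sup>2 * ((real (k + m) + 1) / (real (k + m) + r))" for k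
    unfolding ground_seq_def using r_pos by (simp add: prod_nonneg)
  have nz: "real k + real m + r \<noteq> 0" "real k + real m + 1 + r \<noteq> 0" using r_pos by linarith+
  have "(ground_seq (Suc m) (Suc k))\<^sup>2 * ((real k + 1) * (real k + real (Suc m) + r)) = (ground_seq m (Suc k))\<^sup>2 * (real k + 1) * (real k + real m + 2)"
    unfolding step using nz by (simp add: field_simps)
  also have "(ground_seq m (Suc k))\<^sup>2 * (real k + 1) = (ground_seq m k)\<^sup>2 * ((real k + real m + 1) * (real k + r)) / (real k + real m + r)"
    using Suc nz by (simp add: eq_divide_eq mult.assoc)
  also have "\<dots> * (real k + real m + 2) = (ground_seq (Suc m) k)\<^sup>2 * ((real k + real (Suc m) + 1) * (real k + r))"
    unfolding step using nz by (simp add: field_simps)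
  finally show ?case .
qed

text \<open>After squaring, the linear factors of the two \<open>omega\<close> values complete the
  ratio of neighbouring terms to perfect squares, so the irrational rate acts on the sequence as a
  polynomial.\<close>

lemma ground_seq_step_up:
  "sqrt (omega r (Suc k)) * sqrt (omega r (Suc (k + m))) * ground_seq m (Suc k) = (real k + r) * (real k + real m + 1) * ground_seq m k"
proof (rule power2_eq_imp_eq)
  have o: "(sqrt (omega r n))\<^sup>2 = omega r n" for n by simp
  have "(sqrt (omega r (Suc k)) * sqrt (omega r (Suc (k + m))) * ground_seq m (Suc k))\<^sup>2
      = (real k + r) * (real k + real m + 1) * ((ground_seq m (Suc k))\<^sup>2 * ((real k + 1) * (real k + real m + r)))"
    unfolding power_mult_distrib o by (simp add: omega_def algebra_simps)
  also have "\<dots> = ((real k + r) * (real k + real m + 1) * ground_seq m k)\<^sup>2"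
    unfolding ground_seq_Suc_sq by (simp add: power2_eq_square algebra_simps)
  finally show "(sqrt (omega r (Suc k)) * sqrt (omega r (Suc (k + m))) * ground_seq m (Suc k))\<^sup>2
     = ((real k + r) * (real k + real m + 1) * ground_seq m k)\<^sup>2" .
  show "0 \<le> sqrt (omega r (Suc k)) * sqrt (omega r (Suc (k + m))) * ground_seq m (Suc k)"
    using ground_seq_pos[of m "Suc k"] by simp
  show "0 \<le> (real k + r) * (real k + real m + 1) * ground_seq m k"
    using ground_seq_pos[of m k] r_pos by simp
qed

text \<open>This is the step up at \<open>k - 1\<close>, multiplied by the same two square roots and
  then divided by the polynomial coefficient. At \<open>k = 0\<close> both sides vanish, which
  absorbs the truncated subtraction.\<close>

lemma ground_seq_step_down:
  "sqrt (omega r k) * sqrt (omega r (k + m)) * ground_seq m (k - 1) = real k * (real k + real m + r - 1) * ground_seq m k"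
proof (cases k)
  case (Suc p)
  have nz: "real p + r > 0" "real p + real m + 1 > 0" using r_pos by auto
  have o: "(sqrt (omega r n))\<^sup>2 = omega r n" for n by simp
  have "(real p + r) * (real p + real m + 1) * (sqrt (omega r (Suc p)) * sqrt (omega r (Suc (p + m))) * ground_seq m p)
     = sqrt (omega r (Suc p)) * sqrt (omega r (Suc (p + m))) * ((real p + r) * (real p + real m + 1) * ground_seq m p)"
    by (simp only: mult_ac)
  also have "\<dots> = (sqrt (omega r (Suc p)))\<^sup>2 * (sqrt (omega r (Suc (p + m))))\<^sup>2 * ground_seq m (Suc p)"
    unfolding ground_seq_step_up[symmetric] by (simp only: power2_eq_square mult_ac)
  also have "\<dots> = (real p + r) * (real p + real m + 1) * ((real p + 1) * (real p + real m + r) * ground_seq m (Suc p))"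
    unfolding o by (simp add: omega_def algebra_simps)
  finally have "sqrt (omega r (Suc p)) * sqrt (omega r (Suc (p + m))) * ground_seq m p = (real p + 1) * (real p + real m + r) * ground_seq m (Suc p)"
    using nz by simp
  then show ?thesis using Suc by (simp add: algebra_simps)
qed simp

definition ground :: "nat \<Rightarrow> real \<Rightarrow> nat \<Rightarrow> nat \<Rightarrow> real" where
  "ground m c i j = (if j = i + m then c * ground_seq m i else 0)"

text \<open>With the square roots gone, both jump contributions and \<open>cr\<close> are quadratic
  polynomials in \<open>k\<close> whose sum is the constant \<open>- rate m\<close>. Only values on
  the \<open>m\<close>-th diagonal enter, so \<open>h\<close> is free elsewhere.\<close>

lemma jump_ground_seq:
  assumes "\<And>k. h k (k + m) = c * ground_seq m k"
  shows "jump al be h k (k + m) = (- cr k (k + m) - rate m) * h k (k + m)"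
proof -
  have a: "al k (k + m) * h (k - 1) (k + m - 1) = c * (mu\<^sup>2 * (real k * (real k + real m + r - 1) * ground_seq m k))"
  proof (cases k)
    case (Suc p)
    then have "h (k - 1) (k + m - 1) = c * ground_seq m (k - 1)" using assms[of p] by simp
    then show ?thesis unfolding ground_seq_step_down[symmetric] al_def by (simp only: mult_ac)
  qed simp
  have b: "be k (k + m) * h (Suc k) (Suc (k + m)) = c * (lam\<^sup>2 * ((real k + r) * (real k + real m + 1) * ground_seq m k))"
    using assms[of "Suc k"] unfolding ground_seq_step_up[symmetric] be_def by (simp add: mult_ac)
  show ?thesis
    unfolding jump_def of_real_eq_id id_def a b assms
    by (simp add: cr_def rate_def omega_def field_simps)
qed

text \<open>The term \<open>m - r + 1\<close> can be negative for large \<open>r\<close>; it is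
  offset because \<open>lam\<^sup>2 * r \<le> mu\<^sup>2 * r\<close>.\<close>

lemma rate_pos: "m \<ge> 1 \<Longrightarrow> rate m \<ge> 0"
proof -
  assume m: "m \<ge> 1"
  have l: "lam\<^sup>2 \<le> mu\<^sup>2" using lam_pos lam_mu by (intro power_mono) auto
  have "lam\<^sup>2 * r \<le> mu\<^sup>2 * r" using l r_pos by (intro mult_right_mono) auto
  moreover have "mu\<^sup>2 * (real m - 1) \<ge> 0" "lam\<^sup>2 * (real m + 1) \<ge> 0" using m by auto
  moreover have "mu\<^sup>2 * (real m + r - 1) + lam\<^sup>2 * (real m - r + 1)
      = (mu\<^sup>2 * (real m - 1) + lam\<^sup>2 * (real m + 1)) + (mu\<^sup>2 * r - lam\<^sup>2 * r)"
    by (simp add: algebra_simps)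
  ultimately have "mu\<^sup>2 * (real m + r - 1) + lam\<^sup>2 * (real m - r + 1) \<ge> 0"
    by linarith
  then show ?thesis by (simp add: rate_def)
qed

lemma hs_evol_decay:
  assumes z: "\<And>i j. j \<noteq> i + m \<Longrightarrow> \<xi> i j = 0" and hs: "\<xi> \<in> hs" and t: "0 \<le> t"
  shows "hs_norm (hs_evol t \<xi>) \<le> exp (- rate m * t) * hs_norm \<xi>"
\<comment> \<open>Off the diagonal the value \<open>1\<close> only secures positivity of
  \<open>h\<close>; the eigenvalue equation is asked on the diagonal selected by
  \<open>Q\<close>.\<close>
proof (rule hs_evol_bound(2)[where Q = "\<lambda>d. d = int m" and h = "\<lambda>i j. if j = i + m then ground_seq m i else 1", OF _ _ _ hs t])
  let ?h = "\<lambda>i j. if j = i + m then ground_seq m i else 1"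
  fix i j
  show "jump al be ?h i j \<le> (- cr i j - rate m) * ?h i j" if "int j - int i = int m"
  proof -
    have j: "j = i + m" using that by simp
    show ?thesis unfolding j using jump_ground_seq[of ?h m 1 i] by simp
  qed
  show "0 < ?h i j" by (simp add: ground_seq_pos)
  show "\<xi> i j = 0" if "int j - int i \<noteq> int m" using z[of j i] that by auto
qed

section \<open>Control of the evolved ground state\<close>

lemma ground_bounded: "c \<ge> 0 \<Longrightarrow> ground m c i j \<le> c * sqrt (max 1 (1 / r) ^ m)"
  using mult_left_mono[OF ground_seq_bounded[of m i], of c] by (auto simp: ground_def)

lemma ground_nonneg: "c \<ge> 0 \<Longrightarrow> ground m c i j \<ge> 0"
  using ground_seq_pos[of m i] by (simp add: ground_def)

lemma ground_entry:
  assumes "c \<ge> 0"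
  shows "cmod (of_real (ground m c i j)) \<le> c * sqrt (max 1 (1 / r) ^ m)"
  using ground_bounded[OF assms] ground_nonneg[OF assms] by simp

text \<open>The ground state is a supersolution of the phase-free majorant, and its decay factor is
  at most one. Dropping that factor leaves a bound independent of \<open>t\<close>, suited to
  dominating difference quotients.\<close>

lemma evol_ground_le:
  assumes c: "c \<ge> 0" and m: "m \<ge> 1" and t: "0 \<le> t"
  shows "cmod (evol t (\<lambda>i j. of_real (ground m c i j)) i j) \<le> ground m c i j"
proof -
  let ?u = "\<lambda>i j. complex_of_real (ground m c i j)"
  have D: "cmod (D n t ?u i j) \<le> D0 n t (ground m c) i j" for n
    by (rule D_norm_le[OF _ t]) (use ground_nonneg[OF c] in auto)
  have super: "(\<Sum>n<N. D0 n t (ground m c) i j) \<le> ground m c i j" for N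
  proof (cases "int j - int i = int m")
    case True
    have "(\<Sum>n<N. D0 n t (ground m c) i j) \<le> exp (- rate m * t) * ground m c i j"
    proof (rule dyson_super[where P = "\<lambda>d. d = int m"])
      fix i j assume "int j - int i = int m"
      then have "j = i + m" by simp
      then show "jump al be (ground m c) i j \<le> (- cr i j - rate m) * ground m c i j"
        using jump_ground_seq[of "ground m c" m c i] by (simp add: ground_def)
    qed (use True t ground_nonneg[OF c] in auto)
    also have "\<dots> \<le> 1 * ground m c i j"
      using rate_pos[OF m] t ground_nonneg[OF c] by (intro mult_right_mono) auto
    finally show ?thesis by simp
  next
    case False
    have "D0 n t (ground m c) i j = 0" for n
      by (rule dyson_diag[where P = "\<lambda>d. d = int m"]) (use False in \<open>auto simp: ground_def\<close>)
    then show ?thesis using ground_nonneg[OF c] by simp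
  qed
  show ?thesis
  proof (rule LIMSEQ_le_const2[OF tendsto_norm[OF evol_lim[where x = ?u, OF ground_entry[OF c] t]]])
    have "cmod (\<Sum>n<N. D n t ?u i j) \<le> ground m c i j" for N
      by (rule order_trans[OF norm_sum order_trans[OF sum_mono[OF D] super]])
    then show "\<exists>N. \<forall>n\<ge>N. cmod (\<Sum>n<n. D n t ?u i j) \<le> ground m c i j" by blast
  qed
qed

lemma omega_poly: "omega r n \<le> (1 + r) * (real n + 1)\<^sup>2"
  by (rule order_trans[OF omega_le]) (use r_pos in \<open>auto intro!: mult_left_mono power_mono\<close>)

text \<open>All coefficients are combinations of \<open>omega\<close> and hence quadratic in
  \<open>k\<close>. The difference \<open>cmod cc - cr\<close> is the combination that arises once
  the jump term of the ground state is replaced by the eigenvalue equation.\<close>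

lemma cmod_cc_le: "\<exists>K\<ge>0. \<forall>k. cmod (cc k (k + m)) - cr k (k + m) \<le> K * (real k + 1)\<^sup>2"
proof -
  define A where "A = lam\<^sup>2 / 2 + \<bar>zp\<bar>"
  define B where "B = mu\<^sup>2 / 2 + \<bar>zm\<bar>"
  have AB: "A \<ge> 0" "B \<ge> 0" by (auto simp: A_def B_def)
  have g: "cmod (gcoef r lam mu zp zm n) \<le> A * omega r (Suc n) + B * omega r n" for n
  proof -
    have 1: "cmod (complex_of_real (lam^2/2) + \<i> * complex_of_real zp) \<le> A"
      unfolding A_def by (rule order_trans[OF norm_triangle_ineq]) (simp add: norm_mult norm_power)
    have 2: "cmod (complex_of_real (mu^2/2) + \<i> * complex_of_real zm) \<le> B"
      unfolding B_def by (rule order_trans[OF norm_triangle_ineq]) (simp add: norm_mult norm_power)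
    have "cmod (gcoef r lam mu zp zm n) \<le> cmod (complex_of_real (lam^2/2) + \<i> * complex_of_real zp) * omega r (Suc n)
        + cmod (complex_of_real (mu^2/2) + \<i> * complex_of_real zm) * omega r n"
      unfolding gcoef_def norm_minus_cancel by (rule order_trans[OF norm_triangle_ineq]) (simp add: norm_mult)
    also have "\<dots> \<le> A * omega r (Suc n) + B * omega r n"
      by (intro add_mono mult_right_mono 1 2) auto
    finally show ?thesis .
  qed
  let ?N = "2 * real m + 2"
  have o: "omega r n \<le> (1 + r) * (?N * (real k + 1))\<^sup>2" if "n \<le> Suc (k + m)" for n k
  proof (rule order_trans[OF omega_poly mult_left_mono[OF power_mono]])
    have "real n + 1 \<le> real k + real m + 2" using that by simp
    also have "\<dots> \<le> ?N * (real k + 1)" by (simp add: algebra_simps)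
    finally show "real n + 1 \<le> ?N * (real k + 1)" .
  qed (use r_pos in auto)
  \<comment> \<open>The factor \<open>4\<close> stems from the two \<open>gcoef\<close> terms in
    \<open>cc\<close> and from bounding \<open>- cr\<close> by \<open>cmod cc\<close>.\<close>
  have "cmod (cc k (k + m)) - cr k (k + m) \<le> (4 * (A + B) * (1 + r) * ?N\<^sup>2) * (real k + 1)\<^sup>2" for k
  proof -
    let ?R = "(1 + r) * (?N * (real k + 1))\<^sup>2"
    have gg: "cmod (gcoef r lam mu zp zm n) \<le> (A + B) * ?R" if "n \<le> k + m" for n
    proof -
      have "A * omega r (Suc n) + B * omega r n \<le> A * ?R + B * ?R"
        using that AB by (intro add_mono mult_left_mono o) auto
      then show ?thesis using g[of n] by (simp add: algebra_simps)
    qed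
    have 1: "cmod (cc k (k + m)) \<le> 2 * ((A + B) * ?R)"
      unfolding cc_def
      by (rule order_trans[OF norm_triangle_ineq]) (use gg[of k] gg[of "k+m"] in simp)
    have "- cr k (k + m) \<le> cmod (cc k (k + m))"
      unfolding Re_cc[symmetric] using abs_Re_le_cmod[of "cc k (k + m)"] by linarith
    moreover have "4 * ((A + B) * ?R) = (4 * (A + B) * (1 + r) * ?N\<^sup>2) * (real k + 1)\<^sup>2"
      by (simp only: power_mult_distrib mult_ac)
    ultimately show ?thesis using 1 by linarith
  qed
  moreover have "4 * (A + B) * (1 + r) * ?N\<^sup>2 \<ge> 0" using AB r_pos by simp
  ultimately show ?thesis by blast
qed

text \<open>The squared weight supplies two factors \<open>nu ^ i\<close>: one absorbs the fourth
  power, the other is summed. The quadratic prefactor matches the growth of the generator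
  coefficients, so this matrix serves as the common majorant later.\<close>

lemma ground_weighted_hs:
  assumes c: "c \<ge> 0"
  shows "(\<lambda>i j. of_real (w i j * ((real i + 1)\<^sup>2 * ground m c i j))) \<in> hs"
proof -
  obtain B where B: "B > 0" "\<And>k. (real k + 1) ^ 4 * nu ^ k \<le> B"
    by (rule power4_geometric_bounded[OF nu_pos nu_less]) blast
  define G where "G = c * sqrt (max 1 (1 / r) ^ m)"
  have G: "G \<ge> 0" by (simp add: G_def c)
  let ?\<phi> = "\<lambda>i j. complex_of_real (w i j * ((real i + 1)\<^sup>2 * ground m c i j))"
  have "hs_trunc_norm M ?\<phi> \<le> sqrt (G\<^sup>2 * B * (1 / (1 - nu)))" for M
  proof (rule real_le_rsqrt)
    have "(hs_trunc_norm M ?\<phi>)\<^sup>2 = (\<Sum>i<M. \<Sum>j<M. (cmod (?\<phi> i j))\<^sup>2)" by (rule hs_trunc_norm_sq')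
    also have "\<dots> \<le> (\<Sum>i<M. G\<^sup>2 * B * nu ^ i)"
    proof (rule sum_mono)
      fix i
      have "(\<Sum>j<M. (cmod (?\<phi> i j))\<^sup>2) \<le> (cmod (?\<phi> i (i + m)))\<^sup>2"
      proof -
        have "(\<Sum>j<M. (cmod (?\<phi> i j))\<^sup>2) \<le> (\<Sum>j\<in>{..<M} \<union> {i + m}. (cmod (?\<phi> i j))\<^sup>2)"
          by (rule sum_mono2) auto
        also have "\<dots> = (\<Sum>j\<in>{i + m}. (cmod (?\<phi> i j))\<^sup>2)"
          by (rule sum.mono_neutral_right) (auto simp: ground_def)
        finally show ?thesis by simp
      qed
      also have "\<dots> = (w i (i + m))\<^sup>2 * ((real i + 1) ^ 4 * (ground m c i (i + m))\<^sup>2)"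
        unfolding norm_of_real power2_abs by (simp add: power_mult_distrib power_mult[symmetric])
      also have "\<dots> \<le> (nu ^ i * nu ^ i) * ((real i + 1) ^ 4 * G\<^sup>2)"
      proof (intro mult_mono mult_left_mono power_mono)
        have "nu ^ m \<le> 1" using nu_pos nu_less by (simp add: power_le_one)
        then have "nu ^ i * (nu ^ i * nu ^ m) \<le> nu ^ i * (nu ^ i * 1)"
          using nu_pos by (intro mult_left_mono) auto
        moreover have "(1 - nu\<^sup>2) * (nu ^ i * nu ^ (i + m)) \<le> 1 * (nu ^ i * nu ^ (i + m))"
          using nu_pos by (intro mult_right_mono) auto
        ultimately show "(w i (i + m))\<^sup>2 \<le> nu ^ i * nu ^ i"
          unfolding w_sq by (simp add: power_add)
        show "ground m c i (i + m) \<le> G" unfolding G_def by (rule ground_bounded[OF c])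
      qed (use nu_pos ground_nonneg[OF c] in auto)
      also have "\<dots> = G\<^sup>2 * ((real i + 1) ^ 4 * nu ^ i) * nu ^ i" by (simp only: mult_ac)
      also have "\<dots> \<le> G\<^sup>2 * B * nu ^ i"
        using nu_pos by (intro mult_left_mono mult_right_mono B) auto
      finally show "(\<Sum>j<M. (cmod (?\<phi> i j))\<^sup>2) \<le> G\<^sup>2 * B * nu ^ i" .
    qed
    also have "\<dots> = G\<^sup>2 * B * (\<Sum>i<M. nu ^ i)" by (simp only: sum_distrib_left)
    also have "\<dots> \<le> G\<^sup>2 * B * (1 / (1 - nu))"
      by (rule mult_left_mono[OF sum_nu_le]) (use B in auto)
    finally show "(hs_trunc_norm M ?\<phi>)\<^sup>2 \<le> G\<^sup>2 * B * (1 / (1 - nu))" .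
  qed
  then show ?thesis by (rule hsI(1))
qed

end

section \<open>The spectral gaps\<close>

lemma has_vector_derivative_at_right_quotient:
  fixes f :: "real \<Rightarrow> complex"
  assumes "(f has_vector_derivative D) (at 0 within {0..1})"
  shows "((\<lambda>t. (f t - f 0) / of_real t) \<longlongrightarrow> D) (at_right 0)"
proof -
  have at: "at (0::real) within {0..1} = at_right 0"
    by (rule at_within_Icc_at_right) simp
  have "((\<lambda>t. norm (f t - f 0 - (t - 0) *\<^sub>R D) / norm (t - 0)) \<longlongrightarrow> 0) (at_right 0)"
    using assms unfolding has_vector_derivative_def has_derivative_iff_norm at by simp
  moreover have "\<forall>\<^sub>F t in at_right 0. norm (f t - f 0 - (t - 0) *\<^sub>R D) / norm (t - 0) = norm ((f t - f 0) / of_real t - D)"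
    using eventually_at_right_less[of 0]
  proof eventually_elim
    case (elim t)
    have "(f t - f 0) / of_real t - D = (f t - f 0 - (t - 0) *\<^sub>R D) / of_real t"
      using elim by (simp add: scaleR_conv_of_real diff_divide_distrib)
    then show ?case by (simp add: norm_divide)
  qed
  ultimately have "((\<lambda>t. norm ((f t - f 0) / of_real t - D)) \<longlongrightarrow> 0) (at_right 0)"
    by (rule Lim_transform_eventually)
  then have "((\<lambda>t. (f t - f 0) / of_real t - D) \<longlongrightarrow> 0) (at_right 0)"
    by (rule tendsto_norm_zero_cancel)
  then show ?thesis by (simp add: LIM_zero_iff)
qed

section \<open>Membership in the diagonal subspaces\<close>

lemma Gsub_approximant_hs:
  assumes "finite F"
  shows "(\<lambda>i j. \<Sum>k\<in>F. c k * (if i = k \<and> int j = int k + int m then 1 else 0)) \<in> hs"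
    (is "?A \<in> hs")
proof -
  obtain n where n: "\<forall>k\<in>F. k < n"
    using assms unfolding finite_nat_set_iff_bounded ..
  have "trunc2 (n + m) ?A = ?A"
  proof (intro ext)
    fix i j
    show "trunc2 (n + m) ?A i j = ?A i j"
    proof (cases "i < n + m \<and> j < n + m")
      case False
      have "?A i j = 0"
        by (rule sum.neutral) (use n False in force)
      then show ?thesis using False by (simp add: trunc2_def)
    qed (simp add: trunc2_def)
  qed
  then show ?thesis using trunc2_hs[of "n + m" ?A] by simp
qed

text \<open>Entries are continuous in Hilbert--Schmidt norm, and every approximant vanishes off the
  diagonal.\<close>

lemma Gsub_zero:
  assumes "\<xi> \<in> Gsub (int m)" "j \<noteq> i + m"
  shows "\<xi> i j = 0"
proof -
  have hs: "\<xi> \<in> hs" using assms(1) by (simp add: Gsub_def)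
  have "cmod (\<xi> i j) \<le> 0 + e" if e: "e > 0" for e
  proof -
    obtain F c where F: "finite F" and lt: "hs_norm (\<lambda>i j. \<xi> i j - (\<Sum>k\<in>F. c k * (if i = k \<and> int j = int k + int m then 1 else 0))) < e"
      using assms(1) e unfolding Gsub_def by blast
    have "(\<Sum>k\<in>F. c k * (if i = k \<and> int j = int k + int m then 1 else 0)) = 0"
      by (rule sum.neutral) (use assms(2) in auto)
    then have "cmod (\<xi> i j) \<le> hs_norm (\<lambda>i j. \<xi> i j - (\<Sum>k\<in>F. c k * (if i = k \<and> int j = int k + int m then 1 else 0)))"
      using hs_entry_le[OF hs_diff[OF hs Gsub_approximant_hs[OF F, of c m]], of i j] by simp
    with lt show ?thesis by simp
  qed
  then have "cmod (\<xi> i j) \<le> 0" by (rule field_le_epsilon)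
  then show ?thesis by simp
qed

lemma GsubI:
  assumes "\<xi> \<in> hs" "\<And>i j. j \<noteq> i + m \<Longrightarrow> \<xi> i j = 0"
  shows "\<xi> \<in> Gsub (int m)"
  unfolding Gsub_def mem_Collect_eq
proof (intro conjI allI impI assms(1))
  fix e :: real assume "e > 0"
  then obtain M where M: "hs_norm (\<lambda>i j. \<xi> i j - trunc2 M \<xi> i j) < e"
    using hs_tail[OF assms(1)] by blast
  let ?c = "\<lambda>k. \<xi> k (k + m)"
  have eq: "(\<Sum>k\<in>{..<M}. ?c k * (if i = k \<and> int j = int k + int m then 1 else 0)) = (if i < M then \<xi> i j else 0)" for i j
  proof -
    have "(\<Sum>k\<in>{..<M}. ?c k * (if i = k \<and> int j = int k + int m then 1 else 0)) = (\<Sum>k\<in>{..<M}. if k = i then \<xi> i j else 0)"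
    proof (rule sum.cong[OF refl])
      fix k
      have "(i = k \<and> int j = int k + int m) \<longleftrightarrow> (k = i \<and> j = i + m)" by auto
      then show "?c k * (if i = k \<and> int j = int k + int m then 1 else 0) = (if k = i then \<xi> i j else 0)"
        using assms(2)[of j i] by simp
    qed
    then show ?thesis by (simp add: sum.delta)
  qed
  have "hs_norm (\<lambda>i j. \<xi> i j - (\<Sum>k\<in>{..<M}. ?c k * (if i = k \<and> int j = int k + int m then 1 else 0)))
     \<le> hs_norm (\<lambda>i j. \<xi> i j - trunc2 M \<xi> i j)"
    unfolding eq by (rule hs_mono(2)[OF _ hs_diff[OF assms(1) trunc2_hs]]) (simp add: trunc2_def)
  with M show "\<exists>F c. finite F \<and> (\<forall>k\<in>F. int k + int m \<ge> 0) \<and>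
     hs_norm (\<lambda>i j. \<xi> i j - (\<Sum>k\<in>F. c k * (if i = k \<and> int j = int k + int m then 1 else 0))) < e"
    by (intro exI[of _ "{..<M}"] exI[of _ ?c]) auto
qed

section \<open>The generator, the lower bound and its attainment\<close>

context qds begin

abbreviation "quot t \<xi> \<equiv> (\<lambda>i j. (hs_evol t \<xi> i j - \<xi> i j) / complex_of_real t)"

lemma quot_hs: "\<xi> \<in> hs \<Longrightarrow> 0 \<le> t \<Longrightarrow> quot t \<xi> \<in> hs"
  using hs_cmult[OF hs_diff[OF hs_evol_contraction(1)], of \<xi> t \<xi> "1 / of_real t"] by simp

lemma gen_conv_hs_evol: "gen_conv r lam mu zp zm \<xi> \<eta> \<longleftrightarrow> \<eta> \<in> hs \<and>
    ((\<lambda>t. hs_norm (\<lambda>i j. quot t \<xi> i j - \<eta> i j)) \<longlongrightarrow> 0) (at_right 0)"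
  by (simp add: gen_conv_def hs_sg_eq)

text \<open>Norm convergence of the quotients forces convergence of each entry, which determines the
  limit.\<close>

lemma gen_conv_unique:
  assumes \<xi>: "\<xi> \<in> hs" and "gen_conv r lam mu zp zm \<xi> \<eta>" "gen_conv r lam mu zp zm \<xi> \<eta>'"
  shows "\<eta> = \<eta>'"
proof (intro ext)
  fix i j
  have *: "((\<lambda>t. quot t \<xi> i j) \<longlongrightarrow> \<zeta> i j) (at_right 0)" if "gen_conv r lam mu zp zm \<xi> \<zeta>" for \<zeta>
  proof -
    have \<zeta>: "\<zeta> \<in> hs" and lim: "((\<lambda>t. hs_norm (\<lambda>i j. quot t \<xi> i j - \<zeta> i j)) \<longlongrightarrow> 0) (at_right 0)"
      using that by (auto simp: gen_conv_hs_evol)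
    have "((\<lambda>t. quot t \<xi> i j - \<zeta> i j) \<longlongrightarrow> 0) (at_right 0)"
    proof (rule Lim_null_comparison[OF _ lim])
      show "\<forall>\<^sub>F t in at_right 0. norm (quot t \<xi> i j - \<zeta> i j) \<le> hs_norm (\<lambda>i j. quot t \<xi> i j - \<zeta> i j)"
        using eventually_at_right_less[of "0::real"]
      proof eventually_elim
        case (elim t)
        then have "quot t \<xi> \<in> hs" by (intro quot_hs \<xi>) simp
        from hs_entry_le[OF hs_diff[OF this \<zeta>]] show ?case .
      qed
    qed
    then show ?thesis by (simp add: LIM_zero_iff)
  qed
  show "\<eta> i j = \<eta>' i j"
    by (rule tendsto_unique[OF _ *[OF assms(2)] *[OF assms(3)]]) simp
qed

lemma gen_eq: "\<xi> \<in> hs \<Longrightarrow> gen_conv r lam mu zp zm \<xi> \<eta> \<Longrightarrow> gen r lam mu zp zm \<xi> = \<eta>"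
  unfolding gen_def by (rule the_equality) (auto dest: gen_conv_unique)

lemma exp_quotient_limit: "((\<lambda>t. (exp (- k * t) - 1) / t) \<longlongrightarrow> - k) (at_right (0::real))"
proof -
  have "((\<lambda>t. exp (- k * t)) has_real_derivative - k) (at 0)"
    by (auto intro!: derivative_eq_intros)
  then have "((\<lambda>h. (exp (- k * (0 + h)) - exp (- k * 0)) / h) \<longlongrightarrow> - k) (at 0)"
    by (rule DERIV_D)
  then show ?thesis
    by (auto intro: tendsto_mono[OF at_le])
qed

text \<open>The real part of the inner product of \<open>\<xi>\<close> with its evolution is at most
  \<open>exp (- rate m * t)\<close>, with equality at \<open>t = 0\<close>, so the right derivatives
  at zero compare. Only the existence of \<open>\<eta>\<close> enters, which covers arbitrary domain
  elements.\<close>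

lemma dirichlet_ge_rate:
  assumes dom: "\<xi> \<in> dom_gen r lam mu zp zm" and n: "hs_norm \<xi> = 1" and G: "\<xi> \<in> Gsub (int m)"
  shows "dirichlet r lam mu zp zm \<xi> \<ge> rate m"
proof -
  have \<xi>: "\<xi> \<in> hs" using G by (simp add: Gsub_def)
  obtain \<eta> where conv: "gen_conv r lam mu zp zm \<xi> \<eta>" using dom by (auto simp: dom_gen_def)
  have \<eta>: "\<eta> \<in> hs" and lim: "((\<lambda>t. hs_norm (\<lambda>i j. quot t \<xi> i j - \<eta> i j)) \<longlongrightarrow> 0) (at_right 0)"
    using conv by (auto simp: gen_conv_hs_evol)
  have self: "Re (hs_inner \<xi> \<xi>) = 1"
    using Re_hs_inner_multiplier[of \<xi> "\<lambda>_ _. 1" 1] \<xi> n by simp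
  have pos: "\<forall>\<^sub>F t in at_right (0::real). 0 < t" by (rule eventually_at_right_less)
  have "((\<lambda>t. hs_inner \<xi> (quot t \<xi>) - hs_inner \<xi> \<eta>) \<longlongrightarrow> 0) (at_right 0)"
  proof (rule Lim_null_comparison[OF _ lim])
    show "\<forall>\<^sub>F t in at_right 0. norm (hs_inner \<xi> (quot t \<xi>) - hs_inner \<xi> \<eta>) \<le> hs_norm (\<lambda>i j. quot t \<xi> i j - \<eta> i j)"
      using pos
    proof eventually_elim
      case (elim t)
      have q: "quot t \<xi> \<in> hs" using elim by (intro quot_hs \<xi>) simp
      show ?case
        using hs_cauchy_schwarz[OF \<xi> hs_diff[OF q \<eta>]] n by (simp add: hs_inner_diff[OF \<xi> q \<eta>])
    qed
  qed
  then have "((\<lambda>t. hs_inner \<xi> (quot t \<xi>)) \<longlongrightarrow> hs_inner \<xi> \<eta>) (at_right 0)"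
    by (simp add: LIM_zero_iff)
  then have "((\<lambda>t. Re (hs_inner \<xi> (quot t \<xi>))) \<longlongrightarrow> Re (hs_inner \<xi> \<eta>)) (at_right 0)"
    by (rule tendsto_Re)
  moreover have "\<forall>\<^sub>F t in at_right 0. Re (hs_inner \<xi> (quot t \<xi>)) \<le> (exp (- rate m * t) - 1) / t"
    using pos
  proof eventually_elim
    case (elim t)
    have T: "hs_evol t \<xi> \<in> hs" using elim by (intro hs_evol_contraction \<xi>) simp
    have "hs_inner \<xi> (quot t \<xi>) = (1 / of_real t) * (hs_inner \<xi> (hs_evol t \<xi>) - hs_inner \<xi> \<xi>)"
      using hs_inner_cmult[of \<xi> "1 / of_real t" "\<lambda>i j. hs_evol t \<xi> i j - \<xi> i j"]
      by (simp add: hs_inner_diff[OF \<xi> T \<xi>])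
    then have 1: "Re (hs_inner \<xi> (quot t \<xi>)) = (Re (hs_inner \<xi> (hs_evol t \<xi>)) - 1) / t"
      using self by (simp add: Re_divide_of_real)
    have "Re (hs_inner \<xi> (hs_evol t \<xi>)) \<le> hs_norm \<xi> * hs_norm (hs_evol t \<xi>)"
      using complex_Re_le_cmod hs_cauchy_schwarz[OF \<xi> T] by (rule order_trans)
    also have "\<dots> \<le> exp (- rate m * t)"
      using hs_evol_decay[where t = t, OF Gsub_zero[OF G] \<xi>] elim n by simp
    finally show ?case
      unfolding 1 using elim by (intro divide_right_mono) auto
  qed
  ultimately have "Re (hs_inner \<xi> \<eta>) \<le> - rate m"
    by (intro tendsto_le[OF _ exp_quotient_limit[of "rate m"]]) auto
  then show ?thesis
    by (simp add: dirichlet_def gen_eq[OF \<xi> conv])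
qed

definition ground_hs :: "nat \<Rightarrow> real \<Rightarrow> mat" where
  "ground_hs m c = (\<lambda>i j. of_real (w i j * ground m c i j))"

lemma ground_hs_iota: "ground_hs m c = iota lam mu (\<lambda>i j. of_real (ground m c i j))"
  by (auto simp: fun_eq_iff ground_hs_def iota_w)

lemma ground_hs_dominated_hs:
  assumes c: "c \<ge> 0" and K: "K \<ge> 0" and le: "\<And>k. cmod (\<xi> k (k + m)) \<le> K * (real k + 1)\<^sup>2 * (w k (k + m) * ground m c k (k + m))"
    and z: "\<And>i j. j \<noteq> i + m \<Longrightarrow> \<xi> i j = 0"
  shows "\<xi> \<in> hs"
proof (rule hs_mono(1)[OF _ hs_cmult[OF ground_weighted_hs[OF c, of m], of "of_real K"]])
  fix i j
  show "cmod (\<xi> i j) \<le> cmod (of_real K * of_real (w i j * ((real i + 1)\<^sup>2 * ground m c i j)))"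
  proof (cases "j = i + m")
    case True
    have "0 \<le> w i j * ((real i + 1)\<^sup>2 * ground m c i j)"
      using w_pos[of i j] ground_nonneg[OF c, of m i j] by simp
    then show ?thesis
      using le[of i] K unfolding True norm_mult norm_of_real by (simp add: mult_ac)
  qed (simp add: z)
qed

lemma ground_hs_hs: "c \<ge> 0 \<Longrightarrow> ground_hs m c \<in> hs"
proof (rule ground_hs_dominated_hs[where K = 1])
  fix k assume c: "c \<ge> 0"
  have "0 \<le> w k (k + m) * ground m c k (k + m)"
    using w_pos[of k "k + m"] ground_nonneg[OF c, of m k "k + m"] by simp
  moreover have "1 \<le> (real k + 1)\<^sup>2" by (rule one_le_power) simp
  ultimately have "1 * (w k (k + m) * ground m c k (k + m)) \<le> (real k + 1)\<^sup>2 * (w k (k + m) * ground m c k (k + m))"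
    by (intro mult_right_mono)
  then show "cmod (ground_hs m c k (k + m)) \<le> 1 * (real k + 1)\<^sup>2 * (w k (k + m) * ground m c k (k + m))"
    using \<open>0 \<le> w k (k + m) * ground m c k (k + m)\<close> by (simp add: ground_hs_def del: of_real_mult)
qed (auto simp: ground_hs_def ground_def)

text \<open>The velocity of an entry is bounded for all times by the ground state itself: domination
  controls both the diagonal and the jump part, and the eigenvalue equation evaluates the latter.
  Integration gives a bound linear in \<open>t\<close>.\<close>

lemma evol_ground_increment:
  assumes c: "c \<ge> 0" and m: "m \<ge> 1" and t: "0 \<le> t"
  shows "cmod (evol t (\<lambda>i j. of_real (ground m c i j)) k (k + m) - of_real (ground m c k (k + m)))
     \<le> (cmod (cc k (k + m)) - cr k (k + m)) * ground m c k (k + m) * t"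
proof -
  let ?u = "\<lambda>i j. complex_of_real (ground m c i j)"
  let ?d = "\<lambda>s. cc k (k + m) * evol s ?u k (k + m) + jump al be (evol s ?u) k (k + m)"
  let ?B = "(cmod (cc k (k + m)) - cr k (k + m)) * ground m c k (k + m)"
  note e = ground_entry[OF c, of m]
  have int: "(?d has_integral (evol t ?u k (k + m) - evol 0 ?u k (k + m))) {0..t}"
    by (rule fundamental_theorem_of_calculus[OF t evol_deriv[where x = ?u, OF e]])
  have B: "norm (?d s) \<le> ?B" if "s \<in> {0..t}" for s
  proof -
    have s: "0 \<le> s" using that by simp
    have "norm (?d s) \<le> cmod (cc k (k + m)) * cmod (evol s ?u k (k + m)) + cmod (jump al be (evol s ?u) k (k + m))"
      by (rule order_trans[OF norm_triangle_ineq]) (simp add: norm_mult)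
    also have "\<dots> \<le> cmod (cc k (k + m)) * ground m c k (k + m) + jump al be (ground m c) k (k + m)"
      by (intro add_mono mult_left_mono evol_ground_le[OF c m s] jump_norm_le) auto
    also have "jump al be (ground m c) k (k + m) = (- cr k (k + m) - rate m) * ground m c k (k + m)"
      by (rule jump_ground_seq[where c = c]) (simp add: ground_def)
    also have "\<dots> \<le> - cr k (k + m) * ground m c k (k + m)"
      using rate_pos[OF m] ground_nonneg[OF c, of m k "k + m"] by (intro mult_right_mono) auto
    finally show ?thesis by (simp add: algebra_simps)
  qed
  have B0: "0 \<le> ?B" using B[of 0] t norm_ge_zero[of "?d 0"] by (meson atLeastAtMost_iff order_refl order_trans)
  have "norm (evol t ?u k (k + m) - evol 0 ?u k (k + m)) \<le> ?B * measure lborel (cbox 0 t)"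
    by (rule has_integral_bound[OF B0]) (use int B in auto)
  then show ?thesis using t by (simp add: evol_0[where x = ?u, OF e])
qed

text \<open>For \<open>\<zeta>\<^sup>\<plusminus> \<noteq> 0\<close> the vector \<open>ground_hs\<close> is not an eigenvector, but its evolution stays below it entrywise,
  so the difference quotients are dominated and converge in norm.\<close>

lemma gen_ground_hs:
  assumes c: "c \<ge> 0" and m: "m \<ge> 1"
  shows "gen_conv r lam mu zp zm (ground_hs m c) (\<lambda>i j. (cc i j + of_real (- cr i j - rate m)) * ground_hs m c i j)"
proof -
  let ?u = "\<lambda>i j. complex_of_real (ground m c i j)"
  let ?\<eta> = "\<lambda>i j. (cc i j + of_real (- cr i j - rate m)) * ground_hs m c i j"
  note e = ground_entry[OF c, of m]
  obtain K where K: "K \<ge> 0" "\<And>k. cmod (cc k (k + m)) - cr k (k + m) \<le> K * (real k + 1)\<^sup>2"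
    using cmod_cc_le[of m] by blast
  define R where "R = rate m"
  have R: "R \<ge> 0" using rate_pos[OF m] by (simp add: R_def)
  have wg: "0 \<le> w i j * ground m c i j" for i j
    using w_pos[of i j] ground_nonneg[OF c, of m i j] by simp
  have u0: "ground m c i j = 0" if "j \<noteq> i + m" for i j using that by (simp add: ground_def)
  have \<eta>_le: "cmod (?\<eta> k (k + m)) \<le> (K + R) * (real k + 1)\<^sup>2 * (w k (k + m) * ground m c k (k + m))" for k
  proof -
    have "cmod (cc k (k + m) + of_real (- cr k (k + m) - rate m)) \<le> cmod (cc k (k + m)) + (- cr k (k + m) + R)"
    proof (rule order_trans[OF norm_triangle_ineq add_left_mono])
      show "cmod (of_real (- cr k (k + m) - rate m)) \<le> - cr k (k + m) + R"
        unfolding norm_of_real using cr_nonpos[of k "k + m"] R by (simp add: R_def abs_le_iff)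
    qed
    also have "\<dots> \<le> K * (real k + 1)\<^sup>2 + R * (real k + 1)\<^sup>2"
    proof -
      have "R * 1 \<le> R * (real k + 1)\<^sup>2" using R by (intro mult_left_mono one_le_power) auto
      then show ?thesis using K(2)[of k] by simp
    qed
    finally have "cmod (cc k (k + m) + of_real (- cr k (k + m) - rate m)) \<le> (K + R) * (real k + 1)\<^sup>2"
      by (simp add: distrib_right)
    from mult_right_mono[OF this wg[of k "k + m"]] show ?thesis
      using wg[of k "k + m"] unfolding ground_hs_def norm_mult[of _ "of_real _"] norm_of_real by simp
  qed
  have \<eta>_hs: "?\<eta> \<in> hs"
    by (rule ground_hs_dominated_hs[where \<xi> = ?\<eta> and m = m and K = "K + R", OF c _ \<eta>_le]) (use K R in \<open>auto simp: ground_hs_def u0\<close>)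
  \<comment> \<open>The constant collects \<open>K\<close> from the difference quotient and
    \<open>K + R\<close> from the candidate limit \<open>?\<eta>\<close>.\<close>
  define h where "h i j = complex_of_real ((2 * K + R) * (w i j * ((real i + 1)\<^sup>2 * ground m c i j)))" for i j
  have h: "h \<in> hs"
    unfolding h_def using hs_cmult[OF ground_weighted_hs[OF c, of m], of "of_real (2 * K + R)"] by simp
  have T: "hs_evol t (ground_hs m c) i j = of_real (w i j) * evol t ?u i j" if "0 \<le> t" for t i j
    using that ground_hs_hs[OF c, of m] unfolding hs_evol_def by (simp add: ground_hs_iota iota_inv_iota iota_w)
  have quot: "quot t (ground_hs m c) i j = of_real (w i j) * ((evol t ?u i j - ?u i j) / of_real t)" if "0 < t" for t i j
    unfolding T[OF less_imp_le[OF that]] by (simp add: ground_hs_def right_diff_distrib)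
  have pos: "\<forall>\<^sub>F t in at_right (0::real). 0 < t" by (rule eventually_at_right_less)
  have "((\<lambda>t. hs_norm (\<lambda>i j. quot t (ground_hs m c) i j - ?\<eta> i j)) \<longlongrightarrow> 0) (at_right 0)"
  proof (rule hs_dominated_tendsto_0[OF h])
    show "\<forall>\<^sub>F t in at_right 0. \<forall>i j. cmod (quot t (ground_hs m c) i j - ?\<eta> i j) \<le> cmod (h i j)"
      using pos
    proof (eventually_elim, intro allI)
      fix t :: real and i j assume t: "0 < t"
      show "cmod (quot t (ground_hs m c) i j - ?\<eta> i j) \<le> cmod (h i j)"
      proof (cases "j = i + m")
        case True
        have "cmod (quot t (ground_hs m c) i j) = w i j * (cmod (evol t ?u i j - ?u i j) / t)"
          using t w_pos[of i j] unfolding quot[OF t] by (simp add: norm_mult norm_divide)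
        also have "\<dots> \<le> w i j * ((cmod (cc i j) - cr i j) * ground m c i j)"
          using evol_ground_increment[OF c m, of t i] t w_pos[of i j] unfolding True
          by (intro mult_left_mono) (auto simp: divide_le_eq)
        also have "\<dots> = (cmod (cc i j) - cr i j) * (w i j * ground m c i j)" by (simp only: mult_ac)
        also have "\<dots> \<le> K * (real i + 1)\<^sup>2 * (w i j * ground m c i j)"
          using K(2)[of i] unfolding True by (intro mult_right_mono wg)
        finally have "cmod (quot t (ground_hs m c) i j) \<le> K * (real i + 1)\<^sup>2 * (w i j * ground m c i j)" .
        then have "cmod (quot t (ground_hs m c) i j - ?\<eta> i j) \<le> K * (real i + 1)\<^sup>2 * (w i j * ground m c i j) + (K + R) * (real i + 1)\<^sup>2 * (w i j * ground m c i j)"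
          using \<eta>_le[of i] unfolding True by (intro order_trans[OF norm_triangle_ineq4] add_mono)
        also have "\<dots> = (2 * K + R) * (w i j * ((real i + 1)\<^sup>2 * ground m c i j))"
          by (simp add: algebra_simps)
        also have "\<dots> \<le> cmod (h i j)"
          unfolding h_def norm_of_real by simp
        finally show ?thesis .
      next
        case False
        \<comment> \<open>Off the diagonal the dominating ground state is zero.\<close>
        have "evol t ?u i j = 0"
          using evol_ground_le[OF c m, of t i j] t u0[OF False] by simp
        then show ?thesis
          using u0[OF False] unfolding quot[OF t] by (simp add: ground_hs_def)
      qed
    qed
    fix i j
    have d: "((\<lambda>t. (evol t ?u i j - evol 0 ?u i j) / of_real t) \<longlongrightarrow> cc i j * evol 0 ?u i j + jump al be (evol 0 ?u) i j) (at_right 0)"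
      by (rule has_vector_derivative_at_right_quotient[OF evol_deriv[where x = ?u, OF e]]) simp
    have DS0: "evol 0 ?u = ?u" by (intro ext evol_0[where x = ?u, OF e])
    \<comment> \<open>The eigenvalue equation turns the jump term into a multiplier; since
      \<open>Re cc = cr\<close>, the total multiplier has real part \<open>- rate m\<close>.\<close>
    have val: "of_real (w i j) * (cc i j * ?u i j + jump al be ?u i j) = ?\<eta> i j" if "j = i + m"
    proof -
      have "jump al be ?u i j = of_real (jump al be (ground m c) i j)" by (simp add: jump_def)
      also have "jump al be (ground m c) i j = (- cr i j - rate m) * ground m c i j"
        unfolding that by (rule jump_ground_seq[where c = c]) (simp add: ground_def)
      finally have J: "jump al be ?u i j = of_real (- cr i j - rate m) * ?u i j" by simp
      show ?thesis unfolding J ground_hs_def of_real_mult by (simp only: distrib_left distrib_right mult_ac)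
    qed
    have "((\<lambda>t. quot t (ground_hs m c) i j) \<longlongrightarrow> ?\<eta> i j) (at_right 0)"
    proof (cases "j = i + m")
      case True
      have "((\<lambda>t. of_real (w i j) * ((evol t ?u i j - ?u i j) / of_real t)) \<longlongrightarrow> of_real (w i j) * (cc i j * ?u i j + jump al be ?u i j)) (at_right 0)"
        using d unfolding DS0 by (rule tendsto_mult_left)
      then show ?thesis
        unfolding val[OF True] by (rule Lim_transform_eventually) (use pos quot in \<open>auto elim!: eventually_mono\<close>)
    next
      case False
      have "\<forall>\<^sub>F t in at_right 0. 0 = quot t (ground_hs m c) i j"
        using pos
      proof eventually_elim
        case (elim t)
        then have "evol t ?u i j = 0"
          using evol_ground_le[OF c m, of t i j] u0[OF False] by simp
        then show ?case using quot[OF elim, of i j] u0[OF False] by simp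
      qed
      from Lim_transform_eventually[OF tendsto_const this] show ?thesis
        using u0[OF False] by (simp add: ground_hs_def)
    qed
    then show "((\<lambda>t. quot t (ground_hs m c) i j - ?\<eta> i j) \<longlongrightarrow> 0) (at_right 0)"
      by (simp add: LIM_zero_iff)
  qed
  then show ?thesis using \<eta>_hs by (simp add: gen_conv_hs_evol)
qed

lemma ground_state:
  assumes m: "m \<ge> 1"
  obtains \<xi> where "\<xi> \<in> dom_gen r lam mu zp zm" "hs_norm \<xi> = 1" "\<xi> \<in> Gsub (int m)"
    "dirichlet r lam mu zp zm \<xi> = rate m"
proof -
  \<comment> \<open>One nonzero entry, the corner of the diagonal, makes the vector
    normalisable.\<close>
  have "0 < cmod (ground_hs m 1 0 m)"
    using w_pos[of 0 m] ground_seq_pos[of m 0] by (simp add: ground_hs_def ground_def)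
  also have "\<dots> \<le> hs_norm (ground_hs m 1)" by (intro hs_entry_le ground_hs_hs) simp
  finally have n: "hs_norm (ground_hs m 1) > 0" .
  define c where "c = 1 / hs_norm (ground_hs m 1)"
  have c: "c \<ge> 0" using n by (simp add: c_def)
  have scale: "ground_hs m c = (\<lambda>i j. of_real c * ground_hs m 1 i j)"
    by (auto simp: ground_hs_def ground_def fun_eq_iff)
  have n1: "hs_norm (ground_hs m c) = 1"
    unfolding scale hs_norm_cmult norm_of_real using n by (simp add: c_def)
  note hs = ground_hs_hs[OF c, of m]
  note conv = gen_ground_hs[OF c m]
  have "Re (hs_inner (ground_hs m c) (\<lambda>i j. (cc i j + of_real (- cr i j - rate m)) * ground_hs m c i j)) = - rate m * (hs_norm (ground_hs m c))\<^sup>2"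
    using conv by (intro Re_hs_inner_multiplier hs) (auto simp: gen_conv_hs_evol Re_cc)
  then have "dirichlet r lam mu zp zm (ground_hs m c) = rate m"
    by (simp add: dirichlet_def gen_eq[OF hs conv] n1)
  moreover have "ground_hs m c \<in> dom_gen r lam mu zp zm"
    using hs conv by (auto simp: dom_gen_def)
  moreover have "ground_hs m c \<in> Gsub (int m)"
    by (rule GsubI[OF hs]) (simp add: ground_hs_def ground_def)
  ultimately show ?thesis using n1 by (intro that)
qed

lemma gapA_eq_rate: "m \<ge> 1 \<Longrightarrow> gapA r lam mu zp zm (int m) = rate m"
proof -
  assume m: "m \<ge> 1"
  obtain \<xi> where "\<xi> \<in> dom_gen r lam mu zp zm" "hs_norm \<xi> = 1" "\<xi> \<in> Gsub (int m)"
    "dirichlet r lam mu zp zm \<xi> = rate m" using ground_state[OF m] .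
  then have "rate m \<in> {dirichlet r lam mu zp zm \<xi> | \<xi>. \<xi> \<in> dom_gen r lam mu zp zm \<and> hs_norm \<xi> = 1 \<and> \<xi> \<in> Gsub (int m)}"
    unfolding mem_Collect_eq by (intro exI[of _ \<xi>]) simp
  then show ?thesis
    unfolding gapA_def by (rule cInf_eq_minimum) (auto intro: dirichlet_ge_rate)
qed

text \<open>As a quadratic in \<open>m\<close>, the difference contains the factor
  \<open>m - 1\<close>; the cofactor is nonnegative by comparing \<open>lam\<^sup>2 * r\<close> with
  \<open>mu\<^sup>2 * r\<close>.\<close>

lemma rate_min: "m \<ge> 1 \<Longrightarrow> rate 1 \<le> rate m"
proof -
  assume m: "m \<ge> 1"
  have l: "lam\<^sup>2 \<le> mu\<^sup>2" using lam_pos lam_mu by (intro power_mono) auto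
  have "(real m - 1) * (mu\<^sup>2 * (real m + r) + lam\<^sup>2 * (real m + 2 - r)) \<ge> 0"
  proof (rule mult_nonneg_nonneg)
    have "lam\<^sup>2 * r \<le> mu\<^sup>2 * r" using l r_pos by (intro mult_right_mono) auto
    moreover have "mu\<^sup>2 * real m \<ge> 0" "lam\<^sup>2 * (real m + 2) \<ge> 0" by auto
    moreover have "mu\<^sup>2 * (real m + r) + lam\<^sup>2 * (real m + 2 - r) = (mu\<^sup>2 * real m + lam\<^sup>2 * (real m + 2)) + (mu\<^sup>2 * r - lam\<^sup>2 * r)"
      by (simp add: algebra_simps)
    ultimately show "mu\<^sup>2 * (real m + r) + lam\<^sup>2 * (real m + 2 - r) \<ge> 0" by linarith
  qed (use m in simp)
  moreover have "rate m - rate 1 = (real m - 1) * (mu\<^sup>2 * (real m + r) + lam\<^sup>2 * (real m + 2 - r)) / 2"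
    by (simp add: rate_def field_simps)
  ultimately show ?thesis by simp
qed

lemma rate_nu:
  "rate m = mu\<^sup>2 * real m / 2 * ((real m + r - 1) + (lam / mu)\<^sup>2 * (real m - r + 1))"
  using mu_pos by (simp add: rate_def power_divide field_simps)

lemma rate_1: "rate 1 = mu\<^sup>2 / 2 * (2 * (lam / mu)\<^sup>2 + (1 - (lam / mu)\<^sup>2) * r)"
  unfolding rate_nu by (simp add: algebra_simps)

end

theorem theorem6p6:
  fixes r lam mu zp zm :: real
  assumes "r > 0" and "0 < lam" and "lam < mu"
  shows "(INF m\<in>{1::int..}. gapA r lam mu zp zm m)
           = (INF m\<in>{1::int..}. mu^2 * of_int m / 2 *
                 ((of_int m + r - 1) + (lam/mu)^2 * (of_int m - r + 1)))
       \<and> (INF m\<in>{1::int..}. mu^2 * of_int m / 2 *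
                 ((of_int m + r - 1) + (lam/mu)^2 * (of_int m - r + 1)))
           = mu^2 / 2 * (2 * (lam/mu)^2 + (1 - (lam/mu)^2) * r)"
proof -
  interpret qds r lam mu zp zm by unfold_locales (use assms in auto)
  have rate: "mu\<^sup>2 * of_int m / 2 * ((of_int m + r - 1) + (lam / mu)\<^sup>2 * (of_int m - r + 1)) = rate (nat m)"
    if "m \<in> {1::int..}" for m
    using that by (simp add: rate_nu)
  have gap: "gapA r lam mu zp zm m = rate (nat m)" if "m \<in> {1::int..}" for m
    using gapA_eq_rate[of "nat m"] that by simp
  have inf: "(INF m\<in>{1::int..}. rate (nat m)) = rate 1"
  proof (rule cInf_eq_minimum)
    show "rate 1 \<in> (\<lambda>m. rate (nat m)) ` {1::int..}"
      by (rule image_eqI[of _ _ 1]) auto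
    show "rate 1 \<le> x" if "x \<in> (\<lambda>m. rate (nat m)) ` {1::int..}" for x
      using that by (auto simp del: One_nat_def intro!: rate_min)
  qed
  have "(INF m\<in>{1::int..}. gapA r lam mu zp zm m) = (INF m\<in>{1::int..}. rate (nat m))"
    by (rule INF_cong[OF refl gap])
  moreover have "(INF m\<in>{1::int..}. mu^2 * of_int m / 2 * ((of_int m + r - 1) + (lam/mu)^2 * (of_int m - r + 1)))
      = (INF m\<in>{1::int..}. rate (nat m))"
    by (rule INF_cong[OF refl rate])
  ultimately show ?thesis unfolding inf rate_1 by simp
qed

end
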